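(* Let $\upsilon_n$ be the sequence of experiments based on i.i.d. random variables $(X_1,\dots,X_n)$ with joint distribution $P_{n,\xi_n,\theta_n}$, where $\xi_n=(\xi_{10},\xi_{20})+(\delta_1,\delta_2)n^{-1/4}$ and $\theta_n=\theta+\delta_3n^{-1/2}$, on the sample space $(\mathcal{X}_n,\mathcal{A}_n)$. Suppose the log-likelihood ratio satisfies $$\log\left(\frac{dP_{n,\xi_n,\theta_n}}{dP_{n,\xi_0,\theta}}\right)=t^\top S_n-\tfrac12t^\top Jt+o_P(1),\qquad t=(\delta_1^2,\delta_2^2,2\delta_1\delta_2,\delta_3^\top)^\top,$$ with $S_n=(S_{\xi_1^2,n},S_{\xi_2^2,n},S_{\xi_1\xi_2,n},S_{\theta,n}^\top)^\top$ converging in distribution under $P_{n,\xi_0,\theta}$ to $\mathcal{N}(0,J)$, $J$ non-singular. Then the limit experiment of $\upsilon_n$ is based on observing one sample from $Y=t+\nu$ with $t=(\delta_1^2,\delta_2^2,2\delta_1\delta_2,\delta_3^\top)^\top\in\mathbb{R}_+^2\times\mathbb{R}\times\mathbb{R}^p$ and $\nu\sim\mathcal{N}(0,J^{-1})$. Consider jointly testing $H_0:\delta_1=\delta_2=0$ against $H_a:\delta_1\neq0$ or $\delta_2\neq0$. Let $\tilde S_{\xi,n}=(\tilde S_{\xi_1^2,n},\tilde S_{\xi_2^2,n},\tilde S_{\xi_1\xi_2,n})^\top$ and $\Sigma$ be the residual score and its covariance matrix (defined in the context). Let $u_n=(u_{1n},u_{2n})^\top=(\tilde S_{\xi_1^2,n},\tilde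 S_{\xi_2^2,n})^\top-\Sigma_{(12)}\Sigma_{(22)}^{-1}\tilde S_{\xi_1\xi_2,n}$ and let $\Lambda$ be the Cholesky factor of $\Sigma_{11.2}:=\Sigma_{(11)}-\Sigma_{(12)}\Sigma_{(22)}^{-1}\Sigma_{(21)}$, that is $$\Lambda=\begin{pmatrix}\sqrt{v_1}&0\\ \rho\sqrt{v_2}&\sqrt{v_2}\sqrt{1-\rho^2}\end{pmatrix},$$ where $\rho$ is the correlation coefficient between $u_{1n}$ and $u_{2n}$ and $v_1,v_2$ are their respective variances. Define $$w_n=(w_{1n},w_{2n})^\top=\Lambda^{-1}u_n=\begin{pmatrix}u_{1n}/\sqrt{v_1}\\ (1-\rho^2)^{-1/2}(u_{2n}/\sqrt{v_2}-\rho u_{1n}/\sqrt{v_1})\end{pmatrix},\qquad w_{3n}=\Sigma_{(22)}^{-1/2}\tilde S_{\xi_1\xi_2,n}.$$ Then the $C(\alpha)$ test statistic (see the context) is one of the following four cases: $$T_n=\begin{cases}w_{1n}^2+w_{2n}^2+w_{3n}^2&\text{if } w_{1n}\ge\frac{\rho}{\sqrt{1-\rho^2}}w_{2n},\ w_{2n}\ge0,\\ w_{1n}^2+w_{3n}^2&\text{if } w_{2n}\le0,\ w_{1n}\ge0,\\ (\rho w_{1n}+\sqrt{1-\rho^2}\,w_{2n})^2+w_{3n}^2&\text{if } -\frac{\sqrt{1-\rho^2}}{\rho}w_{2n}\le w_{1n}\le\frac{\rho}{\sqrt{1-\rho^2}}w_{2n},\ w_{2n}\ge0,\\ w_{3n}^2&\text{if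 } w_{1n}\le0,\ w_{2n}\le-\frac{\rho}{\sqrt{1-\rho^2}}w_{1n}.\end{cases}$$ Under $H_0$, the asymptotic distribution of $T_n$ is the mixture $\left(\frac12-\frac{\beta}{2\pi}\right)\chi_1^2+\frac12\chi_2^2+\frac{\beta}{2\pi}\chi_3^2$ with $\beta=\cos^{-1}(\rho)$.
   Context: Setting. $X_1,\dots,X_n$ is an i.i.d. sample with density $p(x;\xi,\theta)$ with respect to a measure $\mu$; $P_{n,\xi,\theta}$ is the joint distribution of the sample. The parameters under test are $\xi=(\xi_1,\xi_2)\in\Xi\subset\mathbb{R}^2$ with null value $\xi_0=(\xi_{10},\xi_{20})$, and $\theta\in\Theta\subset\mathbb{R}^p$ are nuisance parameters. At $\xi_0$ the first-order scores for $\xi_1,\xi_2$ vanish, while the elements of the second-order score matrix do not vanish. Scores (under regularity): for $k=1,2$, $$S_{\xi_k^2,n}=\frac{1}{2\sqrt n}\sum_i\frac{\nabla_{\xi_k\xi_k}^2p(X_i;\xi_0,\theta)}{p(X_i;\xi_0,\theta)}\mathbb{I}_{[p(X_i;\xi_0,\theta)>0]},\quad S_{\xi_1\xi_2,n}=\frac{1}{2\sqrt n}\sum_i\frac{\nabla_{\xi_1\xi_2}^2p(X_i;\xi_0,\theta)}{p(X_i;\xi_0,\theta)}\mathbb{I}_{[p(X_i;\xi_0,\theta)>0]},$$ and $S_{\theta,n}=\frac{1}{\sqrt n}\sum_i\frac{\nabla_\theta p(X_i;\xi_0,\theta)}{p(X_i;\xi_0,\theta)}\mathbb{I}_{[p(X_i;\xi_0,\theta)>0]}$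 (a vector in $\mathbb{R}^p$). Information: $J=\begin{pmatrix}J_{\xi\xi}&J_{\xi\theta}\\ J_{\theta\xi}&J_{\theta\theta}\end{pmatrix}$ is the associated information (covariance) matrix of $S_n$, with $J_{\xi\xi}$ a $3\times3$ block. Residual score: $\tilde S_{\xi,n}=(\tilde S_{\xi_1^2,n},\tilde S_{\xi_2^2,n},\tilde S_{\xi_1\xi_2,n})^\top:=(S_{\xi_1^2,n},S_{\xi_2^2,n},S_{\xi_1\xi_2,n})^\top-J_{\xi\theta}J_{\theta\theta}^{-1}S_{\theta,n}$, with covariance matrix $\Sigma=J_{\xi\xi}-J_{\xi\theta}J_{\theta\theta}^{-1}J_{\theta\xi}=\begin{pmatrix}\Sigma_{(11)}&\Sigma_{(12)}\\ \Sigma_{(21)}&\Sigma_{(22)}\end{pmatrix}$, where $\Sigma_{(11)}$ is the $2\times2$ block for the first two elements of $\tilde S_{\xi,n}$. Limit experiment: a sequence of experiments $(P_{n,h}:h\in H)$ has limit experiment $(P_h:h\in H)$ if for every $h_0\in H$ and finite $I\subset H$ the likelihood ratio process $(dP_{n,h}/dP_{n,h_0})_{h\in I}$ converges in distribution under $P_{n,h_0}$ to $(dP_h/dP_{h_0})_{h\in I}$ under $P_{h_0}$. $C(\alpha)$ test statistic: it is constructed as the likelihood ratio statistic treating $\Sigma^{-1}\tilde S_{\xi,n}$ as the single observation in the limit experiment, $$T_n=\tilde S_{\xi,n}^\top\Sigma^{-1}\tilde S_{\xi,n}-\inf_{\mu\in\mathcal{C}}(\Sigma^{-1}\tilde S_{\xi,n}-\mu)^\top\Sigma(\Sigma^{-1}\tilde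 S_{\xi,n}-\mu),\qquad\mathcal{C}=\mathbb{R}_+^2\times\mathbb{R}.$$ $\chi_k^2$ denotes the chi-squared distribution with $k$ degrees of freedom.
   Formalization: The printed third case divides by ρ, and for ρ ≤ 0 the four cases are not exhaustive. Exhaustiveness is proved as printed for ρ > 0, and for all |ρ| < 1 with the third condition read as ρw₁+√(1−ρ²)w₂ ≥ 0, w₁ ≤ ρw₂/√(1−ρ²); the four printed implications hold for all ρ. *)

theory Defs
  imports "HOL-Probability.Probability"
begin

section \<open>Convergence in distribution, likelihood ratios, limit experiments\<close>

text \<open>
  The values lie in an arbitrary topological space, so that likelihood ratio processes are covered as
  well; for real values this is the library's \<open>weak_conv_m\<close> of the induced distributions.
\<close>

definition conv_in_dist ::
  "(nat \<Rightarrow> 'a measure) \<Rightarrow> (nat \<Rightarrow> 'a \<Rightarrow> 'c::topological_space) \<Rightarrow> 'b measure \<Rightarrow> ('b \<Rightarrow> 'c) \<Rightarrow> bool"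
  where "conv_in_dist P X Q Y \<longleftrightarrow>
    (\<forall>f :: 'c \<Rightarrow> real. continuous_on UNIV f \<and> bounded (range f) \<longrightarrow>
       (\<lambda>n. \<integral>\<omega>. f (X n \<omega>) \<partial>P n) \<longlonglongrightarrow> (\<integral>\<omega>. f (Y \<omega>) \<partial>Q))"

text \<open>
  \<open>lik_ratio Q P\<close> is \<open>dQ/dP\<close> in the sense used for experiments: the density with respect to \<open>P\<close> of
  the absolutely continuous part of \<open>Q\<close>. It is unique up to \<open>P\<close>-null sets.
  (The library's \<open>RN_deriv\<close> is only meaningful when \<open>Q\<close> is absolutely continuous.)
\<close>

definition lik_ratio :: "'a measure \<Rightarrow> 'a measure \<Rightarrow> 'a \<Rightarrow> real"
  where "lik_ratio Q P = (SOME f. f \<in> borel_measurable P \<and> (\<forall>x. 0 \<le> f x) \<and>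
    (\<exists>N\<in>null_sets P. \<forall>A\<in>sets P. emeasure Q (A - N) = (\<integral>\<^sup>+x\<in>A. ennreal (f x) \<partial>P)))"

text \<open>
  \<open>log (dQ\<^sub>n/dP\<^sub>n) = Z\<^sub>n + o\<^sub>P(1)\<close> under \<open>P\<^sub>n\<close>. The log-likelihood ratio is minus infinity where the
  ratio is zero, whereas \<open>ln 0 = 0\<close> in HOL; such points therefore count as exceptional.
\<close>

definition log_lr_expansion ::
  "(nat \<Rightarrow> 'a measure) \<Rightarrow> (nat \<Rightarrow> 'a measure) \<Rightarrow> (nat \<Rightarrow> 'a \<Rightarrow> real) \<Rightarrow> bool"
  where "log_lr_expansion Q P Z \<longleftrightarrow>
    (\<forall>\<epsilon>>0. (\<lambda>n. measure (P n) {\<omega> \<in> space (P n).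
        \<not> (0 < lik_ratio (Q n) (P n) \<omega> \<and> \<bar>ln (lik_ratio (Q n) (P n) \<omega>) - Z n \<omega>\<bar> \<le> \<epsilon>)})
      \<longlonglongrightarrow> 0)"

text \<open>
  The finite-dimensional vector \<open>(dP\<^sub>h/dP\<^bsub>h0\<^esub>)\<close>, \<open>h \<in> I\<close>, is encoded as a function on the whole index type,
  constantly zero off \<open>I\<close>. For finite \<open>I\<close>, convergence in distribution in the function space with its
  product topology is then convergence in distribution in \<open>\<real>\<^sup>I\<close>.
\<close>

definition lr_process :: "'h set \<Rightarrow> ('h \<Rightarrow> 'a measure) \<Rightarrow> 'h \<Rightarrow> 'a \<Rightarrow> ('h \<Rightarrow> real)"
  where "lr_process I E h0 \<omega> = (\<lambda>h. if h \<in> I then lik_ratio (E h) (E h0) \<omega> else 0)"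

definition limit_experiment ::
  "'h set \<Rightarrow> (nat \<Rightarrow> 'h \<Rightarrow> 'a measure) \<Rightarrow> ('h \<Rightarrow> 'b measure) \<Rightarrow> bool"
  where "limit_experiment H E F \<longleftrightarrow>
    (\<forall>h0\<in>H. \<forall>I. finite I \<and> I \<subseteq> H \<longrightarrow>
       conv_in_dist (\<lambda>n. E n h0) (\<lambda>n. lr_process I (E n) h0) (F h0) (lr_process I F h0))"

section \<open>Distributions and covariances\<close>

text \<open>Multivariate normal distribution with non-singular covariance matrix \<open>A\<close>.\<close>

definition mv_normal :: "real^'k \<Rightarrow> real^'k^'k \<Rightarrow> (real^'k) measure"
  where "mv_normal m A = density lborel (\<lambda>x. ennreal
    (exp (- ((x - m) \<bullet> (matrix_inv A *v (x - m))) / 2) / sqrt ((2 * pi) ^ CARD('k) * det A)))"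

definition chi_squared :: "nat \<Rightarrow> real measure"
  where "chi_squared k =
    distr (PiM {..<k} (\<lambda>_. std_normal_distribution)) borel (\<lambda>z. \<Sum>i<k. (z i)\<^sup>2)"

definition mixture :: "(real \<times> real measure) list \<Rightarrow> real measure"
  where "mixture ws =
    measure_of UNIV (sets borel) (\<lambda>A. \<Sum>(c, M)\<leftarrow>ws. ennreal c * emeasure M A)"

definition covar :: "'a measure \<Rightarrow> ('a \<Rightarrow> real) \<Rightarrow> ('a \<Rightarrow> real) \<Rightarrow> real"
  where "covar M X Y =
    (\<integral>\<omega>. (X \<omega> - (\<integral>\<omega>'. X \<omega>' \<partial>M)) * (Y \<omega> - (\<integral>\<omega>'. Y \<omega>' \<partial>M)) \<partial>M)"

definition has_cov_matrix :: "'a measure \<Rightarrow> ('a \<Rightarrow> real^'k) \<Rightarrow> real^'k^'k \<Rightarrow> bool"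
  where "has_cov_matrix M X A \<longleftrightarrow>
    (\<forall>i. (\<lambda>\<omega>. X \<omega> $ i) \<in> borel_measurable M \<and> integrable M (\<lambda>\<omega>. (X \<omega> $ i)\<^sup>2)) \<and>
    (\<forall>i j. covar M (\<lambda>\<omega>. X \<omega> $ i) (\<lambda>\<omega>. X \<omega> $ j) = A $ i $ j)"

definition is_cholesky_factor :: "real^2^2 \<Rightarrow> real^2^2 \<Rightarrow> bool"
  where "is_cholesky_factor L A \<longleftrightarrow>
    L $ 1 $ 2 = 0 \<and> 0 < L $ 1 $ 1 \<and> 0 < L $ 2 $ 2 \<and> L ** transpose L = A"

section \<open>The model, the scores and the local parameters\<close>

text \<open>
  \<open>p x \<xi> \<theta>\<close> is the density with respect to \<open>\<mu>\<close>; only its values for \<open>\<xi> \<in> \<Xi>\<close>, \<open>\<theta> \<in> \<Theta>\<close> are constrained.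
  The sample space for sample size \<open>n\<close> is the product of \<open>n\<close> copies of the space of \<open>\<mu>\<close>.
\<close>

definition density_family ::
  "'x measure \<Rightarrow> (real^2) set \<Rightarrow> (real^'p) set \<Rightarrow> ('x \<Rightarrow> real^2 \<Rightarrow> real^'p \<Rightarrow> real) \<Rightarrow> bool"
  where "density_family \<mu> \<Xi> \<Theta> p \<longleftrightarrow> (\<forall>\<xi>\<in>\<Xi>. \<forall>\<theta>\<in>\<Theta>.
    (\<lambda>x. p x \<xi> \<theta>) \<in> borel_measurable \<mu> \<and> (\<forall>x\<in>space \<mu>. 0 \<le> p x \<xi> \<theta>) \<and>
    (\<integral>\<^sup>+x. ennreal (p x \<xi> \<theta>) \<partial>\<mu>) = 1)"

definition joint_dist ::
  "'x measure \<Rightarrow> ('x \<Rightarrow> real^2 \<Rightarrow> real^'p \<Rightarrow> real) \<Rightarrow> nat \<Rightarrow> real^2 \<Rightarrow> real^'p \<Rightarrow> (nat \<Rightarrow> 'x) measure"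
  where "joint_dist \<mu> p n \<xi> \<theta> = PiM {..<n} (\<lambda>_. density \<mu> (\<lambda>x. ennreal (p x \<xi> \<theta>)))"

definition partial_deriv :: "'k \<Rightarrow> (real^'k \<Rightarrow> real) \<Rightarrow> real^'k \<Rightarrow> real"
  where "partial_deriv k f a = deriv (\<lambda>s. f (a + s *\<^sub>R axis k 1)) 0"

definition partial2_xi ::
  "('x \<Rightarrow> real^2 \<Rightarrow> real^'p \<Rightarrow> real) \<Rightarrow> real^2 \<Rightarrow> real^'p \<Rightarrow> 2 \<Rightarrow> 2 \<Rightarrow> 'x \<Rightarrow> real"
  where "partial2_xi p \<xi>0 \<theta> k l x = partial_deriv k (partial_deriv l (\<lambda>\<xi>. p x \<xi> \<theta>)) \<xi>0"

definition rel_to_density ::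
  "('x \<Rightarrow> real^2 \<Rightarrow> real^'p \<Rightarrow> real) \<Rightarrow> real^2 \<Rightarrow> real^'p \<Rightarrow> ('x \<Rightarrow> real) \<Rightarrow> 'x \<Rightarrow> real"
  where "rel_to_density p \<xi>0 \<theta> d x = (if p x \<xi>0 \<theta> > 0 then d x / p x \<xi>0 \<theta> else 0)"

text \<open>
  Summands of the scores: first order in \<open>\<xi>\<^sub>k\<close>, second order in \<open>\<xi>\<^sub>k, \<xi>\<^sub>l\<close> (before the factor 1/2),
  first order in \<open>\<theta>\<^sub>j\<close>.
\<close>

definition xi_score1 ::
  "('x \<Rightarrow> real^2 \<Rightarrow> real^'p \<Rightarrow> real) \<Rightarrow> real^2 \<Rightarrow> real^'p \<Rightarrow> 2 \<Rightarrow> 'x \<Rightarrow> real"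
  where "xi_score1 p \<xi>0 \<theta> k = rel_to_density p \<xi>0 \<theta> (\<lambda>x. partial_deriv k (\<lambda>\<xi>. p x \<xi> \<theta>) \<xi>0)"

definition xi_score2 ::
  "('x \<Rightarrow> real^2 \<Rightarrow> real^'p \<Rightarrow> real) \<Rightarrow> real^2 \<Rightarrow> real^'p \<Rightarrow> 2 \<Rightarrow> 2 \<Rightarrow> 'x \<Rightarrow> real"
  where "xi_score2 p \<xi>0 \<theta> k l = rel_to_density p \<xi>0 \<theta> (partial2_xi p \<xi>0 \<theta> k l)"

definition theta_score ::
  "('x \<Rightarrow> real^2 \<Rightarrow> real^'p \<Rightarrow> real) \<Rightarrow> real^2 \<Rightarrow> real^'p \<Rightarrow> 'p \<Rightarrow> 'x \<Rightarrow> real"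
  where "theta_score p \<xi>0 \<theta> j =
    rel_to_density p \<xi>0 \<theta> (\<lambda>x. partial_deriv j (\<lambda>\<theta>'. p x \<xi>0 \<theta>') \<theta>)"

text \<open>
  The derivatives in the scores exist wherever they are used, the scores are random variables, the first-order scores for
  \<open>\<xi>\<close> vanish at \<open>\<xi>0\<close> and the second-order ones do not.
\<close>

definition second_order_regular ::
  "'x measure \<Rightarrow> ('x \<Rightarrow> real^2 \<Rightarrow> real^'p \<Rightarrow> real) \<Rightarrow> real^2 \<Rightarrow> real^'p \<Rightarrow> bool"
  where "second_order_regular \<mu> p \<xi>0 \<theta> \<longleftrightarrow>
    (AE x in \<mu>. p x \<xi>0 \<theta> > 0 \<longrightarrow>
       (\<forall>\<^sub>F \<xi> in nhds \<xi>0. (\<lambda>\<xi>. p x \<xi> \<theta>) differentiable (at \<xi>)) \<and>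
       (\<forall>k. partial_deriv k (\<lambda>\<xi>. p x \<xi> \<theta>) differentiable (at \<xi>0)) \<and>
       p x \<xi>0 differentiable (at \<theta>)) \<and>
    (\<forall>k l. xi_score2 p \<xi>0 \<theta> k l \<in> borel_measurable \<mu>) \<and>
    (\<forall>j. theta_score p \<xi>0 \<theta> j \<in> borel_measurable \<mu>) \<and>
    (\<forall>k. AE x in \<mu>. xi_score1 p \<xi>0 \<theta> k x = 0) \<and>
    (\<forall>k l. \<not> (AE x in \<mu>. xi_score2 p \<xi>0 \<theta> k l x = 0))"

text \<open>
  Vectors in \<open>\<real>\<^sup>3 \<times> \<real>\<^sup>p\<close> are indexed by the sum type \<open>3 + 'p\<close>: \<open>Inl 1\<close>, \<open>Inl 2\<close>, \<open>Inl 3\<close> are the entries for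
  \<open>\<xi>\<^sub>1\<^sup>2\<close>, \<open>\<xi>\<^sub>2\<^sup>2\<close>, \<open>\<xi>\<^sub>1\<xi>\<^sub>2\<close> and \<open>Inr j\<close> those for \<open>\<theta>\<^sub>j\<close>.
\<close>

definition vec_append :: "real^3 \<Rightarrow> real^'p::finite \<Rightarrow> real^(3 + 'p)"
  where "vec_append a b = (\<chi> k. case k of Inl i \<Rightarrow> a $ i | Inr j \<Rightarrow> b $ j)"

definition xi_score_sum ::
  "('x \<Rightarrow> real^2 \<Rightarrow> real^'p \<Rightarrow> real) \<Rightarrow> real^2 \<Rightarrow> real^'p \<Rightarrow> nat \<Rightarrow> 2 \<Rightarrow> 2 \<Rightarrow> (nat \<Rightarrow> 'x) \<Rightarrow> real"
  where "xi_score_sum p \<xi>0 \<theta> n k l \<omega> =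
    1 / (2 * sqrt (real n)) * (\<Sum>i<n. xi_score2 p \<xi>0 \<theta> k l (\<omega> i))"

definition theta_score_sum ::
  "('x \<Rightarrow> real^2 \<Rightarrow> real^'p \<Rightarrow> real) \<Rightarrow> real^2 \<Rightarrow> real^'p \<Rightarrow> nat \<Rightarrow> (nat \<Rightarrow> 'x) \<Rightarrow> real^'p"
  where "theta_score_sum p \<xi>0 \<theta> n \<omega> =
    (\<chi> j. 1 / sqrt (real n) * (\<Sum>i<n. theta_score p \<xi>0 \<theta> j (\<omega> i)))"

definition score ::
  "('x \<Rightarrow> real^2 \<Rightarrow> real^'p::finite \<Rightarrow> real) \<Rightarrow> real^2 \<Rightarrow> real^'p \<Rightarrow> nat \<Rightarrow> (nat \<Rightarrow> 'x) \<Rightarrow> real^(3 + 'p)"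
  where "score p \<xi>0 \<theta> n \<omega> = vec_append
    (vector [xi_score_sum p \<xi>0 \<theta> n 1 1 \<omega>, xi_score_sum p \<xi>0 \<theta> n 2 2 \<omega>, xi_score_sum p \<xi>0 \<theta> n 1 2 \<omega>])
    (theta_score_sum p \<xi>0 \<theta> n \<omega>)"

text \<open>Local parameters are pairs \<open>\<delta> = ((\<delta>\<^sub>1, \<delta>\<^sub>2), \<delta>\<^sub>3)\<close>.\<close>

definition xi_loc :: "real^2 \<Rightarrow> (real^2) \<times> (real^'p) \<Rightarrow> nat \<Rightarrow> real^2"
  where "xi_loc \<xi>0 \<delta> n = \<xi>0 + (real n powr (-1/4)) *\<^sub>R fst \<delta>"

definition theta_loc :: "real^'p \<Rightarrow> (real^2) \<times> (real^'p) \<Rightarrow> nat \<Rightarrow> real^'p"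
  where "theta_loc \<theta> \<delta> n = \<theta> + (real n powr (-1/2)) *\<^sub>R snd \<delta>"

text \<open>
  The local parameters for which the sequence stays in the parameter space from some sample size on;
  all of \<open>\<real>\<^sup>2 \<times> \<real>\<^sup>p\<close> if \<open>\<xi>0\<close> and \<open>\<theta>\<close> are interior points.
\<close>

definition loc_params ::
  "(real^2) set \<Rightarrow> (real^'p) set \<Rightarrow> real^2 \<Rightarrow> real^'p \<Rightarrow> ((real^2) \<times> (real^'p)) set"
  where "loc_params \<Xi> \<Theta> \<xi>0 \<theta> =
    {\<delta>. \<forall>\<^sub>F n in sequentially. xi_loc \<xi>0 \<delta> n \<in> \<Xi> \<and> theta_loc \<theta> \<delta> n \<in> \<Theta>}"

definition loc_experiment ::
  "'x measure \<Rightarrow> ('x \<Rightarrow> real^2 \<Rightarrow> real^'p \<Rightarrow> real) \<Rightarrow> real^2 \<Rightarrow> real^'p \<Rightarrow>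
    nat \<Rightarrow> (real^2) \<times> (real^'p) \<Rightarrow> (nat \<Rightarrow> 'x) measure"
  where "loc_experiment \<mu> p \<xi>0 \<theta> n \<delta> = joint_dist \<mu> p n (xi_loc \<xi>0 \<delta> n) (theta_loc \<theta> \<delta> n)"

definition t_of :: "(real^2) \<times> (real^'p::finite) \<Rightarrow> real^(3 + 'p)"
  where "t_of \<delta> = vec_append
    (vector [(fst \<delta> $ 1)\<^sup>2, (fst \<delta> $ 2)\<^sup>2, 2 * (fst \<delta> $ 1) * (fst \<delta> $ 2)]) (snd \<delta>)"

section \<open>Residual score and the test statistic\<close>

definition info_xi_xi :: "real^(3 + 'p::finite)^(3 + 'p) \<Rightarrow> real^3^3"
  where "info_xi_xi J = (\<chi> i j. J $ Inl i $ Inl j)"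

definition info_xi_theta :: "real^(3 + 'p::finite)^(3 + 'p) \<Rightarrow> real^'p^3"
  where "info_xi_theta J = (\<chi> i j. J $ Inl i $ Inr j)"

definition info_theta_xi :: "real^(3 + 'p::finite)^(3 + 'p) \<Rightarrow> real^3^'p"
  where "info_theta_xi J = (\<chi> i j. J $ Inr i $ Inl j)"

definition info_theta_theta :: "real^(3 + 'p::finite)^(3 + 'p) \<Rightarrow> real^'p^'p"
  where "info_theta_theta J = (\<chi> i j. J $ Inr i $ Inr j)"

definition resid_score :: "real^(3 + 'p::finite)^(3 + 'p) \<Rightarrow> real^(3 + 'p) \<Rightarrow> real^3"
  where "resid_score J s =
    (\<chi> i. s $ Inl i) - (info_xi_theta J ** matrix_inv (info_theta_theta J)) *v (\<chi> j. s $ Inr j)"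

definition resid_cov :: "real^(3 + 'p::finite)^(3 + 'p) \<Rightarrow> real^3^3"
  where "resid_cov J =
    info_xi_xi J - info_xi_theta J ** matrix_inv (info_theta_theta J) ** info_theta_xi J"

text \<open>
  With the 2+1 block partition of a 3 by 3 matrix \<open>S\<close>: the Schur complement
  \<open>S\<^sub>1\<^sub>1 - S\<^sub>1\<^sub>2 S\<^sub>2\<^sub>2\<^sup>-\<^sup>1 S\<^sub>2\<^sub>1\<close> and the vector \<open>(s\<^sub>1, s\<^sub>2) - S\<^sub>1\<^sub>2 S\<^sub>2\<^sub>2\<^sup>-\<^sup>1 s\<^sub>3\<close>; the block \<open>S\<^sub>2\<^sub>2\<close> is the scalar \<open>S $ 3 $ 3\<close>.
\<close>

definition schur_11_2 :: "real^3^3 \<Rightarrow> real^2^2"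
  where "schur_11_2 S = vector
    [vector [S$1$1 - S$1$3 / S$3$3 * S$3$1, S$1$2 - S$1$3 / S$3$3 * S$3$2],
     vector [S$2$1 - S$2$3 / S$3$3 * S$3$1, S$2$2 - S$2$3 / S$3$3 * S$3$2]]"

definition u_vec :: "real^3^3 \<Rightarrow> real^3 \<Rightarrow> real^2"
  where "u_vec S s = vector [s$1 - S$1$3 / S$3$3 * s$3, s$2 - S$2$3 / S$3$3 * s$3]"

text \<open>The \<open>C(\<alpha>)\<close> statistic as a function of the matrix \<open>S\<close> and the residual score \<open>s\<close>.\<close>

definition calpha_cone :: "(real^3) set"
  where "calpha_cone = {m. 0 \<le> m $ 1 \<and> 0 \<le> m $ 2}"

definition calpha_stat :: "real^3^3 \<Rightarrow> real^3 \<Rightarrow> real"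
  where "calpha_stat S s = s \<bullet> (matrix_inv S *v s) -
    (INF m\<in>calpha_cone. (matrix_inv S *v s - m) \<bullet> (S *v (matrix_inv S *v s - m)))"

end

theory Submission
  imports Defs
begin

text \<open>
  Limit experiment. Truncation at a level \<open>K\<close> turns the expansion into \<open>min L\<^sub>n K - min (exp (z S\<^sub>n)) K \<rightarrow> 0\<close> in
  mean. Since the Gaussian limit of \<open>exp (z S\<^sub>n)\<close> has expectation 1, almost no mass is lost for large \<open>K\<close>, so
  integrals under the alternatives become integrals of \<open>min (exp (z S\<^sub>n)) K\<close> under the null (Le Cam's third
  lemma). Ratios with respect to another base point are quotients of ratios with respect to the null.

  Test statistic. Maximizing \<open>2 m \<bullet> s - m \<bullet> \<Sigma> m\<close> over the free third coordinate gives \<open>w\<^sub>3\<^sup>2\<close> and leaves, after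
  whitening, the projection of \<open>(w\<^sub>1, w\<^sub>2)\<close> onto a planar cone of angle \<open>\<beta> = arccos \<rho>\<close>. Under the null \<open>(w\<^sub>1, w\<^sub>2, w\<^sub>3)\<close>
  is standard normal; the four sectors have probabilities \<open>\<beta> / 2\<pi>\<close>, \<open>1/4\<close>, \<open>1/4\<close>, \<open>1/2 - \<beta> / 2\<pi>\<close> and on them
  the statistic is a sum of 3, 2, 2 and 1 independent squares.

  Both parts need the law of a linear image of a normal vector. It is obtained from the uniqueness of
  translation invariant measures, because dividing by the standard normal density makes the law invariant.
\<close>

section \<open>Linear maps and Lebesgue measure\<close>

text \<open>The norming constant of a multivariate normal law is never computed.
  \<open>mv_normal 0 J\<close> has mass 1 because it is a weak limit of probability measures, and
  the factor that translation invariance leaves open in a projected law is fixed by total mass. Only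
  the passage between the covariances \<open>J\<close> and \<open>matrix_inv J\<close> uses a
  determinant. Contiguity is not assumed. \<open>lik_ratio\<close> sees only the absolutely
  continuous part of an alternative; the limit having expectation 1 is what excludes a loss of mass
  to the singular part. The null hypothesis lets the nuisance parameter drift, so the score has
  limit mean \<open>J *v t\<close> with \<open>t\<close> in the nuisance block. The residual score
  is uncorrelated with the nuisance scores and does not see this mean. The third chamber is the
  delicate one: the condition with the quotient \<open>r / \<rho>\<close> describes it only for
  \<open>\<rho> > 0\<close>. The proof uses the sign of \<open>\<rho> * w1 + r * w2\<close>, the
  inner product with the unit edge \<open>(\<rho>, r)\<close>, which is right for every
  \<open>\<rho>\<close>. Local parameters may leave the parameter space at small sample sizes, so
  limits are taken along \<open>n + n0\<close>.\<close>

lemma nn_integral_lborel_shift: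
  fixes f :: "'a::euclidean_space \<Rightarrow> ennreal"
  assumes [measurable]: "f \<in> borel_measurable borel"
  shows "(\<integral>\<^sup>+x. f (x + a) \<partial>lborel) = (\<integral>\<^sup>+x. f x \<partial>lborel)"
proof -
  have "(\<integral>\<^sup>+x. f x \<partial>lborel) = (\<integral>\<^sup>+x. f x \<partial>distr lborel borel ((+) a))"
    by (simp add: lborel_distr_plus)
  also have "\<dots> = (\<integral>\<^sup>+x. f (a + x) \<partial>lborel)"
    by (subst nn_integral_distr) simp_all
  finally show ?thesis
    by (simp add: add.commute)
qed

text \<open>
  Fubini applied to \<open>1\<^sub>Q(y) f(g x + y)\<close> with \<open>Q\<close> the unit cube. Stating the invariance for a map \<open>g\<close>
  rather than for its image measure spares the \<open>\<sigma>\<close>-finiteness of the latter.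
\<close>

lemma nn_integral_translation_invariant:
  fixes g :: "'a \<Rightarrow> 'b::euclidean_space"
  assumes "sigma_finite_measure M" and [measurable]: "g \<in> borel_measurable M"
    and inv: "\<And>f a. f \<in> borel_measurable borel \<Longrightarrow>
      (\<integral>\<^sup>+x. f (g x + a) \<partial>M) = (\<integral>\<^sup>+x. f (g x) \<partial>M)"
  obtains c :: ennreal where
    "\<And>f. f \<in> borel_measurable borel \<Longrightarrow> (\<integral>\<^sup>+x. f (g x) \<partial>M) = c * (\<integral>\<^sup>+x. f x \<partial>lborel)"
proof -
  interpret M: sigma_finite_measure M by fact
  interpret pair_sigma_finite M "lborel :: 'b measure" ..
  let ?Q = "box 0 One :: 'b set"
  let ?I = "indicator ?Q :: 'b \<Rightarrow> ennreal"
  \<comment> \<open>The factor is the mass that the image measure gives to the reflected cube; it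
    may be infinite.\<close>
  define c where "c = (\<integral>\<^sup>+x. ?I (- g x) \<partial>M)"
  have Q: "(\<integral>\<^sup>+y. ?I y \<partial>lborel) = 1"
    by (simp add: emeasure_lborel_box)
  have "(\<integral>\<^sup>+x. f (g x) \<partial>M) = c * (\<integral>\<^sup>+x. f x \<partial>lborel)"
    if [measurable]: "f \<in> borel_measurable borel" for f
  proof -
    have "(\<integral>\<^sup>+x. f (g x) \<partial>M) = (\<integral>\<^sup>+y. ?I y * (\<integral>\<^sup>+x. f (g x) \<partial>M) \<partial>lborel)"
      by (subst nn_integral_multc) (simp_all add: Q)
    \<comment> \<open>Invariance is applied for each fixed \<open>y\<close>. After the swap the cube
      is moved by \<open>g x\<close>, and its \<open>M\<close>-integral no longer depends on
      \<open>y\<close>.\<close>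
    also have "\<dots> = (\<integral>\<^sup>+y. \<integral>\<^sup>+x. ?I y * f (g x + y) \<partial>M \<partial>lborel)"
      by (intro nn_integral_cong) (simp add: nn_integral_cmult inv)
    also have "\<dots> = (\<integral>\<^sup>+x. \<integral>\<^sup>+y. ?I y * f (g x + y) \<partial>lborel \<partial>M)"
      by (intro Fubini') measurable
    also have "\<dots> = (\<integral>\<^sup>+x. \<integral>\<^sup>+y. ?I (y - g x) * f y \<partial>lborel \<partial>M)"
      (is "(\<integral>\<^sup>+x. ?l x \<partial>M) = (\<integral>\<^sup>+x. ?r x \<partial>M)")
    proof (rule nn_integral_cong)
      show "?l x = ?r x" for x
        using nn_integral_lborel_shift[of "\<lambda>y. ?I (y - g x) * f y" "g x"]
        by (simp add: add.commute)
    qed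
    also have "\<dots> = (\<integral>\<^sup>+y. \<integral>\<^sup>+x. ?I (y - g x) * f y \<partial>M \<partial>lborel)"
      by (intro Fubini'[symmetric]) measurable
    also have "\<dots> = (\<integral>\<^sup>+y. c * f y \<partial>lborel)"
    proof (rule nn_integral_cong)
      fix y
      have "(\<integral>\<^sup>+x. ?I (y - g x) \<partial>M) = (\<integral>\<^sup>+x. ?I (- (g x + (- y))) \<partial>M)"
        by simp
      also have "\<dots> = c"
        unfolding c_def by (rule inv[of "\<lambda>x. ?I (- x)"]) measurable
      finally show "(\<integral>\<^sup>+x. ?I (y - g x) * f y \<partial>M) = c * f y"
        by (subst nn_integral_multc) simp_all
    qed
    finally show ?thesis
      by (simp add: nn_integral_cmult)
  qed
  then show ?thesis
    using that by blast
qed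

lemma measurable_matrix_vector_mult [measurable]:
  "(*v) (A :: real^'n^'m) \<in> borel_measurable borel"
  by (intro borel_measurable_continuous_onI matrix_vector_mult_linear_continuous_on)

lemma matrix_inv_mult:
  fixes A :: "real^'n^'n"
  assumes "invertible A"
  shows "A ** matrix_inv A = mat 1" "matrix_inv A ** A = mat 1"
  using someI_ex[of "\<lambda>A'. A ** A' = mat 1 \<and> A' ** A = mat 1"] assms
  unfolding invertible_def matrix_inv_def by blast+

text \<open>Compares the image of Lebesgue measure under \<open>A\<close> with Lebesgue measure. For
  invertible \<open>A\<close> the factor is \<open>1 / \<bar>det A\<bar>\<close>, reciprocal to the
  factor for volumes of images.\<close>

definition scales_lborel :: "real^'n^'n \<Rightarrow> ennreal \<Rightarrow> bool"
  where "scales_lborel A c \<longleftrightarrow> (\<forall>f\<in>borel_measurable borel.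
    (\<integral>\<^sup>+x. f (A *v x) \<partial>lborel) = c * (\<integral>\<^sup>+x. f x \<partial>lborel))"

lemma scales_lborel_mult:
  assumes "scales_lborel A a" "scales_lborel B b"
  shows "scales_lborel (A ** B) (b * a)"
proof -
  have "(\<integral>\<^sup>+x. f ((A ** B) *v x) \<partial>lborel) = b * a * (\<integral>\<^sup>+x. f x \<partial>lborel)"
    if [measurable]: "f \<in> borel_measurable borel" for f
  proof -
    have "(\<integral>\<^sup>+x. f ((A ** B) *v x) \<partial>lborel) = (\<integral>\<^sup>+x. f (A *v (B *v x)) \<partial>lborel)"
      by (simp add: matrix_vector_mul_assoc)
    also have "\<dots> = b * (\<integral>\<^sup>+x. f (A *v x) \<partial>lborel)"
      using assms(2) unfolding scales_lborel_def
      by (auto dest!: bspec[where x="\<lambda>y. f (A *v y)"])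
    also have "(\<integral>\<^sup>+x. f (A *v x) \<partial>lborel) = a * (\<integral>\<^sup>+x. f x \<partial>lborel)"
      using assms(1) that unfolding scales_lborel_def by blast
    finally show ?thesis by (simp add: mult.assoc)
  qed
  then show ?thesis
    unfolding scales_lborel_def by blast
qed

lemma scales_lborel_mat1: "scales_lborel (mat 1) 1"
  by (simp add: scales_lborel_def)

lemma scales_lborel_unique:
  fixes A :: "real^'n^'n"
  assumes "scales_lborel A a" "scales_lborel A b"
  shows "a = b"
proof -
  let ?f = "indicator (box 0 One) :: real^'n \<Rightarrow> ennreal"
  have "a * (\<integral>\<^sup>+x. ?f x \<partial>lborel) = b * (\<integral>\<^sup>+x. ?f x \<partial>lborel)"
    using assms unfolding scales_lborel_def by (metis borel_measurable_indicator borel_open open_box)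
  then show ?thesis
    by (simp add: emeasure_lborel_box)
qed

text \<open>A shift by \<open>a\<close> after \<open>A\<close> is a shift by
  \<open>matrix_inv A *v a\<close> before it, so the image of Lebesgue measure is translation
  invariant. The value of the factor stays open.\<close>

lemma scales_lborel_exists:
  fixes A :: "real^'n^'n"
  assumes "invertible A"
  obtains c where "scales_lborel A c"
proof -
  have "(\<integral>\<^sup>+x. f (A *v x + a) \<partial>lborel) = (\<integral>\<^sup>+x. f (A *v x) \<partial>lborel)"
    if [measurable]: "f \<in> borel_measurable borel" for f :: "real^'n \<Rightarrow> ennreal" and a
  proof -
    have "A *v (matrix_inv A *v a) = a"
      by (simp add: matrix_vector_mul_assoc matrix_inv_mult assms)
    then show ?thesis
      using nn_integral_lborel_shift[of "\<lambda>x. f (A *v x)" "matrix_inv A *v a"]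
      by (simp add: matrix_vector_right_distrib)
  qed
  then obtain c where "\<And>f. f \<in> borel_measurable borel \<Longrightarrow>
      (\<integral>\<^sup>+x. f (A *v x) \<partial>lborel) = c * (\<integral>\<^sup>+x. f x \<partial>lborel)"
    by (rule nn_integral_translation_invariant[OF sigma_finite_lborel, of "(*v) A", rotated])
      (auto intro: measurable_matrix_vector_mult)
  then show ?thesis
    using that by (auto simp: scales_lborel_def)
qed

text \<open>Factors multiply, so the factor of an involution is a nonnegative square root of 1. This
  replaces a Jacobian computation for swaps and, indirectly, for shears.\<close>

lemma scales_lborel_involution:
  fixes A :: "real^'n^'n"
  assumes "A ** A = mat 1"
  shows "scales_lborel A 1" "\<bar>det A\<bar> = 1"
proof -
  have "invertible A"
    using assms invertible_def by blast
  then obtain c where c: "scales_lborel A c"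
    using scales_lborel_exists by blast
  have "c * c = 1"
    using scales_lborel_unique[OF scales_lborel_mult[OF c c]] scales_lborel_mat1 assms by metis
  then have "c = 1"
  proof (cases c)
    case (real r)
    then have "r * r = 1"
      using \<open>c * c = 1\<close> by (simp flip: ennreal_mult')
    then show ?thesis
      using real by (auto simp: square_eq_1_iff)
  qed simp
  then show "scales_lborel A 1"
    using c by simp
  have "det A * det A = 1"
    using assms by (metis det_I det_mul)
  then show "\<bar>det A\<bar> = 1"
    by (auto simp: square_eq_1_iff)
qed

lemma scales_lborel_diagonal:
  fixes A :: "real^'n^'n"
  assumes diag: "\<And>i j. i \<noteq> j \<Longrightarrow> A $ i $ j = 0" and "det A \<noteq> 0"
  shows "scales_lborel A (ennreal (inverse \<bar>det A\<bar>))"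
proof -
  have det: "det A = (\<Prod>i\<in>UNIV. A $ i $ i)"
    using det_diagonal[OF diag] .
  then have nz: "A $ i $ i \<noteq> 0" for i
    using assms(2) by simp
  \<comment> \<open>The affine substitution wants one coefficient per basis vector;
    \<open>?c\<close> recovers the diagonal entry from \<open>axis i 1\<close>.\<close>
  let ?c = "\<lambda>b::real^'n. b \<bullet> (A *v b)"
  have Ai: "A *v x = (\<chi> i. A $ i $ i * x $ i)" for x
  proof -
    have "(\<Sum>j\<in>UNIV. A $ i $ j * x $ j) = (\<Sum>j\<in>UNIV. if j = i then A $ i $ i * x $ i else 0)" for i
      by (intro sum.cong) (auto simp: diag)
    then show ?thesis
      by (simp add: vec_eq_iff matrix_vector_mult_def)
  qed
  have c: "?c (axis i 1) = A $ i $ i" for i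
    by (simp only: inner_axis' Ai) (simp add: axis_def)
  have Av: "(\<Sum>j\<in>Basis. (?c j * (x \<bullet> j)) *\<^sub>R j) = A *v x" for x
  proof -
    have "(\<Sum>j\<in>Basis. (?c j * (x \<bullet> j)) *\<^sub>R j) = (\<Sum>j\<in>Basis. ((A *v x) \<bullet> j) *\<^sub>R j)"
      by (intro sum.cong refl) (auto simp: Basis_vec_def c inner_axis, simp add: Ai)
    then show ?thesis
      by (simp only: euclidean_representation)
  qed
  have "lborel = density (distr lborel borel (\<lambda>x. 0 + (\<Sum>j\<in>Basis. (?c j * (x \<bullet> j)) *\<^sub>R j)))
      (\<lambda>_. (\<Prod>j\<in>Basis. \<bar>?c j\<bar>))"
    using nz by (intro lborel_affine_euclidean) (auto simp: Basis_vec_def c)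
  also have "(\<Prod>j\<in>Basis. \<bar>?c j\<bar>) = \<bar>det A\<bar>"
    
  proof -
    have B: "(Basis :: (real^'n) set) = (\<lambda>i. axis i 1) ` UNIV"
      by (auto simp: Basis_vec_def)
    have "(\<Prod>j\<in>Basis. \<bar>?c j\<bar>) = (\<Prod>i\<in>UNIV. \<bar>?c (axis i 1)\<bar>)"
      unfolding B by (subst prod.reindex) (simp_all add: inj_on_def axis_eq_axis)
    then show ?thesis
      by (simp only: c det abs_prod)
  qed
  finally have L: "lborel = density (distr lborel borel ((*v) A)) (\<lambda>_. ennreal \<bar>det A\<bar>)"
    by (simp add: Av)
  show ?thesis
    unfolding scales_lborel_def
  proof
    fix f :: "real^'n \<Rightarrow> ennreal" assume [measurable]: "f \<in> borel_measurable borel"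
    have "(\<integral>\<^sup>+x. f x \<partial>lborel) = \<bar>det A\<bar> * (\<integral>\<^sup>+x. f (A *v x) \<partial>lborel)"
      by (subst L) (simp add: nn_integral_density nn_integral_distr nn_integral_cmult)
    then have "ennreal (inverse \<bar>det A\<bar>) * (\<integral>\<^sup>+x. f x \<partial>lborel) =
        ennreal (inverse \<bar>det A\<bar>) * ennreal \<bar>det A\<bar> * (\<integral>\<^sup>+x. f (A *v x) \<partial>lborel)"
      by (simp add: mult.assoc)
    also have "ennreal (inverse \<bar>det A\<bar>) * ennreal \<bar>det A\<bar> = 1"
      using assms(2) by (simp flip: ennreal_mult')
    finally show "(\<integral>\<^sup>+x. f (A *v x) \<partial>lborel) = ennreal (inverse \<bar>det A\<bar>) * (\<integral>\<^sup>+x. f x \<partial>lborel)"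
      by simp
  qed
qed

text \<open>Induction over elementary matrices. Only diagonal matrices need a computation: a swap is
  an involution and a shear is a product of two involutions.\<close>

proposition scales_lborel_det:
  fixes A :: "real^'n^'n"
  assumes "det A \<noteq> 0"
  shows "scales_lborel A (ennreal (inverse \<bar>det A\<bar>))"
proof -
  \<comment> \<open>The condition on the determinant moves into the induction formula because the
    induction also passes through matrices with a zero row.\<close>
  have "det A \<noteq> 0 \<longrightarrow> scales_lborel A (ennreal (inverse \<bar>det A\<bar>))"
  proof (induction A rule: induct_matrix_elementary_alt)
    case (1 A B)
    then show ?case
      using scales_lborel_mult[of A "ennreal (inverse \<bar>det A\<bar>)" B "ennreal (inverse \<bar>det B\<bar>)"]
      by (auto simp: det_mul abs_mult mult.commute simp flip: ennreal_mult')
  next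
    case (2 A i)
    then show ?case by (simp add: det_zero_row)
  next
    case (3 A)
    then show ?case using scales_lborel_diagonal by blast
  next
    case (4 m n)
    let ?E = "\<chi> i j. mat 1 $ i $ Transposition.transpose m n j :: real^'n^'n"
    have E: "?E *v x = (\<chi> i. x $ Transposition.transpose m n i)" for x
    proof -
      have "(\<Sum>j\<in>UNIV. mat 1 $ i $ Transposition.transpose m n j * x $ j) =
          (\<Sum>j\<in>UNIV. if j = Transposition.transpose m n i then x $ j else 0)" for i
        by (intro sum.cong) (auto simp: mat_def)
      then show ?thesis
        by (simp add: vec_eq_iff matrix_vector_mult_def)
    qed
    have "?E ** ?E = mat 1"
      by (simp only: matrix_eq matrix_vector_mul_assoc[symmetric] E matrix_vector_mul_lid) (simp add: vec_eq_iff)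
    from scales_lborel_involution[OF this] show ?case by simp
  next
    case (5 m n)
    let ?E = "\<chi> i j. of_bool (i = m \<and> j = n \<or> i = j) :: real^'n^'n"
    \<comment> \<open>Changing the sign of coordinate \<open>m\<close> after the shear gives an
      involution: \<open>x $ m\<close> becomes \<open>- (x $ m + x $ n)\<close>, and doing so twice
      restores it. Hence \<open>?E = ?D ** (?D ** ?E)\<close> has factor 1.\<close>
    let ?D = "\<chi> i j. if i = j then if i = m then -1 else 1 else 0 :: real^'n^'n"
    have E: "?E *v x = (\<chi> i. if i = m then x $ m + x $ n else x $ i)" for x
    proof -
      have "(\<Sum>j\<in>UNIV. of_bool (i = m \<and> j = n \<or> i = j) * x $ j) =
          (\<Sum>j\<in>UNIV. (if j = i then x $ i else 0) + (if j = n then if i = m then x $ n else 0 else 0))" for i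
        using 5 by (intro sum.cong) auto
      then show ?thesis
        by (auto simp: vec_eq_iff matrix_vector_mult_def sum.distrib)
    qed
    have D: "?D *v x = (\<chi> i. if i = m then - x $ i else x $ i)" for x
    proof -
      have "(\<Sum>j\<in>UNIV. (if i = j then if i = m then -1 else 1 else 0) * x $ j) =
          (\<Sum>j\<in>UNIV. if j = i then if i = m then - x $ i else x $ i else 0)" for i
        by (intro sum.cong) auto
      then show ?thesis
        by (auto simp: vec_eq_iff matrix_vector_mult_def)
    qed
    have "(?D ** ?E) ** (?D ** ?E) = mat 1"
      using 5 by (simp only: matrix_eq matrix_vector_mul_assoc[symmetric] E D matrix_vector_mul_lid) (simp add: vec_eq_iff)
    from scales_lborel_involution[OF this] have DE: "scales_lborel (?D ** ?E) 1" "\<bar>det (?D ** ?E)\<bar> = 1" .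
    have DD: "?D ** ?D = mat 1"
      by (simp only: matrix_eq matrix_vector_mul_assoc[symmetric] D matrix_vector_mul_lid) (simp add: vec_eq_iff)
    note SD = scales_lborel_involution[OF DD]
    have "scales_lborel (?D ** (?D ** ?E)) (1 * 1)"
      by (rule scales_lborel_mult) fact+
    then have "scales_lborel ?E 1"
      by (simp add: matrix_mul_assoc DD)
    moreover have "\<bar>det ?E\<bar> = 1"
      using SD DE by (simp add: det_mul abs_mult)
    ultimately show ?case by simp
  qed
  with assms show ?thesis by blast
qed

section \<open>Multivariate normal distributions\<close>

lemma matrix_inv_unique:
  fixes A B :: "real^'n^'n"
  assumes "A ** B = mat 1"
  shows "matrix_inv A = B"
proof -
  have "B ** A = mat 1"
    using assms by (simp add: matrix_left_right_inverse)
  then have "invertible A"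
    using assms invertible_def by blast
  then have "matrix_inv A ** (A ** B) = B"
    by (simp add: matrix_mul_assoc matrix_inv_mult)
  then show ?thesis
    by (simp add: assms)
qed

lemma matrix_inv_matrix_inv:
  fixes A :: "real^'n^'n"
  assumes "invertible A"
  shows "matrix_inv (matrix_inv A) = A"
  by (rule matrix_inv_unique) (simp add: matrix_inv_mult assms)

lemma inner_symmetric_matrix:
  fixes J :: "real^'n^'n"
  assumes "transpose J = J"
  shows "x \<bullet> (J *v y) = (J *v x) \<bullet> y"
  using dot_lmul_matrix[of x J y] vector_transpose_matrix[of x J] assms by simp

lemma sets_mv_normal [measurable_cong, simp]: "sets (mv_normal m A) = sets borel"
  and space_mv_normal [simp]: "space (mv_normal m A) = UNIV"
  by (simp_all add: mv_normal_def)

text \<open>The exponent of \<open>mv_normal 0 (matrix_inv J)\<close> at \<open>y\<close> is the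
  exponent of \<open>mv_normal 0 J\<close> at \<open>J *v y\<close>. This connects the observation
  \<open>Y\<close>, with noise covariance \<open>matrix_inv J\<close>, to the limit of the scores,
  with covariance \<open>J\<close>.\<close>

lemma mv_normal_image:
  fixes J :: "real^'n^'n"
  assumes sym: "transpose J = J" and det: "0 < det J"
  shows "distr (mv_normal 0 (matrix_inv J)) borel ((*v) J) = mv_normal 0 J"
proof (rule measure_eqI)
  have inv: "invertible J"
    using det by (simp add: invertible_det_nz)
  have det_inv: "det (matrix_inv J) = inverse (det J)"
    using arg_cong[OF matrix_inv_mult(1)[OF inv], of det] det by (simp add: det_mul field_simps)
  let ?k = "(2 * pi) ^ CARD('n)"
  fix B assume "B \<in> sets (distr (mv_normal 0 (matrix_inv J)) borel ((*v) J))"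
  then have [measurable]: "B \<in> sets borel" by simp
  define \<rho> where "\<rho> s = exp (- (s \<bullet> (matrix_inv J *v s)) / 2)" for s :: "real^'n"
  have [measurable]: "\<rho> \<in> borel_measurable borel"
    unfolding \<rho>_def by (intro borel_measurable_continuous_onI continuous_intros) auto
  have dens: "ennreal (exp (- ((y - 0) \<bullet> (matrix_inv (matrix_inv J) *v (y - 0))) / 2)
      / sqrt (?k * det (matrix_inv J))) = ennreal (\<rho> (J *v y) / sqrt (?k / det J))" for y
  proof -
    have "matrix_inv J *v (J *v y) = y"
      by (simp add: matrix_vector_mul_assoc matrix_inv_mult inv)
    moreover have "?k / det J = ?k * det (matrix_inv J)"
      by (simp add: det_inv divide_inverse)
    ultimately show ?thesis
      by (simp only: \<rho>_def matrix_inv_matrix_inv inv diff_zero inner_commute[of y])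
  qed
  \<comment> \<open>The Jacobian \<open>1 / det J\<close> turns the norming constant for the
    determinant \<open>1 / det J\<close> into the one for \<open>det J\<close>.\<close>
  have scal: "inverse \<bar>det J\<bar> * (\<rho> s / sqrt (?k / det J)) = \<rho> s / sqrt (?k * det J)" for s
  proof -
    have *: "inverse (S * S) * (r / (k / S)) = r / (k * S)" if "0 < S" "0 < k" for S k r :: real
      using that by (simp add: field_simps)
    have "\<bar>det J\<bar> = sqrt (det J) * sqrt (det J)"
      using det by simp
    then show ?thesis
      using *[of "sqrt (det J)" "sqrt ?k" "\<rho> s"] det
      by (simp only: real_sqrt_mult[of _ "det J"] real_sqrt_divide) simp
  qed
  have "emeasure (distr (mv_normal 0 (matrix_inv J)) borel ((*v) J)) B =
      (\<integral>\<^sup>+y. indicator B (J *v y) \<partial>mv_normal 0 (matrix_inv J))"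
    by (subst nn_integral_indicator[symmetric], simp, subst nn_integral_distr) simp_all
  also have "\<dots> = (\<integral>\<^sup>+y. ennreal (\<rho> (J *v y) / sqrt (?k / det J)) * indicator B (J *v y) \<partial>lborel)"
    unfolding mv_normal_def dens by (subst nn_integral_density) simp_all
  also have "\<dots> = ennreal (inverse \<bar>det J\<bar>) * (\<integral>\<^sup>+s. ennreal (\<rho> s / sqrt (?k / det J)) * indicator B s \<partial>lborel)"
    using scales_lborel_det[of J] det unfolding scales_lborel_def
    by (auto dest!: bspec[where x="\<lambda>s. ennreal (\<rho> s / sqrt (?k / det J)) * indicator B s"])
  also have "\<dots> = (\<integral>\<^sup>+s. ennreal (inverse \<bar>det J\<bar> * (\<rho> s / sqrt (?k / det J))) * indicator B s \<partial>lborel)"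
  proof -
    have "ennreal (inverse \<bar>det J\<bar> * (\<rho> s / sqrt (?k / det J))) =
        ennreal (inverse \<bar>det J\<bar>) * ennreal (\<rho> s / sqrt (?k / det J))" for s
      by (intro ennreal_mult') simp
    then show ?thesis
      by (simp only: mult.assoc) (subst nn_integral_cmult, simp_all)
  qed
  also have "\<dots> = emeasure (mv_normal 0 J) B"
    unfolding scal by (simp add: mv_normal_def emeasure_density \<rho>_def)
  finally show "emeasure (distr (mv_normal 0 (matrix_inv J)) borel ((*v) J)) B = emeasure (mv_normal 0 J) B" .
qed simp

text \<open>The Cameron-Martin formula, by completing the square: tilting by \<open>t\<close> moves
  the mean to \<open>J *v t\<close>. With \<open>f = 1\<close> it says that the limiting likelihood
  ratio has expectation 1.\<close>

lemma mv_normal_tilt: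
  fixes J :: "real^'n^'n"
  assumes sym: "transpose J = J" and inv: "invertible J" and [measurable]: "f \<in> borel_measurable borel"
  shows "(\<integral>\<^sup>+s. f s * ennreal (exp (t \<bullet> s - 1/2 * (t \<bullet> (J *v t)))) \<partial>mv_normal 0 J) =
    (\<integral>\<^sup>+s. f (s + J *v t) \<partial>mv_normal 0 J)"
proof -
  let ?c = "sqrt ((2 * pi) ^ CARD('n) * det J)"
  define q where "q s = exp (- (s \<bullet> (matrix_inv J *v s)) / 2)" for s
  have [measurable]: "q \<in> borel_measurable borel"
    unfolding q_def by (intro borel_measurable_continuous_onI continuous_intros) auto
  have mv: "mv_normal 0 J = density lborel (\<lambda>s. ennreal (q s / ?c))"
    by (simp add: mv_normal_def q_def)
  have symi: "x \<bullet> (matrix_inv J *v (J *v t)) = x \<bullet> t" "(J *v t) \<bullet> (matrix_inv J *v x) = t \<bullet> x" for x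
    by (simp_all add: matrix_vector_mul_assoc matrix_inv_mult inv flip: inner_symmetric_matrix[OF sym])
  have q: "q s = q (s + J *v t) * exp (t \<bullet> (s + J *v t) - 1/2 * (t \<bullet> (J *v t)))" for s
    unfolding q_def by (subst exp_add[symmetric])
      (simp add: matrix_vector_right_distrib inner_add_left inner_add_right symi inner_commute algebra_simps
        add_divide_distrib diff_divide_distrib)
  have "(\<integral>\<^sup>+s. f (s + J *v t) \<partial>mv_normal 0 J) = (\<integral>\<^sup>+s. ennreal (q s / ?c) * f (s + J *v t) \<partial>lborel)"
    unfolding mv by (subst nn_integral_density) simp_all
  also have "\<dots> = (\<integral>\<^sup>+s. ennreal (q s * exp (t \<bullet> s - 1/2 * (t \<bullet> (J *v t))) / ?c) * f s \<partial>lborel)"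
    by (subst q, subst nn_integral_lborel_shift) simp_all
  also have "\<dots> = (\<integral>\<^sup>+s. ennreal (q s / ?c) * (f s * ennreal (exp (t \<bullet> s - 1/2 * (t \<bullet> (J *v t))))) \<partial>lborel)"
  proof -
    have "ennreal (q s * exp (t \<bullet> s - 1/2 * (t \<bullet> (J *v t))) / ?c) =
        ennreal (q s / ?c) * ennreal (exp (t \<bullet> s - 1/2 * (t \<bullet> (J *v t))))" for s
      by (simp flip: ennreal_mult'')
    then show ?thesis
      by (simp only: ac_simps)
  qed
  also have "\<dots> = (\<integral>\<^sup>+s. f s * ennreal (exp (t \<bullet> s - 1/2 * (t \<bullet> (J *v t)))) \<partial>mv_normal 0 J)"
    unfolding mv by (subst nn_integral_density) simp_all
  finally show ?thesis by simp
qed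

text \<open>
  After division by the standard Gaussian density, the law of \<open>w\<close> becomes translation invariant.
\<close>

lemma mv_normal_projection:
  fixes J :: "real^'n^'n" and w :: "real^'n \<Rightarrow> 'b::euclidean_space"
  assumes sym: "transpose J = J" and inv: "invertible J" 
    and lin: "linear w" and adj: "\<And>a s. adj a \<bullet> s = a \<bullet> w s"
    and white: "\<And>a. w (J *v adj a) = a" and uncorrelated: "w (J *v t) = 0"
  obtains c :: ennreal where "\<And>g. g \<in> borel_measurable borel \<Longrightarrow>
    (\<integral>\<^sup>+s. g (w s) * ennreal (exp (t \<bullet> s - 1/2 * (t \<bullet> (J *v t)))) \<partial>mv_normal 0 J) =
    c * (\<integral>\<^sup>+x. g x * ennreal (exp (- (x \<bullet> x) / 2)) \<partial>lborel)"
proof -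
  have [measurable]: "w \<in> borel_measurable borel"
    using lin by (intro borel_measurable_continuous_onI linear_continuous_on) (simp add: linear_conv_bounded_linear)
  interpret w: linear w by fact
  let ?c = "sqrt ((2 * pi) ^ CARD('n) * det J)"
  \<comment> \<open>The normal density without its constant, times the tilt, divided by the standard
    Gaussian weight of \<open>w s\<close>.\<close>
  define q where "q s = exp (- (s \<bullet> (matrix_inv J *v s)) / 2) *
      exp (t \<bullet> s - 1/2 * (t \<bullet> (J *v t))) * exp ((w s \<bullet> w s) / 2)" for s
  have [measurable]: "q \<in> borel_measurable borel"
  proof -
    have "continuous_on UNIV (\<lambda>s. matrix_inv J *v s)"
      by (intro continuous_intros)
    from borel_measurable_continuous_onI[OF this] show ?thesis
      unfolding q_def by measurable
  qed
  let ?M = "density lborel (\<lambda>s. ennreal (q s / ?c))"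
  \<comment> \<open>The measure \<open>?M\<close> is to be mapped to a multiple of Lebesgue measure,
    so it is not finite in general. Sigma-finiteness, inherited from \<open>lborel\<close> since the
    density is finite, is what Fubini requires.\<close>
  have sigma: "sigma_finite_measure ?M"
    by (subst sigma_finite_measure.sigma_finite_iff_density_finite[OF sigma_finite_lborel]) simp_all
  have symi: "(J *v x) \<bullet> (matrix_inv J *v s) = x \<bullet> s" "s \<bullet> (matrix_inv J *v (J *v x)) = x \<bullet> s" for x s
  proof -
    have "matrix_inv J *v (J *v x) = x" "J *v (matrix_inv J *v s) = s"
      by (simp_all add: matrix_vector_mul_assoc matrix_inv_mult inv)
    then show "(J *v x) \<bullet> (matrix_inv J *v s) = x \<bullet> s" "s \<bullet> (matrix_inv J *v (J *v x)) = x \<bullet> s"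
      by (simp_all add: inner_commute[of s] flip: inner_symmetric_matrix[OF sym])
  qed
  have adj': "s \<bullet> adj a = a \<bullet> w s" for a s
    by (simp only: adj inner_commute[of s])
  \<comment> \<open>The move by \<open>J *v adj a\<close> multiplies the normal density by
    \<open>exp (- (a \<bullet> w s) - a \<bullet> a / 2)\<close>, by adjointness and whiteness. As
    \<open>w\<close> moves by \<open>a\<close>, the last factor gains the inverse. The tilt is
    unchanged because \<open>t \<bullet> (J *v adj a) = a \<bullet> w (J *v t) = 0\<close>.\<close>
  have shift: "q (s + J *v adj a) = q s" for s a
  proof -
    have "t \<bullet> (J *v adj a) = 0"
      using adj[of a "J *v t"] uncorrelated by (simp add: inner_symmetric_matrix[OF sym, of t] inner_commute[of "J *v t"])
    then show ?thesis
      unfolding q_def exp_add[symmetric]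
      by (simp add: matrix_vector_right_distrib inner_add_left inner_add_right symi adj adj' white w.add inner_commute
          algebra_simps add_divide_distrib diff_divide_distrib)
  qed
  have "(\<integral>\<^sup>+s. f (w s + a) \<partial>?M) = (\<integral>\<^sup>+s. f (w s) \<partial>?M)" if [measurable]: "f \<in> borel_measurable borel" for f a
  proof -
    have "(\<integral>\<^sup>+s. f (w s + a) \<partial>?M) = (\<integral>\<^sup>+s. ennreal (q (s + J *v adj a) / ?c) * f (w (s + J *v adj a)) \<partial>lborel)"
      by (simp add: nn_integral_density shift w.add white)
    also have "\<dots> = (\<integral>\<^sup>+s. f (w s) \<partial>?M)"
      by (subst nn_integral_lborel_shift[of "\<lambda>s. ennreal (q s / ?c) * f (w s)"]) (simp_all add: nn_integral_density)
    finally show ?thesis .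
  qed
  then obtain c where c: "\<And>f. f \<in> borel_measurable borel \<Longrightarrow>
      (\<integral>\<^sup>+s. f (w s) \<partial>?M) = c * (\<integral>\<^sup>+x. f x \<partial>lborel)"
    by (rule nn_integral_translation_invariant[OF sigma, of w, rotated]) auto
  have "(\<integral>\<^sup>+s. g (w s) * ennreal (exp (t \<bullet> s - 1/2 * (t \<bullet> (J *v t)))) \<partial>mv_normal 0 J) =
    c * (\<integral>\<^sup>+x. g x * ennreal (exp (- (x \<bullet> x) / 2)) \<partial>lborel)"
    if [measurable]: "g \<in> borel_measurable borel" for g
  proof -
    have [measurable]: "(\<lambda>s. matrix_inv J *v s) \<in> borel_measurable borel"
      by (intro borel_measurable_continuous_onI continuous_intros)
    have "(\<integral>\<^sup>+s. g (w s) * ennreal (exp (t \<bullet> s - 1/2 * (t \<bullet> (J *v t)))) \<partial>mv_normal 0 J) =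
        (\<integral>\<^sup>+s. ennreal (exp (- (s \<bullet> (matrix_inv J *v s)) / 2) / ?c) *
          (g (w s) * ennreal (exp (t \<bullet> s - 1/2 * (t \<bullet> (J *v t))))) \<partial>lborel)"
      unfolding mv_normal_def by (subst nn_integral_density) simp_all
    also have "\<dots> = (\<integral>\<^sup>+s. ennreal (q s / ?c) * (g (w s) * ennreal (exp (- (w s \<bullet> w s) / 2))) \<partial>lborel)"
    proof (rule nn_integral_cong)
      fix s
      have "q s / ?c * exp (- (w s \<bullet> w s) / 2) = exp (- (s \<bullet> (matrix_inv J *v s)) / 2) / ?c * exp (t \<bullet> s - 1/2 * (t \<bullet> (J *v t)))"
        by (simp add: q_def exp_minus field_simps)
      then have "ennreal (q s / ?c) * ennreal (exp (- (w s \<bullet> w s) / 2)) =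
          ennreal (exp (- (s \<bullet> (matrix_inv J *v s)) / 2) / ?c) * ennreal (exp (t \<bullet> s - 1/2 * (t \<bullet> (J *v t))))"
        by (simp only: ennreal_mult''[OF exp_ge_zero, symmetric])
      then show "ennreal (exp (- (s \<bullet> (matrix_inv J *v s)) / 2) / ?c) *
          (g (w s) * ennreal (exp (t \<bullet> s - 1/2 * (t \<bullet> (J *v t))))) =
          ennreal (q s / ?c) * (g (w s) * ennreal (exp (- (w s \<bullet> w s) / 2)))"
        by (simp only: mult.left_commute[of _ "g (w s)"])
    qed
    also have "\<dots> = c * (\<integral>\<^sup>+x. g x * ennreal (exp (- (x \<bullet> x) / 2)) \<partial>lborel)"
      by (subst c[symmetric]) (simp_all add: nn_integral_density)
    finally show ?thesis .
  qed
  then show ?thesis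
    using that by blast
qed

section \<open>Planar sectors\<close>

lemma nn_integral_reflect:
  fixes f :: "real \<Rightarrow> ennreal"
  assumes [measurable]: "f \<in> borel_measurable borel"
  shows "(\<integral>\<^sup>+x. f (- x) \<partial>lborel) = (\<integral>\<^sup>+x. f x \<partial>lborel)"
  by (subst (2) nn_integral_real_affine[where c="-1" and t=0]) simp_all

lemma nn_integral_even:
  fixes f :: "real \<Rightarrow> ennreal"
  assumes [measurable]: "f \<in> borel_measurable borel" and even: "\<And>x. f (- x) = f x"
  shows "(\<integral>\<^sup>+x. f x \<partial>lborel) = 2 * (\<integral>\<^sup>+x. f x * indicator {0<..} x \<partial>lborel)"
proof -
  have "(\<integral>\<^sup>+x. f x \<partial>lborel) = (\<integral>\<^sup>+x. f x * indicator {0<..} x + f x * indicator {..<0} x \<partial>lborel)"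
  proof (rule nn_integral_cong_AE)
    have "AE x in lborel. x \<noteq> (0::real)"
      by (rule AE_lborel_singleton)
    then show "AE x in lborel. f x = f x * indicator {0<..} x + f x * indicator {..<0} x"
      by eventually_elim (auto split: split_indicator)
  qed
  also have "\<dots> = (\<integral>\<^sup>+x. f x * indicator {0<..} x \<partial>lborel) + (\<integral>\<^sup>+x. f x * indicator {..<0} x \<partial>lborel)"
    by (rule nn_integral_add) simp_all
  also have "(\<integral>\<^sup>+x. f x * indicator {..<0} x \<partial>lborel) = (\<integral>\<^sup>+x. f (- x) * indicator {..<0} (- x) \<partial>lborel)"
    by (rule nn_integral_reflect[symmetric]) simp
  also have "\<dots> = (\<integral>\<^sup>+x. f x * indicator {0<..} x \<partial>lborel)"
    by (intro nn_integral_cong) (auto simp: even split: split_indicator)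
  finally show ?thesis by (simp add: mult_2)
qed

lemma nn_integral_Cauchy_density:
  "(\<integral>\<^sup>+u. ennreal (1 / (1 + u\<^sup>2)) * indicator {k..} u \<partial>lborel) = ennreal (pi / 2 - arctan k)"
  by (rule nn_integral_FTC_atLeast)
    (auto intro!: derivative_eq_intros tendsto_arctan_at_top simp: field_simps)

text \<open>Polar coordinates in disguise: substitute \<open>x = u y\<close> and then \<open>y = s / sqrt (1 + u\<^sup>2)\<close>.\<close>

lemma nn_integral_sector_aux:
  fixes G :: "real \<Rightarrow> ennreal"
  assumes [measurable]: "G \<in> borel_measurable borel" "U \<in> sets borel"
  shows "(\<integral>\<^sup>+y. \<integral>\<^sup>+x. G (x\<^sup>2 + y\<^sup>2) * indicator {0<..} y * indicator U (x / y) \<partial>lborel \<partial>lborel) =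
    (\<integral>\<^sup>+u. ennreal (1 / (1 + u\<^sup>2)) * indicator U u \<partial>lborel) *
    (\<integral>\<^sup>+s. G (s\<^sup>2) * ennreal s * indicator {0<..} s \<partial>lborel)"
proof -
  have "(\<integral>\<^sup>+y. \<integral>\<^sup>+x. G (x\<^sup>2 + y\<^sup>2) * indicator {0<..} y * indicator U (x / y) \<partial>lborel \<partial>lborel) =
    (\<integral>\<^sup>+y. \<integral>\<^sup>+u. indicator U u * (ennreal y * G (y\<^sup>2 * (1 + u\<^sup>2)) * indicator {0<..} y) \<partial>lborel \<partial>lborel)"
  proof (rule nn_integral_cong)
    fix y :: real
    show "(\<integral>\<^sup>+x. G (x\<^sup>2 + y\<^sup>2) * indicator {0<..} y * indicator U (x / y) \<partial>lborel) =
      (\<integral>\<^sup>+u. indicator U u * (ennreal y * G (y\<^sup>2 * (1 + u\<^sup>2)) * indicator {0<..} y) \<partial>lborel)"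
    proof (cases "0 < y")
      case True
      then show ?thesis
        by (subst nn_integral_real_affine[where c=y and t=0])
          (simp_all add: nn_integral_cmult[symmetric] algebra_simps power_mult_distrib)
    qed simp
  qed
  also have "\<dots> = (\<integral>\<^sup>+u. \<integral>\<^sup>+y. indicator U u * (ennreal y * G (y\<^sup>2 * (1 + u\<^sup>2)) * indicator {0<..} y) \<partial>lborel \<partial>lborel)"
    by (intro lborel_pair.Fubini') measurable
  also have "\<dots> = (\<integral>\<^sup>+u. indicator U u * (\<integral>\<^sup>+y. ennreal y * G (y\<^sup>2 * (1 + u\<^sup>2)) * indicator {0<..} y \<partial>lborel) \<partial>lborel)"
    by (intro nn_integral_cong nn_integral_cmult) simp
  also have "\<dots> = (\<integral>\<^sup>+u. ennreal (1 / (1 + u\<^sup>2)) * indicator U u *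
      (\<integral>\<^sup>+s. G (s\<^sup>2) * ennreal s * indicator {0<..} s \<partial>lborel) \<partial>lborel)"
  proof (rule nn_integral_cong)
    fix u :: real
    let ?r = "1 / sqrt (1 + u\<^sup>2)"
    have pos: "0 < 1 + u\<^sup>2"
      by (simp add: add_pos_nonneg)
    have sq: "(?r * s)\<^sup>2 * (1 + u\<^sup>2) = s\<^sup>2" for s
      using pos by (simp add: power_mult_distrib power_divide)
    have ind: "0 < ?r * s \<longleftrightarrow> 0 < s" for s
      using pos by (simp add: zero_less_divide_iff)
    have rr: "\<bar>?r\<bar> * (?r * s) = 1 / (1 + u\<^sup>2) * s" for s
      using pos by (simp add: field_simps)
    have em: "ennreal (1 / (1 + u\<^sup>2) * s) = ennreal (1 / (1 + u\<^sup>2)) * ennreal s" for s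
      using pos by (intro ennreal_mult') simp
    have "(\<integral>\<^sup>+y. ennreal y * G (y\<^sup>2 * (1 + u\<^sup>2)) * indicator {0<..} y \<partial>lborel) =
      ennreal \<bar>?r\<bar> * (\<integral>\<^sup>+s. ennreal (0 + ?r * s) * G ((0 + ?r * s)\<^sup>2 * (1 + u\<^sup>2)) * indicator {0<..} (0 + ?r * s) \<partial>lborel)"
      using pos by (intro nn_integral_real_affine) auto
    also have "\<dots> = (\<integral>\<^sup>+s. ennreal (\<bar>?r\<bar> * (?r * s)) * G (s\<^sup>2) * indicator {0<..} s \<partial>lborel)"
      by (subst nn_integral_cmult[symmetric])
        (auto intro!: nn_integral_cong simp: sq ind ennreal_mult' mult.assoc indicator_def simp del: times_divide_eq_left)
    also have "\<dots> = ennreal (1 / (1 + u\<^sup>2)) * (\<integral>\<^sup>+s. G (s\<^sup>2) * ennreal s * indicator {0<..} s \<partial>lborel)"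
      unfolding rr em by (subst nn_integral_cmult[symmetric]) (simp_all add: ac_simps)
    finally show "indicator U u * (\<integral>\<^sup>+y. ennreal y * G (y\<^sup>2 * (1 + u\<^sup>2)) * indicator {0<..} y \<partial>lborel) =
      ennreal (1 / (1 + u\<^sup>2)) * indicator U u * (\<integral>\<^sup>+s. G (s\<^sup>2) * ennreal s * indicator {0<..} s \<partial>lborel)"
      by (simp add: ac_simps)
  qed
  also have "\<dots> = (\<integral>\<^sup>+u. ennreal (1 / (1 + u\<^sup>2)) * indicator U u \<partial>lborel) *
    (\<integral>\<^sup>+s. G (s\<^sup>2) * ennreal s * indicator {0<..} s \<partial>lborel)"
    by (rule nn_integral_multc) simp
  finally show ?thesis .
qed

text \<open>The sector has the angle \<open>pi / 2 - arctan k\<close>, and a rotation invariant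
  integrand gives it the share angle / 2 pi. Both sides are multiples of the same radial integral,
  which may be infinite and is never evaluated.\<close>

lemma nn_integral_sector:
  fixes G :: "real \<Rightarrow> ennreal"
  assumes [measurable]: "G \<in> borel_measurable borel"
  shows "(\<integral>\<^sup>+y. \<integral>\<^sup>+x. G (x\<^sup>2 + y\<^sup>2) * indicator {0<..} y * indicator {k * y..} x \<partial>lborel \<partial>lborel) =
    ennreal ((pi / 2 - arctan k) / (2 * pi)) * (\<integral>\<^sup>+y. \<integral>\<^sup>+x. G (x\<^sup>2 + y\<^sup>2) \<partial>lborel \<partial>lborel)"
proof -
  let ?C = "\<integral>\<^sup>+s. G (s\<^sup>2) * ennreal s * indicator {0<..} s \<partial>lborel"
  have "(\<integral>\<^sup>+y. \<integral>\<^sup>+x. G (x\<^sup>2 + y\<^sup>2) * indicator {0<..} y * indicator {k * y..} x \<partial>lborel \<partial>lborel) =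
    (\<integral>\<^sup>+y. \<integral>\<^sup>+x. G (x\<^sup>2 + y\<^sup>2) * indicator {0<..} y * indicator {k..} (x / y) \<partial>lborel \<partial>lborel)"
    by (intro nn_integral_cong) (auto simp: field_simps split: split_indicator)
  also have "\<dots> = ennreal (pi / 2 - arctan k) * ?C"
    by (subst nn_integral_sector_aux) (simp_all add: nn_integral_Cauchy_density)
  finally have sector: "(\<integral>\<^sup>+y. \<integral>\<^sup>+x. G (x\<^sup>2 + y\<^sup>2) * indicator {0<..} y * indicator {k * y..} x \<partial>lborel \<partial>lborel) =
    ennreal (pi / 2 - arctan k) * ?C" .
  \<comment> \<open>The substitution reaches only the upper half plane. There all slopes together
    contribute the mass \<open>pi\<close> of the Cauchy kernel, and evenness in \<open>y\<close>
    doubles it.\<close>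
  have "(\<integral>\<^sup>+u. ennreal (1 / (1 + u\<^sup>2)) \<partial>lborel) =
      2 * (\<integral>\<^sup>+u. ennreal (1 / (1 + u\<^sup>2)) * indicator {0<..} u \<partial>lborel)"
    by (rule nn_integral_even) simp_all
  also have "(\<integral>\<^sup>+u. ennreal (1 / (1 + u\<^sup>2)) * indicator {0<..} u \<partial>lborel) =
      (\<integral>\<^sup>+u. ennreal (1 / (1 + u\<^sup>2)) * indicator {0..} u \<partial>lborel)"
  proof (rule nn_integral_cong_AE)
    have "AE x in lborel. x \<noteq> (0::real)"
      by (rule AE_lborel_singleton)
    then show "AE u in lborel. ennreal (1 / (1 + u\<^sup>2)) * indicator {0<..} u = ennreal (1 / (1 + u\<^sup>2)) * indicator {0..} u"
      by eventually_elim (auto split: split_indicator)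
  qed
  also have "2 * \<dots> = ennreal pi"
    by (simp add: nn_integral_Cauchy_density flip: ennreal_numeral ennreal_mult)
  finally have total: "(\<integral>\<^sup>+u. ennreal (1 / (1 + u\<^sup>2)) \<partial>lborel) = ennreal pi" .
  have "(\<integral>\<^sup>+y. \<integral>\<^sup>+x. G (x\<^sup>2 + y\<^sup>2) \<partial>lborel \<partial>lborel) =
      2 * (\<integral>\<^sup>+y. (\<integral>\<^sup>+x. G (x\<^sup>2 + y\<^sup>2) \<partial>lborel) * indicator {0<..} y \<partial>lborel)"
    by (rule nn_integral_even) simp_all
  also have "(\<integral>\<^sup>+y. (\<integral>\<^sup>+x. G (x\<^sup>2 + y\<^sup>2) \<partial>lborel) * indicator {0<..} y \<partial>lborel) =
    (\<integral>\<^sup>+y. \<integral>\<^sup>+x. G (x\<^sup>2 + y\<^sup>2) * indicator {0<..} y * indicator UNIV (x / y) \<partial>lborel \<partial>lborel)"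
    by (intro nn_integral_cong) (simp add: nn_integral_multc)
  also have "\<dots> = ennreal pi * ?C"
    by (subst nn_integral_sector_aux) (simp_all add: total)
  finally have "(\<integral>\<^sup>+y. \<integral>\<^sup>+x. G (x\<^sup>2 + y\<^sup>2) \<partial>lborel \<partial>lborel) = ennreal (2 * pi) * ?C"
    by (simp add: mult.assoc ennreal_mult')
  moreover have "ennreal (pi / 2 - arctan k) = ennreal ((pi / 2 - arctan k) / (2 * pi)) * ennreal (2 * pi)"
    using arctan_ubound[of k] by (simp flip: ennreal_mult)
  ultimately show ?thesis
    unfolding sector by (simp add: mult.assoc)
qed

section \<open>The chi-squared mixture\<close>

lemma measurable_indicator_atLeast [measurable]:
  fixes f g :: "'a \<Rightarrow> real"
  assumes [measurable]: "f \<in> borel_measurable M" "g \<in> borel_measurable M"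
  shows "(\<lambda>x. indicator {f x..} (g x) :: ennreal) \<in> borel_measurable M"
proof -
  have "(\<lambda>x. indicator {f x..} (g x) :: ennreal) = (\<lambda>x. if f x \<le> g x then 1 else 0)"
    by (auto simp: indicator_def)
  then show ?thesis by simp
qed

lemma nn_integral_std_normal:
  fixes f :: "real \<Rightarrow> ennreal"
  assumes [measurable]: "f \<in> borel_measurable borel"
  shows "(\<integral>\<^sup>+x. f x \<partial>std_normal_distribution) = (\<integral>\<^sup>+x. ennreal (std_normal_density x) * f x \<partial>lborel)"
  by (subst nn_integral_density) auto

text \<open>Joint law of three independent standard normal variables, written with iterated
  integrals because the chambers are treated coordinate by coordinate. The first component is the
  outermost variable.\<close>

definition std_normal_triple :: "'a measure \<Rightarrow> ('a \<Rightarrow> real \<times> real \<times> real) \<Rightarrow> bool"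
  where "std_normal_triple M X \<longleftrightarrow> X \<in> borel_measurable M \<and>
    (\<forall>g\<in>borel_measurable borel. (\<integral>\<^sup>+\<omega>. g (X \<omega>) \<partial>M) =
      (\<integral>\<^sup>+x. \<integral>\<^sup>+y. \<integral>\<^sup>+z. g (x, y, z) \<partial>std_normal_distribution \<partial>std_normal_distribution \<partial>std_normal_distribution))"

interpretation std_normal: prob_space std_normal_distribution
  by (rule prob_space_normal_density) simp

lemma emeasure_std_normal_UNIV [simp]: "emeasure std_normal_distribution UNIV = 1"
  using std_normal.emeasure_space_1 by simp

lemma std_normal_density_minus [simp]: "std_normal_density (- x) = std_normal_density x"
  by (simp add: std_normal_density_def)

text \<open>Knowing the law up to a factor is enough: testing with the constant 1 determines
  \<open>c\<close>, since both laws have mass 1.\<close>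

lemma std_normal_tripleI:
  fixes X :: "'a \<Rightarrow> real \<times> real \<times> real"
  assumes [measurable]: "X \<in> borel_measurable M" and M: "emeasure M (space M) = 1"
    and c: "\<And>g. g \<in> borel_measurable borel \<Longrightarrow>
      (\<integral>\<^sup>+\<omega>. g (X \<omega>) \<partial>M) = c * (\<integral>\<^sup>+x. g x * ennreal (exp (- (x \<bullet> x) / 2)) \<partial>lborel)"
  shows "std_normal_triple M X"
proof -
  let ?\<gamma> = std_normal_distribution
  define \<kappa> where "\<kappa> = (1 / sqrt (2 * pi)) ^ 3"
  have eq: "(\<integral>\<^sup>+x. \<integral>\<^sup>+y. \<integral>\<^sup>+z. g (x, y, z) \<partial>?\<gamma> \<partial>?\<gamma> \<partial>?\<gamma>) =
      ennreal \<kappa> * (\<integral>\<^sup>+x. g x * ennreal (exp (- (x \<bullet> x) / 2)) \<partial>lborel)"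
    if [measurable]: "g \<in> borel_measurable borel" for g :: "real \<times> real \<times> real \<Rightarrow> ennreal"
  proof -
    have [measurable]: "g \<in> borel_measurable (lborel \<Otimes>\<^sub>M lborel \<Otimes>\<^sub>M lborel)"
      by (simp add: lborel_prod)
    have d: "ennreal (std_normal_density x) * (ennreal (std_normal_density y) * (ennreal (std_normal_density z) * a))
        = ennreal \<kappa> * (a * ennreal (exp (- ((x, y, z) \<bullet> (x, y, z)) / 2)))" for x y z a
    proof -
      have "std_normal_density x * std_normal_density y * std_normal_density z =
          \<kappa> * exp (- ((x, y, z) \<bullet> (x, y, z)) / 2)"
        by (simp add: std_normal_density_def \<kappa>_def inner_prod_def power2_eq_square power3_eq_cube
            add_divide_distrib diff_divide_distrib flip: exp_add)
      then have "ennreal (std_normal_density x) * ennreal (std_normal_density y) * ennreal (std_normal_density z) =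
          ennreal \<kappa> * ennreal (exp (- ((x, y, z) \<bullet> (x, y, z)) / 2))"
        by (simp only: \<kappa>_def normal_density_nonneg ennreal_mult''[symmetric] exp_ge_zero)
      then show ?thesis
        by (simp only: mult.assoc[symmetric]) (simp only: ac_simps)
    qed
    have "(\<integral>\<^sup>+x. \<integral>\<^sup>+y. \<integral>\<^sup>+z. g (x, y, z) \<partial>?\<gamma> \<partial>?\<gamma> \<partial>?\<gamma>) =
      (\<integral>\<^sup>+x. \<integral>\<^sup>+y. \<integral>\<^sup>+z. ennreal \<kappa> * (g (x, y, z) * ennreal (exp (- ((x, y, z) \<bullet> (x, y, z)) / 2))) \<partial>lborel \<partial>lborel \<partial>lborel)"
      by (simp add: nn_integral_std_normal nn_integral_cmult[symmetric] d)
    also have "\<dots> = (\<integral>\<^sup>+p. ennreal \<kappa> * (g p * ennreal (exp (- (p \<bullet> p) / 2))) \<partial>(lborel \<Otimes>\<^sub>M lborel \<Otimes>\<^sub>M lborel))"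
    proof -
      define f where "f p = ennreal \<kappa> * (g p * ennreal (exp (- (p \<bullet> p) / 2)))" for p
      have [measurable]: "f \<in> borel_measurable (lborel \<Otimes>\<^sub>M lborel \<Otimes>\<^sub>M lborel)"
        unfolding f_def by (simp add: lborel_prod)
      have "(\<integral>\<^sup>+y. \<integral>\<^sup>+z. f (x, y, z) \<partial>lborel \<partial>lborel) = (\<integral>\<^sup>+q. f (x, q) \<partial>(lborel \<Otimes>\<^sub>M lborel))" for x
        by (rule lborel.nn_integral_fst) measurable
      moreover have "(\<integral>\<^sup>+x. \<integral>\<^sup>+q. f (x, q) \<partial>lborel \<partial>lborel) = (\<integral>\<^sup>+p. f p \<partial>(lborel \<Otimes>\<^sub>M lborel))"
        by (rule lborel.nn_integral_fst) (simp add: f_def lborel_prod)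
      ultimately show ?thesis
        by (simp add: lborel_prod f_def)
    qed
    also have "\<dots> = ennreal \<kappa> * (\<integral>\<^sup>+p. g p * ennreal (exp (- (p \<bullet> p) / 2)) \<partial>lborel)"
      by (simp add: lborel_prod nn_integral_cmult)
    finally show ?thesis .
  qed
  let ?I = "integral\<^sup>N lborel (\<lambda>x::real\<times>real\<times>real. ennreal (exp (- (x \<bullet> x) / 2)))"
  have \<kappa>: "ennreal \<kappa> * ?I = 1"
    using eq[of "\<lambda>_. 1"] by simp
  have "c * ?I = 1"
    using c[of "\<lambda>_. 1"] M by simp
  \<comment> \<open>The two equations \<open>\<kappa> * ?I = 1\<close> and \<open>c * ?I = 1\<close>
    are combined by multiplication, which avoids a division in \<open>ennreal\<close>.\<close>
  have "c = c * (ennreal \<kappa> * ?I)"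
    by (simp only: \<kappa> mult_1_right)
  also have "\<dots> = ennreal \<kappa> * (c * ?I)"
    by (rule mult.left_commute)
  also have "\<dots> = ennreal \<kappa>"
    by (simp only: \<open>c * ?I = 1\<close> mult_1_right)
  finally show ?thesis
    using c eq by (simp add: std_normal_triple_def)
qed

lemma std_normal_even:
  fixes f :: "real \<Rightarrow> ennreal"
  assumes [measurable]: "f \<in> borel_measurable borel" and "\<And>x. f (- x) = f x"
  shows "(\<integral>\<^sup>+x. f x * indicator {0<..} x \<partial>std_normal_distribution) =
    ennreal (1/2) * (\<integral>\<^sup>+x. f x \<partial>std_normal_distribution)"
proof -
  have "(\<integral>\<^sup>+x. f x \<partial>std_normal_distribution) = 2 * (\<integral>\<^sup>+x. f x * indicator {0<..} x \<partial>std_normal_distribution)"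
    using nn_integral_even[of "\<lambda>x. ennreal (std_normal_density x) * f x"] assms
    by (simp add: nn_integral_std_normal[of f] nn_integral_std_normal[of "\<lambda>x. f x * indicator {0<..} x"] mult.assoc
        del: nn_integral_indicator)
  moreover have "ennreal (1/2) * 2 = 1"
    using ennreal_mult'[of "1/2" 2] by simp
  ultimately show ?thesis
    by (simp add: mult.assoc[symmetric])
qed

lemma emeasure_std_normal_half_line:
  "(\<integral>\<^sup>+x. indicator {..0} x \<partial>std_normal_distribution) = ennreal (1/2)"
  "(\<integral>\<^sup>+x. indicator {..<0} x \<partial>std_normal_distribution) = ennreal (1/2)"
proof -
  have pos: "(\<integral>\<^sup>+x. indicator {0<..} x \<partial>std_normal_distribution) = ennreal (1/2)"
    using std_normal_even[of "\<lambda>_. 1"] by simp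
  have "(\<integral>\<^sup>+x. indicator {..<0} x \<partial>std_normal_distribution) =
      (\<integral>\<^sup>+x. ennreal (std_normal_density (- x)) * indicator {..<0} (- x) \<partial>lborel)"
    by (subst nn_integral_std_normal, simp, subst nn_integral_reflect) simp_all
  also have "\<dots> = (\<integral>\<^sup>+x. indicator {0<..} x \<partial>std_normal_distribution)"
    by (subst nn_integral_std_normal, simp)
      (auto intro!: nn_integral_cong simp: std_normal_density_def split: split_indicator)
  finally show neg: "(\<integral>\<^sup>+x. indicator {..<0} x \<partial>std_normal_distribution) = ennreal (1/2)"
    using pos by simp
  have "AE x in lborel. x \<noteq> (0::real)"
    by (rule AE_lborel_singleton)
  then have "AE x in std_normal_distribution. x \<noteq> 0"
    by (subst AE_density) (auto elim: eventually_mono)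
  then have "(\<integral>\<^sup>+x. indicator {..0} x \<partial>std_normal_distribution) = (\<integral>\<^sup>+x. indicator {..<0} x \<partial>std_normal_distribution)"
    by (intro nn_integral_cong_AE) (auto elim!: eventually_mono split: split_indicator)
  with neg show "(\<integral>\<^sup>+x. indicator {..0} x \<partial>std_normal_distribution) = ennreal (1/2)"
    by simp
qed

text \<open>The joint density of two standard normal variables depends on
  \<open>x\<^sup>2 + y\<^sup>2\<close> only and is absorbed into the integrand as
  \<open>G'\<close>.\<close>

lemma std_normal_sector:
  fixes G :: "real \<Rightarrow> ennreal"
  assumes [measurable]: "G \<in> borel_measurable borel"
  shows "(\<integral>\<^sup>+y. \<integral>\<^sup>+x. G (x\<^sup>2 + y\<^sup>2) * indicator {0<..} y * indicator {k * y..} x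
      \<partial>std_normal_distribution \<partial>std_normal_distribution) =
    ennreal ((pi / 2 - arctan k) / (2 * pi)) *
    (\<integral>\<^sup>+y. \<integral>\<^sup>+x. G (x\<^sup>2 + y\<^sup>2) \<partial>std_normal_distribution \<partial>std_normal_distribution)"
proof -
  define G' where "G' q = ennreal (exp (- q / 2) / (2 * pi)) * G q" for q
  have [measurable]: "G' \<in> borel_measurable borel"
    unfolding G'_def by measurable
  have G': "ennreal (std_normal_density y) * (ennreal (std_normal_density x) * (G (x\<^sup>2 + y\<^sup>2) * a)) =
      G' (x\<^sup>2 + y\<^sup>2) * a" for x y a
  proof -
    have "std_normal_density y * std_normal_density x = exp (- (x\<^sup>2 + y\<^sup>2) / 2) / (2 * pi)"
      by (simp add: std_normal_density_def add_divide_distrib diff_divide_distrib flip: exp_add)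
    then have "ennreal (std_normal_density y) * ennreal (std_normal_density x) = ennreal (exp (- (x\<^sup>2 + y\<^sup>2) / 2) / (2 * pi))"
      by (simp only: normal_density_nonneg ennreal_mult''[symmetric])
    then show ?thesis
      by (simp add: G'_def mult.assoc[symmetric])
  qed
  have *: "(\<integral>\<^sup>+y. \<integral>\<^sup>+x. G (x\<^sup>2 + y\<^sup>2) * h x y \<partial>std_normal_distribution \<partial>std_normal_distribution) =
      (\<integral>\<^sup>+y. \<integral>\<^sup>+x. G' (x\<^sup>2 + y\<^sup>2) * h x y \<partial>lborel \<partial>lborel)"
    if [measurable]: "case_prod h \<in> borel_measurable (borel \<Otimes>\<^sub>M borel)" for h
    by (simp add: nn_integral_std_normal nn_integral_cmult[symmetric] G')
  show ?thesis
    using *[of "\<lambda>x y. indicator {0<..} y * indicator {k * y..} x"] *[of "\<lambda>_ _. 1"] nn_integral_sector[of G' k]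
    by (simp add: mult.assoc split_beta')
qed

lemma emeasure_chi_squared:
  assumes [measurable]: "A \<in> sets borel"
  shows "emeasure (chi_squared 1) A = (\<integral>\<^sup>+z. indicator A (z\<^sup>2) \<partial>std_normal_distribution)"
    and "emeasure (chi_squared 2) A =
      (\<integral>\<^sup>+x. \<integral>\<^sup>+z. indicator A (x\<^sup>2 + z\<^sup>2) \<partial>std_normal_distribution \<partial>std_normal_distribution)"
    and "emeasure (chi_squared 3) A =
      (\<integral>\<^sup>+y. \<integral>\<^sup>+x. \<integral>\<^sup>+z. indicator A (x\<^sup>2 + y\<^sup>2 + z\<^sup>2)
        \<partial>std_normal_distribution \<partial>std_normal_distribution \<partial>std_normal_distribution)"
proof -
  interpret product_sigma_finite "\<lambda>_::nat. std_normal_distribution" ..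
  let ?P = "\<lambda>k. PiM {..<k::nat} (\<lambda>_. std_normal_distribution)"
  have chi: "emeasure (chi_squared k) A = (\<integral>\<^sup>+z. indicator A (\<Sum>i<k. (z i)\<^sup>2) \<partial>?P k)" for k
    unfolding chi_squared_def
    by (subst nn_integral_indicator[symmetric], simp, subst nn_integral_distr) simp_all
  have 0: "(\<integral>\<^sup>+z. F (\<Sum>i<0. (z i)\<^sup>2) \<partial>?P 0) = F 0" for F :: "real \<Rightarrow> ennreal"
    by (simp add: nn_integral_count_space PiM_empty)
  have Suc: "(\<integral>\<^sup>+z. F (\<Sum>i<Suc k. (z i)\<^sup>2) \<partial>?P (Suc k)) =
      (\<integral>\<^sup>+z. (\<integral>\<^sup>+y. F ((\<Sum>i<k. (z i)\<^sup>2) + y\<^sup>2) \<partial>std_normal_distribution) \<partial>?P k)"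
    if [measurable]: "F \<in> borel_measurable borel" for F k
    unfolding lessThan_Suc
    by (subst product_nn_integral_insert) (auto intro!: nn_integral_cong arg_cong[where f=F] sum.cong simp: add.commute)
  show "emeasure (chi_squared 1) A = (\<integral>\<^sup>+z. indicator A (z\<^sup>2) \<partial>std_normal_distribution)"
    unfolding chi One_nat_def by (subst Suc, simp, subst 0) simp
  have "emeasure (chi_squared (Suc (Suc 0))) A =
      (\<integral>\<^sup>+x. \<integral>\<^sup>+z. indicator A (x\<^sup>2 + z\<^sup>2) \<partial>std_normal_distribution \<partial>std_normal_distribution)"
    unfolding chi by (subst Suc, simp, subst Suc, simp, subst 0) simp
  then show "emeasure (chi_squared 2) A =
      (\<integral>\<^sup>+x. \<integral>\<^sup>+z. indicator A (x\<^sup>2 + z\<^sup>2) \<partial>std_normal_distribution \<partial>std_normal_distribution)"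
    by (simp only: numeral_2_eq_2[symmetric])
  have "emeasure (chi_squared (Suc (Suc (Suc 0)))) A =
      (\<integral>\<^sup>+y. \<integral>\<^sup>+x. \<integral>\<^sup>+z. indicator A (y\<^sup>2 + x\<^sup>2 + z\<^sup>2)
        \<partial>std_normal_distribution \<partial>std_normal_distribution \<partial>std_normal_distribution)"
    unfolding chi by (subst Suc, simp, subst Suc, simp, subst Suc, simp, subst 0) simp
  then show "emeasure (chi_squared 3) A =
      (\<integral>\<^sup>+y. \<integral>\<^sup>+x. \<integral>\<^sup>+z. indicator A (x\<^sup>2 + y\<^sup>2 + z\<^sup>2)
        \<partial>std_normal_distribution \<partial>std_normal_distribution \<partial>std_normal_distribution)"
    by (simp only: numeral_3_eq_3[symmetric] add.commute[of "_\<^sup>2 :: real" "_\<^sup>2"])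
qed

lemma sets_mixture [simp]: "sets (mixture ws) = sets borel"
  using sets.sigma_sets_eq[of "borel :: real measure"] by (simp add: mixture_def)

text \<open>\<open>measure_of\<close> yields the intended values only for a countably additive set
  function; this is checked by induction on the list of components.\<close>

lemma emeasure_mixture:
  assumes "\<And>c M. (c, M) \<in> set ws \<Longrightarrow> sets M = sets borel" and A: "A \<in> sets borel"
  shows "emeasure (mixture ws) A = (\<Sum>(c, M)\<leftarrow>ws. ennreal c * emeasure M A)"
  unfolding mixture_def
proof (rule emeasure_measure_of[OF refl])
  show "countably_additive (sets (measure_of UNIV (sets borel) (\<lambda>A. \<Sum>(c, M)\<leftarrow>ws. ennreal c * emeasure M A)))
      (\<lambda>A. \<Sum>(c, M)\<leftarrow>ws. ennreal c * emeasure M A)"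
    unfolding countably_additive_def
  proof safe
    fix B :: "nat \<Rightarrow> real set"
    assume "range B \<subseteq> sets (measure_of UNIV (sets borel) (\<lambda>A. \<Sum>(c, M)\<leftarrow>ws. ennreal c * emeasure M A))"
      and disj: "disjoint_family B"
    then have B: "range B \<subseteq> sets borel"
      using sets.sigma_sets_eq[of "borel :: real measure"] by simp
    show "(\<Sum>i. \<Sum>(c, M)\<leftarrow>ws. ennreal c * emeasure M (B i)) = (\<Sum>(c, M)\<leftarrow>ws. ennreal c * emeasure M (\<Union>i. B i))"
      using assms(1)
    proof (induction ws)
      case (Cons a ws)
      obtain c M where a: "a = (c, M)" by (cases a)
      have "(\<Sum>i. emeasure M (B i)) = emeasure M (\<Union>i. B i)"
        using B disj Cons.prems a by (intro suminf_emeasure) auto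
      then have "(\<Sum>i. ennreal c * emeasure M (B i)) = ennreal c * emeasure M (\<Union>i. B i)"
        by simp
      moreover have "(\<Sum>i. \<Sum>(c, M)\<leftarrow>ws. ennreal c * emeasure M (B i)) = (\<Sum>(c, M)\<leftarrow>ws. ennreal c * emeasure M (\<Union>i. B i))"
        using Cons by auto
      ultimately show ?case
        by (simp add: a suminf_add[symmetric])
    qed simp
  qed
qed (use A in \<open>auto simp: positive_def split_beta' sum_list_eq_0_iff\<close>)

text \<open>
  The four regions are the chamber of \<open>w\<close> where the projection onto the cone is \<open>w\<close> itself, onto either
  of its edges, and the apex. In the coordinates \<open>(\<rho> w\<^sub>1 + r w\<^sub>2, r w\<^sub>1 - \<rho> w\<^sub>2)\<close> the third is a quarter plane
  as well.
\<close>

lemma mixture_law: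
  fixes w1 w2 w3 T :: "'a \<Rightarrow> real"
  assumes X: "std_normal_triple M (\<lambda>\<omega>. (w2 \<omega>, w1 \<omega>, w3 \<omega>))"
    and Y: "std_normal_triple M (\<lambda>\<omega>. (r * w1 \<omega> - \<rho> * w2 \<omega>, \<rho> * w1 \<omega> + r * w2 \<omega>, w3 \<omega>))"
    and \<rho>: "\<bar>\<rho>\<bar> < 1" and r: "r = sqrt (1 - \<rho>\<^sup>2)"
    and T1: "\<And>\<omega>. 0 < w2 \<omega> \<Longrightarrow> \<rho> / r * w2 \<omega> \<le> w1 \<omega> \<Longrightarrow> T \<omega> = (w1 \<omega>)\<^sup>2 + (w2 \<omega>)\<^sup>2 + (w3 \<omega>)\<^sup>2"
    and T2: "\<And>\<omega>. w2 \<omega> \<le> 0 \<Longrightarrow> 0 < w1 \<omega> \<Longrightarrow> T \<omega> = (w1 \<omega>)\<^sup>2 + (w3 \<omega>)\<^sup>2"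
    and T3: "\<And>\<omega>. 0 < \<rho> * w1 \<omega> + r * w2 \<omega> \<Longrightarrow> w1 \<omega> < \<rho> / r * w2 \<omega> \<Longrightarrow>
      T \<omega> = (\<rho> * w1 \<omega> + r * w2 \<omega>)\<^sup>2 + (w3 \<omega>)\<^sup>2"
    and T4: "\<And>\<omega>. w1 \<omega> \<le> 0 \<Longrightarrow> w2 \<omega> \<le> - (\<rho> / r) * w1 \<omega> \<Longrightarrow> T \<omega> = (w3 \<omega>)\<^sup>2"
    and [measurable]: "T \<in> borel_measurable M"
  shows "distr M borel T = mixture [(1/2 - arccos \<rho> / (2 * pi), chi_squared 1), (1/2, chi_squared 2),
    (arccos \<rho> / (2 * pi), chi_squared 3)]"
proof -
  let ?\<gamma> = std_normal_distribution
  let ?\<beta> = "arccos \<rho>"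
  have r0: "0 < r" and r2: "r\<^sup>2 = 1 - \<rho>\<^sup>2"
    using \<rho> using abs_square_le_1[of \<rho>] by (auto simp: r abs_square_less_1)
  \<comment> \<open>The unit vector \<open>(\<rho>, r)\<close> spans the ray
    \<open>x / y = \<rho> / r\<close>, at the angle \<open>arccos \<rho>\<close> to the first axis;
    this is the angle of the chamber in which all three squares survive.\<close>
  have \<beta>: "pi / 2 - arctan (\<rho> / r) = ?\<beta>" "0 \<le> ?\<beta>" "?\<beta> \<le> pi"
    using \<rho> arccos_arctan[of \<rho>] arccos_lbound[of \<rho>] arccos_ubound[of \<rho>] by (simp_all add: r)
  have X': "(\<integral>\<^sup>+\<omega>. g (w2 \<omega>) (w1 \<omega>) (w3 \<omega>) \<partial>M) = (\<integral>\<^sup>+y. \<integral>\<^sup>+x. \<integral>\<^sup>+z. g y x z \<partial>?\<gamma> \<partial>?\<gamma> \<partial>?\<gamma>)"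
    and Y': "(\<integral>\<^sup>+\<omega>. g (r * w1 \<omega> - \<rho> * w2 \<omega>) (\<rho> * w1 \<omega> + r * w2 \<omega>) (w3 \<omega>) \<partial>M) =
      (\<integral>\<^sup>+y. \<integral>\<^sup>+x. \<integral>\<^sup>+z. g y x z \<partial>?\<gamma> \<partial>?\<gamma> \<partial>?\<gamma>)"
    if [measurable]: "(\<lambda>(y, x, z). g y x z) \<in> borel_measurable (borel \<Otimes>\<^sub>M borel \<Otimes>\<^sub>M borel)"
    for g :: "real \<Rightarrow> real \<Rightarrow> real \<Rightarrow> ennreal"
    using X Y that unfolding std_normal_triple_def borel_prod
    by (auto dest!: bspec[where x="\<lambda>(y, x, z). g y x z"])
  have [measurable]: "w1 \<in> borel_measurable M" "w2 \<in> borel_measurable M" "w3 \<in> borel_measurable M"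
  proof -
    have "(\<lambda>\<omega>. (w2 \<omega>, w1 \<omega>, w3 \<omega>)) \<in> borel_measurable M"
      using X by (simp add: std_normal_triple_def)
    then have *: "(\<lambda>\<omega>. (w2 \<omega>, w1 \<omega>, w3 \<omega>)) \<in> M \<rightarrow>\<^sub>M borel \<Otimes>\<^sub>M borel \<Otimes>\<^sub>M borel"
      by (simp add: borel_prod)
    from measurable_compose[OF * measurable_fst] measurable_compose[OF * measurable_compose[OF measurable_snd measurable_fst]]
      measurable_compose[OF * measurable_compose[OF measurable_snd measurable_snd]]
    show "w1 \<in> borel_measurable M" "w2 \<in> borel_measurable M" "w3 \<in> borel_measurable M"
      by simp_all
  qed
  \<comment> \<open>Boundary rays are allotted so that the first three chambers are disjoint
    whatever the sign of \<open>\<rho>\<close>. \<open>A4\<close> is the complement: the cover is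
    exact, and its probability can be found by subtraction.\<close>
  define A1 where "A1 = (\<lambda>\<omega>. 0 < w2 \<omega> \<and> \<rho> / r * w2 \<omega> \<le> w1 \<omega>)"
  define A2 where "A2 = (\<lambda>\<omega>. w2 \<omega> \<le> 0 \<and> 0 < w1 \<omega>)"
  define A3 where "A3 = (\<lambda>\<omega>. 0 < \<rho> * w1 \<omega> + r * w2 \<omega> \<and> r * w1 \<omega> - \<rho> * w2 \<omega> < 0)"
  define A4 where "A4 = (\<lambda>y x. \<not> (0 < y \<and> \<rho> / r * y \<le> x) \<and> \<not> (y \<le> 0 \<and> 0 < x) \<and> \<not> (0 < \<rho> * x + r * y \<and> r * x - \<rho> * y < 0))"
  have A1r: "A1 \<omega> \<longleftrightarrow> 0 < w2 \<omega> \<and> 0 \<le> r * w1 \<omega> - \<rho> * w2 \<omega>" for \<omega>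
    using r0 by (auto simp: A1_def field_simps)
  have A3r: "A3 \<omega> \<longleftrightarrow> 0 < \<rho> * w1 \<omega> + r * w2 \<omega> \<and> w1 \<omega> < \<rho> / r * w2 \<omega>" for \<omega>
    using r0 by (auto simp: A3_def field_simps)
  have disj: "\<not> (A1 \<omega> \<and> A2 \<omega>)" "\<not> (A1 \<omega> \<and> A3 \<omega>)" "\<not> (A2 \<omega> \<and> A3 \<omega>)" for \<omega>
  proof -
    show "\<not> (A1 \<omega> \<and> A2 \<omega>)" "\<not> (A1 \<omega> \<and> A3 \<omega>)"
      by (auto simp: A1r A2_def A3_def)
    show "\<not> (A2 \<omega> \<and> A3 \<omega>)"
    proof
      assume A: "A2 \<omega> \<and> A3 \<omega>"
      \<comment> \<open>Given these signs of \<open>w1\<close> and \<open>w2\<close>, the third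
        inequality needs \<open>\<rho> > 0\<close> and the fourth needs
        \<open>\<rho> < 0\<close>.\<close>
      then have *: "w2 \<omega> \<le> 0" "0 < w1 \<omega>" "0 < \<rho> * w1 \<omega> + r * w2 \<omega>" "r * w1 \<omega> < \<rho> * w2 \<omega>"
        by (auto simp: A2_def A3_def)
      have "r * w2 \<omega> \<le> 0" "0 < r * w1 \<omega>"
        using * r0 by (auto simp: mult_nonneg_nonpos)
      with * show False
        by (smt (verit) mult_nonneg_nonpos mult_nonneg_nonneg mult_nonpos_nonneg)
    qed
  qed
  \<comment> \<open>The complement must be shown to lie in the chamber of the apex, where the
    assumption \<open>T4\<close> speaks. Again each wrong configuration forces contradictory signs
    of \<open>\<rho>\<close>.\<close>
  have T4': "T \<omega> = (w3 \<omega>)\<^sup>2" if "A4 (w2 \<omega>) (w1 \<omega>)" for \<omega>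
  proof (rule T4)
    have A: "\<not> A1 \<omega>" "\<not> A2 \<omega>" "\<not> A3 \<omega>"
      using that by (auto simp: A1_def A2_def A3_def A4_def)
    show w1: "w1 \<omega> \<le> 0"
    proof (rule ccontr)
      assume "\<not> w1 \<omega> \<le> 0"
      with A have "0 < w1 \<omega>" "0 < w2 \<omega>" "r * w1 \<omega> < \<rho> * w2 \<omega>" "\<rho> * w1 \<omega> + r * w2 \<omega> \<le> 0"
        by (auto simp: A1r A2_def A3_def)
      moreover have "0 < r * w1 \<omega>" "0 < r * w2 \<omega>"
        using calculation r0 by auto
      ultimately show False
        by (smt (verit) mult_nonneg_nonneg mult_nonpos_nonneg)
    qed
    have "\<rho> * w1 \<omega> + r * w2 \<omega> \<le> 0"
    proof (rule ccontr)
      assume p: "\<not> \<rho> * w1 \<omega> + r * w2 \<omega> \<le> 0"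
      with A have b: "0 \<le> r * w1 \<omega> - \<rho> * w2 \<omega>"
        by (auto simp: A3_def)
      with A have w2: "w2 \<omega> \<le> 0"
        by (auto simp: A1r)
      have "r * w2 \<omega> \<le> 0" "r * w1 \<omega> \<le> 0"
        using w1 w2 r0 by (auto simp: mult_nonneg_nonpos)
      then have "0 < \<rho> * w1 \<omega>" "\<rho> * w2 \<omega> \<le> 0"
        using p b by auto
      then show False
        using w1 w2 b \<open>r * w1 \<omega> \<le> 0\<close> p r0 by (smt (verit) mult_nonneg_nonpos mult_nonpos_nonpos mult_eq_0_iff mult_pos_neg)
    qed
    then show "w2 \<omega> \<le> - (\<rho> / r) * w1 \<omega>"
      using r0 by (simp add: field_simps)
  qed
  have A4': "A4 (w2 \<omega>) (w1 \<omega>) \<longleftrightarrow> \<not> A1 \<omega> \<and> \<not> A2 \<omega> \<and> \<not> A3 \<omega>" for \<omega>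
    by (simp add: A1_def A2_def A3_def A4_def)
  have TA: "A1 \<omega> \<Longrightarrow> T \<omega> = (w1 \<omega>)\<^sup>2 + (w2 \<omega>)\<^sup>2 + (w3 \<omega>)\<^sup>2" "A2 \<omega> \<Longrightarrow> T \<omega> = (w1 \<omega>)\<^sup>2 + (w3 \<omega>)\<^sup>2"
    "A3 \<omega> \<Longrightarrow> T \<omega> = (\<rho> * w1 \<omega> + r * w2 \<omega>)\<^sup>2 + (w3 \<omega>)\<^sup>2"
    "\<not> A1 \<omega> \<Longrightarrow> \<not> A2 \<omega> \<Longrightarrow> \<not> A3 \<omega> \<Longrightarrow> T \<omega> = (w3 \<omega>)\<^sup>2" for \<omega>
    using T1[of \<omega>] T2[of \<omega>] T3[of \<omega>] T4'[of \<omega>] A3r[of \<omega>] A4'[of \<omega>] by (auto simp: A1_def A2_def)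
  let ?X1 = "\<lambda>g::real\<Rightarrow>ennreal. \<integral>\<^sup>+z. g (z\<^sup>2) \<partial>?\<gamma>"
  let ?X2 = "\<lambda>g::real\<Rightarrow>ennreal. \<integral>\<^sup>+x. \<integral>\<^sup>+z. g (x\<^sup>2 + z\<^sup>2) \<partial>?\<gamma> \<partial>?\<gamma>"
  let ?X3 = "\<lambda>g::real\<Rightarrow>ennreal. \<integral>\<^sup>+y. \<integral>\<^sup>+x. \<integral>\<^sup>+z. g (x\<^sup>2 + y\<^sup>2 + z\<^sup>2) \<partial>?\<gamma> \<partial>?\<gamma> \<partial>?\<gamma>"
  let ?m = "\<integral>\<^sup>+y. \<integral>\<^sup>+x. indicator {(y, x). A4 y x} (y, x) \<partial>?\<gamma> \<partial>?\<gamma>"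
  have [measurable]: "Measurable.pred (borel \<Otimes>\<^sub>M borel) (\<lambda>(y, x). A4 y x)"
    unfolding A4_def by measurable
  have split: "(\<integral>\<^sup>+\<omega>. g (T \<omega>) \<partial>M) = ennreal (?\<beta> / (2 * pi)) * ?X3 g + ennreal (1/4) * ?X2 g + ennreal (1/4) * ?X2 g + ?m * ?X1 g"
    if [measurable]: "g \<in> borel_measurable borel" for g :: "real \<Rightarrow> ennreal"
  proof -
    \<comment> \<open>Serves both edges of the cone: \<open>U\<close> is a half-line of probability
      1/2 for the coordinate that is dropped, and evenness gives another 1/2 for the coordinate
      whose square remains.\<close>
    have quarter: "(\<integral>\<^sup>+y. \<integral>\<^sup>+x. \<integral>\<^sup>+z. g (x\<^sup>2 + z\<^sup>2) * (indicator U y * indicator {0<..} x) \<partial>?\<gamma> \<partial>?\<gamma> \<partial>?\<gamma>) =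
        ennreal (1/4) * ?X2 g" if [measurable]: "U \<in> sets borel" and U: "(\<integral>\<^sup>+y. indicator U y \<partial>?\<gamma>) = ennreal (1/2)"
      for U :: "real set"
    proof -
      let ?G = "\<lambda>x. \<integral>\<^sup>+z. g (x\<^sup>2 + z\<^sup>2) \<partial>?\<gamma>"
      have "(\<integral>\<^sup>+y. \<integral>\<^sup>+x. \<integral>\<^sup>+z. g (x\<^sup>2 + z\<^sup>2) * (indicator U y * indicator {0<..} x) \<partial>?\<gamma> \<partial>?\<gamma> \<partial>?\<gamma>) =
          (\<integral>\<^sup>+y. indicator U y * (\<integral>\<^sup>+x. ?G x * indicator {0<..} x \<partial>?\<gamma>) \<partial>?\<gamma>)"
        by (simp add: nn_integral_multc nn_integral_cmult[symmetric] ac_simps)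
      also have "\<dots> = ennreal (1/2) * (ennreal (1/2) * ?X2 g)"
        by (subst nn_integral_multc, simp, subst std_normal_even) (simp_all only: U, simp_all)
      also have "ennreal (1/2) * (ennreal (1/2) * ?X2 g) = ennreal (1/4) * ?X2 g"
        by (simp only: mult.assoc[symmetric] ennreal_mult'[symmetric]) simp
      finally show ?thesis .
    qed
    have "(\<integral>\<^sup>+\<omega>. g (T \<omega>) \<partial>M) =
      (\<integral>\<^sup>+\<omega>. g ((w1 \<omega>)\<^sup>2 + (w2 \<omega>)\<^sup>2 + (w3 \<omega>)\<^sup>2) * (indicator {0<..} (w2 \<omega>) * indicator {\<rho> / r * w2 \<omega>..} (w1 \<omega>)) +
        g ((w1 \<omega>)\<^sup>2 + (w3 \<omega>)\<^sup>2) * (indicator {..0} (w2 \<omega>) * indicator {0<..} (w1 \<omega>)) +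
        g ((\<rho> * w1 \<omega> + r * w2 \<omega>)\<^sup>2 + (w3 \<omega>)\<^sup>2) * (indicator {..<0} (r * w1 \<omega> - \<rho> * w2 \<omega>) * indicator {0<..} (\<rho> * w1 \<omega> + r * w2 \<omega>)) +
        g ((w3 \<omega>)\<^sup>2) * indicator {(y, x). A4 y x} (w2 \<omega>, w1 \<omega>) \<partial>M)"
      (is "_ = (\<integral>\<^sup>+\<omega>. ?t1 \<omega> + ?t2 \<omega> + ?t3 \<omega> + ?t4 \<omega> \<partial>M)")
    proof (rule nn_integral_cong)
      fix \<omega>
      have i1: "indicator {0<..} (w2 \<omega>) * indicator {\<rho> / r * w2 \<omega>..} (w1 \<omega>) = (if A1 \<omega> then 1 else 0 :: ennreal)"
        by (simp add: A1_def indicator_def)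
      have i2: "indicator {..0} (w2 \<omega>) * indicator {0<..} (w1 \<omega>) = (if A2 \<omega> then 1 else 0 :: ennreal)"
        by (simp add: A2_def indicator_def)
      have i3: "indicator {..<0} (r * w1 \<omega> - \<rho> * w2 \<omega>) * indicator {0<..} (\<rho> * w1 \<omega> + r * w2 \<omega>) = (if A3 \<omega> then 1 else 0 :: ennreal)"
        by (auto simp add: A3_def indicator_def)
      have i4: "indicator {(y, x). A4 y x} (w2 \<omega>, w1 \<omega>) = (if \<not> A1 \<omega> \<and> \<not> A2 \<omega> \<and> \<not> A3 \<omega> then 1 else 0 :: ennreal)"
        by (simp add: A4' indicator_def)
      show "g (T \<omega>) = ?t1 \<omega> + ?t2 \<omega> + ?t3 \<omega> + ?t4 \<omega>"
        unfolding i1 i2 i3 i4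
        using disj[of \<omega>] TA[of \<omega>] by (cases "A1 \<omega>"; cases "A2 \<omega>"; cases "A3 \<omega>") simp_all
    qed
    also have "\<dots> = (\<integral>\<^sup>+\<omega>. ?t1 \<omega> \<partial>M) + (\<integral>\<^sup>+\<omega>. ?t2 \<omega> \<partial>M) + (\<integral>\<^sup>+\<omega>. ?t3 \<omega> \<partial>M) + (\<integral>\<^sup>+\<omega>. ?t4 \<omega> \<partial>M)"
      by (simp add: nn_integral_add)
    also have "(\<integral>\<^sup>+\<omega>. ?t1 \<omega> \<partial>M) =
        (\<integral>\<^sup>+y. \<integral>\<^sup>+x. (\<integral>\<^sup>+z. g (x\<^sup>2 + y\<^sup>2 + z\<^sup>2) \<partial>?\<gamma>) * indicator {0<..} y * indicator {\<rho> / r * y..} x \<partial>?\<gamma> \<partial>?\<gamma>)"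
      by (subst X'[of "\<lambda>y x z. g (x\<^sup>2 + y\<^sup>2 + z\<^sup>2) * (indicator {0<..} y * indicator {\<rho> / r * y..} x)"])
        (simp_all add: nn_integral_multc mult.assoc)
    also have "\<dots> = ennreal (?\<beta> / (2 * pi)) * ?X3 g"
      by (subst std_normal_sector[of "\<lambda>q. \<integral>\<^sup>+z. g (q + z\<^sup>2) \<partial>?\<gamma>" "\<rho> / r"]) (simp_all add: \<beta>)
    also have "(\<integral>\<^sup>+\<omega>. ?t2 \<omega> \<partial>M) =
        (\<integral>\<^sup>+y. \<integral>\<^sup>+x. \<integral>\<^sup>+z. g (x\<^sup>2 + z\<^sup>2) * (indicator {..0} y * indicator {0<..} x) \<partial>?\<gamma> \<partial>?\<gamma> \<partial>?\<gamma>)"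
      by (rule X') simp
    \<comment> \<open>In the rotated pair, \<open>A3\<close> is the quarter plane where the
      component orthogonal to the edge is negative and the component along it is positive.\<close>
    also have "(\<integral>\<^sup>+\<omega>. ?t3 \<omega> \<partial>M) =
        (\<integral>\<^sup>+y. \<integral>\<^sup>+x. \<integral>\<^sup>+z. g (x\<^sup>2 + z\<^sup>2) * (indicator {..<0} y * indicator {0<..} x) \<partial>?\<gamma> \<partial>?\<gamma> \<partial>?\<gamma>)"
      by (rule Y') simp
    also have "(\<integral>\<^sup>+y. \<integral>\<^sup>+x. \<integral>\<^sup>+z. g (x\<^sup>2 + z\<^sup>2) * (indicator {..0} y * indicator {0<..} x) \<partial>?\<gamma> \<partial>?\<gamma> \<partial>?\<gamma>) = ennreal (1/4) * ?X2 g"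
      by (rule quarter) (simp_all add: emeasure_std_normal_half_line)
    also have "(\<integral>\<^sup>+y. \<integral>\<^sup>+x. \<integral>\<^sup>+z. g (x\<^sup>2 + z\<^sup>2) * (indicator {..<0} y * indicator {0<..} x) \<partial>?\<gamma> \<partial>?\<gamma> \<partial>?\<gamma>) = ennreal (1/4) * ?X2 g"
      by (rule quarter) (simp_all add: emeasure_std_normal_half_line)
    also have "(\<integral>\<^sup>+\<omega>. ?t4 \<omega> \<partial>M) =
        (\<integral>\<^sup>+y. \<integral>\<^sup>+x. \<integral>\<^sup>+z. g (z\<^sup>2) * indicator {(y, x). A4 y x} (y, x) \<partial>?\<gamma> \<partial>?\<gamma> \<partial>?\<gamma>)"
      by (rule X') simp
    also have "\<dots> = ?m * ?X1 g"
      by (simp add: nn_integral_multc nn_integral_cmult mult.commute)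
    finally show ?thesis .
  qed
  have M: "(\<integral>\<^sup>+\<omega>. 1 \<partial>M) = 1"
    using X'[of "\<lambda>_ _ _. 1"] by simp
  \<comment> \<open>With the constant test function all chi-squared integrals become 1, which leaves
    \<open>1 - \<beta> / (2 * pi) - 1/2\<close> for the apex.\<close>
  have m: "?m = ennreal (1/2 - ?\<beta> / (2 * pi))"
  proof -
    have "1 = ennreal (?\<beta> / (2 * pi)) + ennreal (1/4) + ennreal (1/4) + ?m"
      using split[of "\<lambda>_. 1"] M by simp
    also have "ennreal (?\<beta> / (2 * pi)) + ennreal (1/4) + ennreal (1/4) = ennreal (?\<beta> / (2 * pi) + 1/2)"
      using \<beta> by (simp flip: ennreal_plus)
    finally have *: "ennreal (?\<beta> / (2 * pi) + 1/2) + ?m = ennreal 1"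
      by simp
    then have "?m = ennreal 1 - ennreal (?\<beta> / (2 * pi) + 1/2)"
      by (metis ennreal_add_diff_cancel_left ennreal_neq_top)
    also have "\<dots> = ennreal (1/2 - ?\<beta> / (2 * pi))"
      using \<beta> by (subst ennreal_minus) auto
    finally show ?thesis .
  qed
  show ?thesis (is "_ = mixture ?ws")
  proof (rule measure_eqI)
    fix A assume "A \<in> sets (distr M borel T)"
    then have [measurable]: "A \<in> sets borel" by simp
    have "emeasure (distr M borel T) A = (\<integral>\<^sup>+\<omega>. indicator A (T \<omega>) \<partial>M)"
      by (subst nn_integral_indicator[symmetric], simp, subst nn_integral_distr) simp_all
    also have "\<dots> = ennreal (?\<beta> / (2 * pi)) * emeasure (chi_squared 3) A + ennreal (1/4) * emeasure (chi_squared 2) A +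
        ennreal (1/4) * emeasure (chi_squared 2) A + ennreal (1/2 - ?\<beta> / (2 * pi)) * emeasure (chi_squared 1) A"
      by (simp only: split[of "indicator A"] m emeasure_chi_squared \<open>A \<in> sets borel\<close> borel_measurable_indicator)
    also have "\<dots> = (\<Sum>(c, M)\<leftarrow>?ws. ennreal c * emeasure M A)"
    proof -
      have "ennreal (1/2) = ennreal (1/4) + ennreal (1/4)"
        by (simp flip: ennreal_plus)
      then show ?thesis
        by (simp only: list.map sum_list.Cons sum_list.Nil prod.case distrib_right add_0_right) (simp only: ac_simps)
    qed
    also have "\<dots> = emeasure (mixture ?ws) A"
      by (rule emeasure_mixture[symmetric]) (auto simp: chi_squared_def)
    finally show "emeasure (distr M borel T) A = emeasure (mixture ?ws) A" .
  qed simp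
qed

section \<open>Likelihood ratios\<close>

text \<open>Lebesgue decomposition by means of the dominating measure \<open>P + Q\<close>: the
  ratio is the quotient of the two densities. It justifies the choice operator in
  \<open>lik_ratio\<close>.\<close>

lemma lik_ratio_exists:
  assumes P: "finite_measure P" and Q: "finite_measure Q" and sets_eq: "sets Q = sets P"
  shows "\<exists>f. f \<in> borel_measurable P \<and> (\<forall>x. 0 \<le> f x) \<and>
    (\<exists>N\<in>null_sets P. \<forall>A\<in>sets P. emeasure Q (A - N) = (\<integral>\<^sup>+x\<in>A. ennreal (f x) \<partial>P))"
proof -
  interpret P: finite_measure P by fact
  interpret Q: finite_measure Q by fact
  note sets_eq [measurable_cong]
  define R where "R = measure_of (space P) (sets P) (\<lambda>A. emeasure P A + emeasure Q A)"
  have sets_R [simp, measurable_cong]: "sets R = sets P"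
    by (simp add: R_def)
  have space_R [simp]: "space R = space P"
    by (simp add: R_def)
  have R: "emeasure R A = emeasure P A + emeasure Q A" if "A \<in> sets P" for A
    unfolding R_def
  proof (rule emeasure_measure_of_sigma)
    show "sigma_algebra (space P) (sets P)" ..
    show "positive (sets P) (\<lambda>A. emeasure P A + emeasure Q A)"
      by (simp add: positive_def)
    show "countably_additive (sets P) (\<lambda>A. emeasure P A + emeasure Q A)"
      unfolding countably_additive_def
      by (auto simp: suminf_add[symmetric] suminf_emeasure sets_eq)
  qed fact
  have "finite_measure R"
    by (rule finite_measureI) (simp add: R)
  then interpret R: finite_measure R .
  have "absolutely_continuous R P" "absolutely_continuous R Q"
    by (auto simp: absolutely_continuous_def null_sets_def R sets_eq)
  then obtain p q where p [measurable]: "p \<in> borel_measurable R" "density R p = P"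
    and q [measurable]: "q \<in> borel_measurable R" "density R q = Q"
    using R.Radon_Nikodym[of P] R.Radon_Nikodym[of Q] sets_eq by auto
  \<comment> \<open>Where \<open>p\<close> vanishes the singular part of \<open>Q\<close> may live,
    and \<open>P\<close> has no mass there. Infinite values are removed too, so that the quotient is
    a real number.\<close>
  define N where "N = {x \<in> space P. p x = 0 \<or> p x = \<infinity> \<or> q x = \<infinity>}"
  have [measurable]: "N \<in> sets P"
  proof -
    have "N = {x \<in> space R. p x = 0 \<or> p x = \<infinity> \<or> q x = \<infinity>}"
      by (simp add: N_def)
    also have "\<dots> \<in> sets R" by measurable
    finally show ?thesis by simp
  qed
  have "AE x in R. p x \<noteq> \<infinity>"
  proof (rule nn_integral_PInf_AE)
    have "integral\<^sup>N R p = emeasure (density R p) (space R)"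
      by (subst emeasure_density) (auto intro!: nn_integral_cong)
    then show "integral\<^sup>N R p \<noteq> \<infinity>" by (simp add: p)
  qed fact
  moreover have "AE x in R. q x \<noteq> \<infinity>"
  proof (rule nn_integral_PInf_AE)
    have "integral\<^sup>N R q = emeasure (density R q) (space R)"
      by (subst emeasure_density) (auto intro!: nn_integral_cong)
    then show "integral\<^sup>N R q \<noteq> \<infinity>" by (simp add: q)
  qed fact
  ultimately have "AE x in R. p x \<noteq> 0 \<longrightarrow> x \<notin> N"
    by (auto simp: N_def)
  then have "AE x in density R p. x \<notin> N"
    by (subst AE_density) (auto simp: zero_less_iff_neq_zero)
  then have N: "N \<in> null_sets P"
    by (simp add: p AE_iff_null_sets[symmetric])
  define f where "f x = (if x \<in> N then 0 else enn2real (q x / p x))" for x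
  have [measurable]: "f \<in> borel_measurable P"
  proof -
    have "f \<in> borel_measurable R"
      unfolding f_def by measurable
    then show ?thesis by (simp cong: measurable_cong_sets)
  qed
  have "emeasure Q (A - N) = (\<integral>\<^sup>+x\<in>A. ennreal (f x) \<partial>P)" if [measurable]: "A \<in> sets P" for A
  proof -
    have "emeasure Q (A - N) = (\<integral>\<^sup>+x. q x * indicator (A - N) x \<partial>R)"
      by (subst q(2)[symmetric], subst emeasure_density) simp_all
    also have "\<dots> = (\<integral>\<^sup>+x. p x * (ennreal (f x) * indicator A x) \<partial>R)"
    proof (rule nn_integral_cong)
      fix x assume x: "x \<in> space R"
      show "q x * indicator (A - N) x = p x * (ennreal (f x) * indicator A x)"
      proof (cases "x \<in> N")
        case False
        then have "p x \<noteq> 0" "p x \<noteq> \<infinity>" "q x \<noteq> \<infinity>"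
          using x by (auto simp: N_def)
        then have "ennreal (enn2real (q x / p x)) = q x / p x"
          by (simp add: ennreal_divide_eq_top_iff ennreal_enn2real_if)
        moreover have "p x * (q x / p x) = q x * p x / p x"
          by (simp only: ennreal_times_divide mult.commute[of "p x"])
        moreover have "q x * p x / p x = q x"
          using \<open>p x \<noteq> 0\<close> \<open>p x \<noteq> \<infinity>\<close> by (simp add: mult_divide_eq_ennreal)
        ultimately have "p x * ennreal (enn2real (q x / p x)) = q x"
          by simp
        then show ?thesis
          using False by (simp add: f_def mult.assoc[symmetric] indicator_def)
      qed (simp add: f_def)
    qed
    also have "\<dots> = (\<integral>\<^sup>+x\<in>A. ennreal (f x) \<partial>P)"
      by (subst p(2)[symmetric], subst nn_integral_density) simp_all
    finally show ?thesis .
  qed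
  then show ?thesis
    using N by (intro exI[of _ f]) (auto simp: f_def)
qed

lemma lik_ratio_spec:
  assumes "finite_measure P" "finite_measure Q" "sets Q = sets P"
  shows "lik_ratio Q P \<in> borel_measurable P" "0 \<le> lik_ratio Q P x"
    and "\<exists>N\<in>null_sets P. \<forall>A\<in>sets P. emeasure Q (A - N) = (\<integral>\<^sup>+x\<in>A. ennreal (lik_ratio Q P x) \<partial>P)"
  using someI_ex[OF lik_ratio_exists[OF assms]] unfolding lik_ratio_def by blast+

lemma nn_integral_lik_ratio_le:
  assumes P: "finite_measure P" and Q: "finite_measure Q" and sets_eq: "sets Q = sets P" and A: "A \<in> sets P"
  shows "(\<integral>\<^sup>+x\<in>A. ennreal (lik_ratio Q P x) \<partial>P) \<le> emeasure Q A"
proof -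
  obtain N where N: "N \<in> null_sets P" "\<And>A. A \<in> sets P \<Longrightarrow> emeasure Q (A - N) = (\<integral>\<^sup>+x\<in>A. ennreal (lik_ratio Q P x) \<partial>P)"
    using lik_ratio_spec(3)[OF P Q sets_eq] by blast
  have "(\<integral>\<^sup>+x\<in>A. ennreal (lik_ratio Q P x) \<partial>P) = emeasure Q (A - N)"
    using N(2)[OF A] by simp
  also have "\<dots> \<le> emeasure Q A"
    using A sets_eq by (intro emeasure_mono) auto
  finally show ?thesis .
qed

lemma nn_integral_lik_ratio:
  assumes P: "finite_measure P" and Q: "finite_measure Q" and sets_eq: "sets Q = sets P"
    and N: "N \<in> null_sets P" "\<And>A. A \<in> sets P \<Longrightarrow> emeasure Q (A - N) = (\<integral>\<^sup>+x\<in>A. ennreal (lik_ratio Q P x) \<partial>P)"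
    and [measurable]: "h \<in> borel_measurable P"
  shows "(\<integral>\<^sup>+x. h x * indicator (- N) x \<partial>Q) = (\<integral>\<^sup>+x. h x * ennreal (lik_ratio Q P x) \<partial>P)"
proof -
  note sets_eq [measurable_cong] lik_ratio_spec(1)[OF P Q sets_eq, measurable]
  have [measurable]: "N \<in> sets P"
    using N by auto
  have "density Q (indicator (- N)) = density P (\<lambda>x. ennreal (lik_ratio Q P x))"
  proof (rule measure_eqI)
    fix A assume "A \<in> sets (density Q (indicator (- N)))"
    then have [measurable]: "A \<in> sets P"
      by (simp add: sets_eq)
    have "emeasure (density Q (indicator (- N))) A = (\<integral>\<^sup>+x. indicator (- N) x * indicator A x \<partial>Q)"
      by (rule emeasure_density) simp_all
    also have "\<dots> = (\<integral>\<^sup>+x. indicator (A - N) x \<partial>Q)"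
      by (rule nn_integral_cong) (simp split: split_indicator)
    also have "\<dots> = emeasure (density P (\<lambda>x. ennreal (lik_ratio Q P x))) A"
      using N(2)[of A] by (simp add: emeasure_density)
    finally show "emeasure (density Q (indicator (- N))) A = emeasure (density P (\<lambda>x. ennreal (lik_ratio Q P x))) A" .
  qed (simp add: sets_eq)
  then have "integral\<^sup>N (density Q (indicator (- N))) h = integral\<^sup>N (density P (\<lambda>x. ennreal (lik_ratio Q P x))) h"
    by simp
  then show ?thesis
    by (simp add: nn_integral_density mult.commute)
qed

text \<open>Chain rule for absolutely continuous parts. On the set where \<open>R\<close> has
  positive ratio and all three exceptional sets are avoided, both candidates integrate to the
  \<open>Q\<close>-measure of every measurable subset, so they agree almost everywhere.\<close>

lemma lik_ratio_quotient:
  assumes P: "finite_measure P" and Q: "finite_measure Q" and R: "finite_measure R"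
    and sQ: "sets Q = sets P" and sR: "sets R = sets P"
  shows "AE x in P. 0 < lik_ratio R P x \<longrightarrow> lik_ratio Q R x = lik_ratio Q P x / lik_ratio R P x"
proof -
  interpret P: finite_measure P by fact
  note sQ [measurable_cong] sR [measurable_cong]
  have sQR: "sets Q = sets R" using sQ sR by simp
  let ?f = "lik_ratio Q P" and ?r = "lik_ratio R P" and ?q = "lik_ratio Q R"
  note f = lik_ratio_spec[OF P Q sQ] and r = lik_ratio_spec[OF P R sR] and q = lik_ratio_spec[OF R Q sQR]
  note [measurable] = f(1) r(1) q(1)
  obtain NQ where NQ: "NQ \<in> null_sets P" "\<And>A. A \<in> sets P \<Longrightarrow> emeasure Q (A - NQ) = (\<integral>\<^sup>+x\<in>A. ennreal (?f x) \<partial>P)"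
    using f(3) by blast
  obtain NR where NR: "NR \<in> null_sets P" "\<And>A. A \<in> sets P \<Longrightarrow> emeasure R (A - NR) = (\<integral>\<^sup>+x\<in>A. ennreal (?r x) \<partial>P)"
    using r(3) by blast
  obtain M where M: "M \<in> null_sets R" "\<And>A. A \<in> sets R \<Longrightarrow> emeasure Q (A - M) = (\<integral>\<^sup>+x\<in>A. ennreal (?q x) \<partial>R)"
    using q(3) by blast
  have [measurable]: "NQ \<in> sets P" "NR \<in> sets P" "M \<in> sets P"
    using NQ(1) NR(1) M(1) sR by auto
  \<comment> \<open>The exceptional set \<open>M\<close> is null for \<open>R\<close> only.
    \<open>P\<close> may charge it, but not where the ratio of \<open>R\<close> to \<open>P\<close>
    is positive.\<close>
  have "(\<integral>\<^sup>+x\<in>M. ennreal (?r x) \<partial>P) \<le> emeasure R M"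
    by (rule nn_integral_lik_ratio_le[OF P R sR]) simp
  also have "\<dots> = 0"
    using M(1) by auto
  finally have "AE x in P. ennreal (?r x) * indicator M x = 0"
    by (subst nn_integral_0_iff_AE[symmetric]) (simp_all add: le_zero_eq)
  then have AE: "AE x in P. x \<notin> NQ \<and> x \<notin> NR \<and> (0 < ?r x \<longrightarrow> x \<notin> M)"
    using AE_not_in[OF NQ(1)] AE_not_in[OF NR(1)]
    by eventually_elim (auto split: split_indicator_asm)
  let ?G = "\<lambda>x. x \<notin> NQ \<and> x \<notin> NR \<and> 0 < ?r x \<and> x \<notin> M"
  have "AE x in P. ennreal (?f x) * indicator {x. ?G x} x = ennreal (?q x * ?r x) * indicator {x. ?G x} x"
  proof (rule P.density_unique_finite_measure)
    have *: "{x \<in> space P. ?G x} \<in> sets P" by measurable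
    have **: "indicator {x. ?G x} x = (indicator {x \<in> space P. ?G x} x :: ennreal)" if "x \<in> space P" for x
      using that by (simp add: indicator_def)
    show "(\<lambda>x. ennreal (?f x) * indicator {x. ?G x} x) \<in> borel_measurable P"
      "(\<lambda>x. ennreal (?q x * ?r x) * indicator {x. ?G x} x) \<in> borel_measurable P"
      using * by (simp_all add: ** cong: measurable_cong)
    fix A assume [measurable]: "A \<in> sets P"
    define B where "B = A \<inter> {x \<in> space P. ?G x}"
    have [measurable]: "B \<in> sets P"
      unfolding B_def using * by auto
    have BI: "indicator {x. ?G x} x * indicator A x = (indicator B x :: ennreal)" if "x \<in> space P" for x
      using that by (auto simp: B_def split: split_indicator)
    have "(\<integral>\<^sup>+x. ennreal (?f x) * indicator {x. ?G x} x * indicator A x \<partial>P) = (\<integral>\<^sup>+x\<in>B. ennreal (?f x) \<partial>P)"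
      by (intro nn_integral_cong) (simp add: BI mult.assoc)
    also have "\<dots> = emeasure Q (B - NQ)"
      by (rule NQ(2)[symmetric]) simp
    \<comment> \<open>\<open>B\<close> meets neither exceptional set, so one can be exchanged for
      the other; this is how the base measure changes from \<open>P\<close> to
      \<open>R\<close>.\<close>
    also have "B - NQ = B - M"
      by (auto simp: B_def)
    also have "emeasure Q (B - M) = (\<integral>\<^sup>+x\<in>B. ennreal (?q x) \<partial>R)"
      by (rule M(2)) (simp add: sR)
    also have "\<dots> = (\<integral>\<^sup>+x. ennreal (?q x) * indicator B x * indicator (- NR) x \<partial>R)"
      by (intro nn_integral_cong) (auto simp: B_def split: split_indicator)
    also have "\<dots> = (\<integral>\<^sup>+x. ennreal (?q x) * indicator B x * ennreal (?r x) \<partial>P)"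
      by (rule nn_integral_lik_ratio[OF P R sR NR]) simp_all
    also have "\<dots> = (\<integral>\<^sup>+x. ennreal (?q x * ?r x) * indicator {x. ?G x} x * indicator A x \<partial>P)"
      by (intro nn_integral_cong) (simp add: BI mult.assoc ennreal_mult q(2) r(2) mult.commute mult.left_commute flip: BI)
    finally show "(\<integral>\<^sup>+x. ennreal (?f x) * indicator {x. ?G x} x * indicator A x \<partial>P) =
      (\<integral>\<^sup>+x. ennreal (?q x * ?r x) * indicator {x. ?G x} x * indicator A x \<partial>P)" .
  qed simp_all
  with AE show ?thesis
    by eventually_elim (auto simp: field_simps ennreal_inj f(2) r(2) q(2))
qed

text \<open>The null set in the definition of \<open>lik_ratio\<close> carries no mass of a measure
  with a density, so uniqueness of densities identifies the chosen ratio with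
  \<open>g\<close>.\<close>

lemma lik_ratio_density:
  assumes P: "finite_measure P" and g [measurable]: "g \<in> borel_measurable P" and nonneg: "\<And>x. 0 \<le> g x"
    and fin: "finite_measure (density P (\<lambda>x. ennreal (g x)))"
  shows "AE x in P. lik_ratio (density P (\<lambda>x. ennreal (g x))) P x = g x"
proof -
  interpret P: finite_measure P by fact
  let ?Q = "density P (\<lambda>x. ennreal (g x))"
  note spec = lik_ratio_spec[OF P fin sets_density]
  note [measurable] = spec(1)
  obtain N where N: "N \<in> null_sets P" "\<And>A. A \<in> sets P \<Longrightarrow> emeasure ?Q (A - N) = (\<integral>\<^sup>+x\<in>A. ennreal (lik_ratio ?Q P x) \<partial>P)"
    using spec(3) by blast
  have [measurable]: "N \<in> sets P" using N by auto
  have "AE x in P. ennreal (lik_ratio ?Q P x) = ennreal (g x)"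
  proof (rule P.density_unique_finite_measure)
    fix A assume [measurable]: "A \<in> sets P"
    have "(\<integral>\<^sup>+x\<in>A. ennreal (lik_ratio ?Q P x) \<partial>P) = (\<integral>\<^sup>+x. ennreal (g x) * indicator (A - N) x \<partial>P)"
      using N(2)[of A] by (simp add: emeasure_density)
    also have "\<dots> = (\<integral>\<^sup>+x\<in>A. ennreal (g x) \<partial>P)"
      using AE_not_in[OF N(1)] by (intro nn_integral_cong_AE) (auto elim!: eventually_mono split: split_indicator)
    finally show "(\<integral>\<^sup>+x\<in>A. ennreal (lik_ratio ?Q P x) \<partial>P) = (\<integral>\<^sup>+x\<in>A. ennreal (g x) \<partial>P)" .
  qed simp_all
  then show ?thesis
    by eventually_elim (simp add: ennreal_inj spec(2) nonneg)
qed

text \<open>The measure with \<open>P\<close>-density \<open>l\<close> lies below \<open>Q\<close>.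
  The remainder of \<open>Q\<close>, its singular part included, is a positive measure of mass
  \<open>1 - (\<integral>x. l x \<partial>P)\<close>, and \<open>g\<close> is bounded by
  \<open>B\<close> on it.\<close>

lemma integral_lik_ratio_minorant:
  assumes P: "prob_space P" and Q: "prob_space Q" and sets_eq: "sets Q = sets P"
    and l [measurable]: "l \<in> borel_measurable P" and l0: "\<And>x. 0 \<le> l x" and lL: "\<And>x. l x \<le> lik_ratio Q P x"
    and lK: "\<And>x. l x \<le> K"
    and g [measurable]: "g \<in> borel_measurable P" and gB: "\<And>x. \<bar>g x\<bar> \<le> B"
  shows "\<bar>(\<integral>x. g x \<partial>Q) - (\<integral>x. g x * l x \<partial>P)\<bar> \<le> B * (1 - (\<integral>x. l x \<partial>P))"
proof -
  interpret P: prob_space P by fact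
  interpret Q: prob_space Q by fact
  note sets_eq [measurable_cong]
  note fin = P.finite_measure_axioms Q.finite_measure_axioms
  have gQ [measurable]: "g \<in> borel_measurable Q"
    using g by (simp cong: measurable_cong_sets)
  have int: "integrable Q g" "integrable P g" "integrable P l" "integrable P (\<lambda>x. g x * l x)"
  proof -
    show "integrable Q g" by (rule Q.integrable_const_bound[where B=B]) (auto simp: gB)
    show "integrable P g" by (rule P.integrable_const_bound[where B=B]) (auto simp: gB)
    show "integrable P l" by (rule P.integrable_const_bound[where B=K]) (auto simp: l0 lK)
    show "integrable P (\<lambda>x. g x * l x)"
      by (rule P.integrable_const_bound[where B="B * K"]) (auto simp: abs_mult l0 lK gB intro!: mult_mono order_trans[OF _ gB])
  qed
  have le: "density P (\<lambda>x. ennreal (l x)) \<le> Q"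
  proof -
    have "emeasure (density P (\<lambda>x. ennreal (l x))) A \<le> emeasure Q A" if [measurable]: "A \<in> sets P" for A
    proof -
      have "emeasure (density P (\<lambda>x. ennreal (l x))) A = (\<integral>\<^sup>+x\<in>A. ennreal (l x) \<partial>P)"
        by (simp add: emeasure_density)
      also have "\<dots> \<le> (\<integral>\<^sup>+x\<in>A. ennreal (lik_ratio Q P x) \<partial>P)"
        by (intro nn_integral_mono mult_right_mono ennreal_leI lL) simp
      also have "\<dots> \<le> emeasure Q A"
        by (rule nn_integral_lik_ratio_le[OF fin sets_eq]) simp
      finally show ?thesis .
    qed
    then have "emeasure (density P (\<lambda>x. ennreal (l x))) A \<le> emeasure Q A" for A
      by (cases "A \<in> sets P") (simp_all add: emeasure_notin_sets sets_eq)
    then show ?thesis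
      using sets_eq_imp_space_eq[OF sets_eq] by (simp add: le_measure_iff sets_eq le_fun_def)
  qed
  have key: "(\<integral>x. h x * l x \<partial>P) \<le> (\<integral>x. h x \<partial>Q)"
    if h [measurable]: "h \<in> borel_measurable P" and h0: "\<And>x. 0 \<le> h x" and hB: "\<And>x. h x \<le> 2 * B" for h
  proof -
    have hQ [measurable]: "h \<in> borel_measurable Q"
      using h by (simp cong: measurable_cong_sets)
    have i: "integrable P (\<lambda>x. h x * l x)"
      by (rule P.integrable_const_bound[where B="2 * B * K"]) (auto simp: abs_mult l0 h0 lK hB intro!: mult_mono order_trans[OF h0 hB])
    have j: "integrable Q h"
      by (rule Q.integrable_const_bound[where B="2 * B"]) (auto simp: h0 hB)
    have "ennreal (\<integral>x. h x * l x \<partial>P) = (\<integral>\<^sup>+x. ennreal (h x * l x) \<partial>P)"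
      using i by (simp add: nn_integral_eq_integral h0 l0)
    also have "\<dots> = (\<integral>\<^sup>+x. ennreal (h x) \<partial>density P (\<lambda>x. ennreal (l x)))"
      by (simp add: nn_integral_density ennreal_mult h0 l0 mult.commute)
    also have "\<dots> \<le> (\<integral>\<^sup>+x. ennreal (h x) \<partial>Q)"
      by (rule nn_integral_mono_measure) (simp_all add: le sets_eq)
    also have "\<dots> = ennreal (\<integral>x. h x \<partial>Q)"
      using j by (simp add: nn_integral_eq_integral h0)
    finally show ?thesis
      by (simp add: ennreal_le_iff integral_nonneg h0)
  qed
  have B: "- B \<le> g x" "g x \<le> B" for x
    using gB[of x] by auto
  \<comment> \<open>The inequality for nonnegative functions, applied to \<open>B + g\<close> and
    \<open>B - g\<close>, yields the two halves of the absolute value. Both functions are at most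
    \<open>2 * B\<close>.\<close>
  have "(\<integral>x. (B + g x) * l x \<partial>P) \<le> (\<integral>x. B + g x \<partial>Q)"
    by (rule key) (simp, use B in \<open>smt (verit)\<close>)+
  moreover have "(\<integral>x. (B - g x) * l x \<partial>P) \<le> (\<integral>x. B - g x \<partial>Q)"
    by (rule key) (simp, use B in \<open>smt (verit)\<close>)+
  ultimately show ?thesis
    using int by (simp add: distrib_right left_diff_distrib Q.prob_space right_diff_distrib)
qed

section \<open>Contiguity and Le Cam's third lemma\<close>

lemma tendsto_bounded_weak:
  assumes "conv_in_dist P X N (\<lambda>x. x)" and "continuous_on UNIV f" and "\<And>x. \<bar>f x\<bar> \<le> (B::real)"
  shows "(\<lambda>n. \<integral>\<omega>. f (X n \<omega>) \<partial>P n) \<longlonglongrightarrow> (\<integral>x. f x \<partial>N)"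
  using assms unfolding conv_in_dist_def
  by (auto intro!: boundedI[where B=B])

lemma abs_min_nonneg: "0 \<le> a \<Longrightarrow> 0 < K \<Longrightarrow> \<bar>min a K\<bar> = min a (K :: real)"
  by simp

lemma abs_mult_diff: "\<bar>c * a - c * b\<bar> = \<bar>c\<bar> * \<bar>a - b :: real\<bar>"
  by (simp add: abs_mult flip: right_diff_distrib)

lemma abs_mult_min_le:
  fixes c a K B :: real
  assumes "\<bar>c\<bar> \<le> B" "0 \<le> a" "0 < K"
  shows "\<bar>c * min a K\<bar> \<le> B * K"
  using assms by (simp add: abs_mult) (intro mult_mono, auto)

text \<open>\<open>X\<close> plays the role of the score, \<open>N\<close> that of its limit law,
  and \<open>z\<close> is the limiting log-likelihood ratio as a function of the score.
  \<open>exp_z\<close> is the condition of Le Cam's first lemma for contiguity.\<close>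

locale lr_expansion =
  fixes P Q :: "nat \<Rightarrow> 'a measure" and X :: "nat \<Rightarrow> 'a \<Rightarrow> 'b::euclidean_space"
    and N :: "'b measure" and z :: "'b \<Rightarrow> real"
  assumes P: "\<And>n. prob_space (P n)" and Q: "\<And>n. prob_space (Q n)"
    and sets_Q: "\<And>n. sets (Q n) = sets (P n)"
    and X: "\<And>n. X n \<in> borel_measurable (P n)"
    and weak: "conv_in_dist P X N (\<lambda>x. x)"
    and N: "prob_space N" "sets N = sets borel"
    and cont: "continuous_on UNIV z"
    and exp_z: "(\<integral>\<^sup>+x. ennreal (exp (z x)) \<partial>N) = 1"
    and expansion: "log_lr_expansion Q P (\<lambda>n \<omega>. z (X n \<omega>))"
begin

abbreviation "L n \<equiv> lik_ratio (Q n) (P n)"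
abbreviation "e n \<omega> \<equiv> exp (z (X n \<omega>))"

lemma fin: "finite_measure (P n)" "finite_measure (Q n)"
  using P Q prob_space_def by blast+

lemmas L = lik_ratio_spec[OF fin(1) fin(2) sets_Q]

declare X [measurable] sets_Q [measurable_cong]

lemma [measurable]: "L n \<in> borel_measurable (P n)"
  by (rule L)

lemma z [measurable]: "z \<in> borel_measurable borel"
  by (rule borel_measurable_continuous_onI[OF cont])

lemma z_N [measurable]: "z \<in> borel_measurable N"
  using z N(2) by (simp cong: measurable_cong_sets)

lemma integrable_exp_z: "integrable N (\<lambda>x. exp (z x))" and integral_exp_z: "(\<integral>x. exp (z x) \<partial>N) = 1"
proof -
  show "integrable N (\<lambda>x. exp (z x))"
    by (rule integrableI_nonneg) (simp_all add: exp_z)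
  then have "ennreal (\<integral>x. exp (z x) \<partial>N) = 1"
    using exp_z by (simp add: nn_integral_eq_integral)
  then show "(\<integral>x. exp (z x) \<partial>N) = 1"
    by simp
qed

lemma eventually_bad:
  assumes "0 < \<epsilon>" "0 < \<eta>"
  shows "\<forall>\<^sub>F n in sequentially. measure (P n)
    {\<omega> \<in> space (P n). \<not> (0 < L n \<omega> \<and> \<bar>ln (L n \<omega>) - z (X n \<omega>)\<bar> \<le> \<epsilon>)} < \<eta>"
  using expansion assms unfolding log_lr_expansion_def by (auto dest: order_tendstoD(2))

lemma integrable_truncated: "0 < K \<Longrightarrow> integrable (P n) (\<lambda>\<omega>. min (L n \<omega>) K)"
  "0 < K \<Longrightarrow> integrable (P n) (\<lambda>\<omega>. min (e n \<omega>) K)"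
proof -
  interpret prob_space "P n" by (rule P)
  show "0 < K \<Longrightarrow> integrable (P n) (\<lambda>\<omega>. min (L n \<omega>) K)"
    "0 < K \<Longrightarrow> integrable (P n) (\<lambda>\<omega>. min (e n \<omega>) K)"
    using L(2)[of n] by (auto intro!: integrable_const_bound[where B=K] simp: abs_min_nonneg)
qed

text \<open>Off the exceptional event \<open>L n\<close> and \<open>e n\<close> agree up to a factor
  \<open>exp \<epsilon>\<close>, so their truncations differ by at most
  \<open>K * (exp \<epsilon> - 1)\<close>. On it they differ by at most \<open>K\<close>.\<close>

lemma truncated_lik_ratio:
  assumes K: "0 < K"
  shows "(\<lambda>n. \<integral>\<omega>. \<bar>min (L n \<omega>) K - min (e n \<omega>) K\<bar> \<partial>P n) \<longlonglongrightarrow> 0"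
proof (rule tendstoI)
  fix \<eta> :: real assume \<eta>: "0 < \<eta>"
  \<comment> \<open>Chosen to make \<open>K * (exp \<epsilon> - 1)\<close> equal to
    \<open>\<eta> / 4\<close>; the exceptional event is then asked to contribute less than another
    \<open>\<eta> / 4\<close>.\<close>
  define \<epsilon> where "\<epsilon> = ln (1 + \<eta> / (4 * K))"
  have \<epsilon>: "0 < \<epsilon>" and exp_\<epsilon>: "K * (exp \<epsilon> - 1) = \<eta> / 4"
    using \<eta> K by (simp_all add: \<epsilon>_def add_pos_pos)
  define bad where "bad n = {\<omega> \<in> space (P n). \<not> (0 < L n \<omega> \<and> \<bar>ln (L n \<omega>) - z (X n \<omega>)\<bar> \<le> \<epsilon>)}" for n
  have "\<forall>\<^sub>F n in sequentially. measure (P n) (bad n) < \<eta> / (4 * K)"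
    unfolding bad_def using \<epsilon> \<eta> K by (intro eventually_bad) auto
  then show "\<forall>\<^sub>F n in sequentially. dist (\<integral>\<omega>. \<bar>min (L n \<omega>) K - min (e n \<omega>) K\<bar> \<partial>P n) 0 < \<eta>"
  proof eventually_elim
    case (elim n)
    interpret prob_space "P n" by (rule P)
    have [measurable]: "bad n \<in> sets (P n)"
      unfolding bad_def by measurable
    have "\<bar>min (L n \<omega>) K - min (e n \<omega>) K\<bar> \<le> \<eta> / 4 + K * indicator (bad n) \<omega>" if \<omega>: "\<omega> \<in> space (P n)" for \<omega>
    proof (cases "\<omega> \<in> bad n")
      case True
      have "0 \<le> min (L n \<omega>) K" "min (L n \<omega>) K \<le> K" "0 \<le> min (e n \<omega>) K" "min (e n \<omega>) K \<le> K"
        using K L(2)[of n \<omega>] by auto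
      then have "\<bar>min (L n \<omega>) K - min (e n \<omega>) K\<bar> \<le> K"
        by linarith
      moreover have "indicator (bad n) \<omega> = (1 :: real)"
        using True by simp
      ultimately show ?thesis
        using \<eta> by simp
    next
      case False
      with \<omega> have good: "0 < L n \<omega>" "\<bar>ln (L n \<omega>) - z (X n \<omega>)\<bar> \<le> \<epsilon>"
        by (auto simp: bad_def)
      define l where "l = ln (L n \<omega>)"
      have l: "L n \<omega> = exp l" "\<bar>l - z (X n \<omega>)\<bar> \<le> \<epsilon>"
        using good by (simp_all add: l_def)
      have *: "min (exp a) K - min (exp b) K \<le> \<eta> / 4" if "a \<le> b + \<epsilon>" for a b :: real
      proof -
        have "exp a \<le> exp \<epsilon> * exp b"
          using that by (simp flip: exp_add)
        moreover have "1 \<le> exp \<epsilon>"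
          using \<epsilon> by simp
        ultimately have "min (exp a) K \<le> exp \<epsilon> * min (exp b) K"
        proof -
          assume 1: "exp a \<le> exp \<epsilon> * exp b" and 2: "1 \<le> exp \<epsilon>"
          have "K \<le> exp \<epsilon> * K"
            using 2 K by simp
          with 1 show ?thesis
            by (cases "exp b \<le> K") auto
        qed
        then have "min (exp a) K - min (exp b) K \<le> (exp \<epsilon> - 1) * min (exp b) K"
          by (simp add: algebra_simps)
        also have "\<dots> \<le> (exp \<epsilon> - 1) * K"
          using \<epsilon> by (intro mult_left_mono) auto
        finally show ?thesis
          using exp_\<epsilon> by (simp add: mult.commute)
      qed
      have "\<bar>min (L n \<omega>) K - min (e n \<omega>) K\<bar> \<le> \<eta> / 4"
      proof -
        have "l \<le> z (X n \<omega>) + \<epsilon>" "z (X n \<omega>) \<le> l + \<epsilon>"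
          using l(2) by linarith+
        from this[THEN *] show ?thesis
          unfolding l(1) abs_le_iff by simp
      qed
      then show ?thesis
        using False by simp
    qed
    then have "(\<integral>\<omega>. \<bar>min (L n \<omega>) K - min (e n \<omega>) K\<bar> \<partial>P n) \<le> (\<integral>\<omega>. \<eta> / 4 + K * indicator (bad n) \<omega> \<partial>P n)"
    proof (intro integral_mono)
      show "integrable (P n) (\<lambda>\<omega>. \<bar>min (L n \<omega>) K - min (e n \<omega>) K\<bar>)"
        using K L(2)[of n] integrable_truncated[OF K, of n] by auto
      show "integrable (P n) (\<lambda>\<omega>. \<eta> / 4 + K * indicator (bad n) \<omega>)"
        by (intro Bochner_Integration.integrable_add integrable_mult_right integrable_real_indicator) (auto simp: less_top[symmetric])
    qed
    also have "\<dots> = \<eta> / 4 + K * measure (P n) (bad n)"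
      by (subst Bochner_Integration.integral_add) (auto simp: prob_space less_top[symmetric])
    also have "\<dots> < \<eta> / 4 + K * (\<eta> / (4 * K))"
      using elim K by (intro add_strict_left_mono mult_strict_left_mono) auto
    also have "\<dots> \<le> \<eta>"
      using K \<eta> by simp
    finally show ?case
      by (simp add: integral_nonneg)
  qed
qed

text \<open>The limiting mass that ratios truncated at \<open>K\<close> miss, a singular part of
  \<open>Q n\<close> included. By \<open>exp_z\<close> it is the expected excess of
  \<open>exp z\<close> over \<open>K\<close>, hence small for large \<open>K\<close>.\<close>

definition "tail K = 1 - (\<integral>x. min (exp (z x)) K \<partial>N)"

lemma integral_truncated:
  assumes "0 < K"
  shows "(\<lambda>n. \<integral>\<omega>. min (L n \<omega>) K \<partial>P n) \<longlonglongrightarrow> 1 - tail K"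
proof -
  have "(\<lambda>n. \<integral>\<omega>. min (exp (z (X n \<omega>))) K \<partial>P n) \<longlonglongrightarrow> (\<integral>x. min (exp (z x)) K \<partial>N)"
    by (rule tendsto_bounded_weak[OF weak, where B=K])
      (use assms in \<open>auto intro!: continuous_intros cont simp: abs_min_nonneg\<close>)
  moreover have "(\<lambda>n. (\<integral>\<omega>. min (L n \<omega>) K \<partial>P n) - (\<integral>\<omega>. min (e n \<omega>) K \<partial>P n)) \<longlonglongrightarrow> 0"
  proof (rule Lim_null_comparison[OF _ truncated_lik_ratio[OF assms]], rule always_eventually, rule allI)
    fix n
    show "norm ((\<integral>\<omega>. min (L n \<omega>) K \<partial>P n) - (\<integral>\<omega>. min (e n \<omega>) K \<partial>P n)) \<le> (\<integral>\<omega>. \<bar>min (L n \<omega>) K - min (e n \<omega>) K\<bar> \<partial>P n)"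
    proof -
      have "(\<integral>\<omega>. min (L n \<omega>) K \<partial>P n) - (\<integral>\<omega>. min (e n \<omega>) K \<partial>P n) = (\<integral>\<omega>. min (L n \<omega>) K - min (e n \<omega>) K \<partial>P n)"
        using integrable_truncated[OF assms, of n] by simp
      then show ?thesis
        by (simp only: real_norm_def integral_abs_bound)
    qed
  qed
  ultimately show ?thesis
    using tendsto_add by (fastforce simp: tail_def)
qed

lemma tail_nonneg: "0 < K \<Longrightarrow> 0 \<le> tail K"
  and tail_antimono: "0 < K \<Longrightarrow> K \<le> K' \<Longrightarrow> tail K' \<le> tail K"
  and tail_eq: "0 < K \<Longrightarrow> tail K = (\<integral>x. exp (z x) - min (exp (z x)) K \<partial>N)"
proof -
  interpret N: prob_space N by (rule N)
  have i: "integrable N (\<lambda>x. min (exp (z x)) K)" if "0 < K" for K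
    using that by (intro N.integrable_const_bound[where B=K]) (auto simp: abs_min_nonneg)
  show "tail K = (\<integral>x. exp (z x) - min (exp (z x)) K \<partial>N)" if "0 < K" for K
    using i[OF that] integrable_exp_z by (simp add: tail_def integral_exp_z)
  then show "0 \<le> tail K" if "0 < K" for K
    using that by (simp add: integral_nonneg)
  show "tail K' \<le> tail K" if "0 < K" "K \<le> K'" for K K'
    unfolding tail_def using that i[of K] i[of K'] by (auto intro!: integral_mono)
qed

lemma tail_small:
  assumes "0 < \<eta>"
  obtains K where "0 < K" "tail K < \<eta>"
proof -
  have "((\<lambda>k. \<integral>x. min (exp (z x)) k \<partial>N) \<longlongrightarrow> (\<integral>x. exp (z x) \<partial>N)) at_top"
  proof (rule integral_dominated_convergence_at_top[where w="\<lambda>x. exp (z x)"])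
    show "AE x in N. ((\<lambda>k. min (exp (z x)) k) \<longlongrightarrow> exp (z x)) at_top"
    proof (rule AE_I2)
      fix x
      have "\<forall>\<^sub>F k in at_top. min (exp (z x)) k = exp (z x)"
        using eventually_ge_at_top[of "exp (z x)"] by eventually_elim simp
      then show "((\<lambda>k. min (exp (z x)) k) \<longlongrightarrow> exp (z x)) at_top"
        by (rule tendsto_eventually)
    qed
    show "\<forall>\<^sub>F k in at_top. AE x in N. norm (min (exp (z x)) k) \<le> exp (z x)"
      using eventually_ge_at_top[of 0] by eventually_elim (auto simp: abs_min_nonneg)
  qed (simp_all add: integrable_exp_z)
  then have "\<forall>\<^sub>F k in at_top. 1 - \<eta> < (\<integral>x. min (exp (z x)) k \<partial>N)"
    using assms by (auto intro!: order_tendstoD(1) simp: integral_exp_z)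
  then have "\<forall>\<^sub>F k in at_top. 0 < k \<and> tail k < \<eta>"
    using eventually_gt_at_top[of 0] by eventually_elim (simp add: tail_def)
  then show ?thesis
    using that by (auto simp: eventually_at_top_linorder)
qed

text \<open>Stated for arbitrary bounded \<open>g n\<close> because likelihood ratio processes are
  not functions of \<open>X n\<close>. The truncated ratio is a minorant, which costs
  \<open>B * tail K\<close>; replacing it by the truncated exponential costs nothing in the
  limit.\<close>

lemma change_of_measure:
  assumes g [measurable]: "\<And>n. g n \<in> borel_measurable (P n)" and gB: "\<And>n \<omega>. \<bar>g n \<omega>\<bar> \<le> B"
    and K: "0 < K" and \<eta>: "0 < \<eta>"
  shows "\<forall>\<^sub>F n in sequentially. \<bar>(\<integral>\<omega>. g n \<omega> \<partial>Q n) - (\<integral>\<omega>. g n \<omega> * min (e n \<omega>) K \<partial>P n)\<bar> \<le> B * tail K + \<eta>"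
proof -
  have B: "0 \<le> B"
    using gB[of 0 undefined] by linarith
  have "(\<lambda>n. B * (1 - (\<integral>\<omega>. min (L n \<omega>) K \<partial>P n)) + B * (\<integral>\<omega>. \<bar>min (L n \<omega>) K - min (e n \<omega>) K\<bar> \<partial>P n))
      \<longlonglongrightarrow> B * (1 - (1 - tail K)) + B * 0"
    by (intro tendsto_intros integral_truncated truncated_lik_ratio K)
  then have "\<forall>\<^sub>F n in sequentially. B * (1 - (\<integral>\<omega>. min (L n \<omega>) K \<partial>P n)) + B * (\<integral>\<omega>. \<bar>min (L n \<omega>) K - min (e n \<omega>) K\<bar> \<partial>P n) < B * tail K + \<eta>"
    by (rule order_tendstoD(2)) (simp add: \<eta>)
  then show ?thesis
  proof eventually_elim
    case (elim n)
    interpret prob_space "P n" by (rule P)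
    have "\<bar>(\<integral>\<omega>. g n \<omega> \<partial>Q n) - (\<integral>\<omega>. g n \<omega> * min (L n \<omega>) K \<partial>P n)\<bar> \<le> B * (1 - (\<integral>\<omega>. min (L n \<omega>) K \<partial>P n))"
      using K L(2)[of n] by (intro integral_lik_ratio_minorant[where K=K] P Q sets_Q gB) auto
    moreover have "\<bar>(\<integral>\<omega>. g n \<omega> * min (L n \<omega>) K \<partial>P n) - (\<integral>\<omega>. g n \<omega> * min (e n \<omega>) K \<partial>P n)\<bar> \<le>
        B * (\<integral>\<omega>. \<bar>min (L n \<omega>) K - min (e n \<omega>) K\<bar> \<partial>P n)"
    proof -
      have i: "integrable (P n) (\<lambda>\<omega>. g n \<omega> * min (L n \<omega>) K)" "integrable (P n) (\<lambda>\<omega>. g n \<omega> * min (e n \<omega>) K)"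
        by (rule integrable_const_bound[where B="B * K"]; simp add: abs_mult_min_le gB K L(2))+
      have "\<bar>(\<integral>\<omega>. g n \<omega> * min (L n \<omega>) K \<partial>P n) - (\<integral>\<omega>. g n \<omega> * min (e n \<omega>) K \<partial>P n)\<bar> =
          \<bar>\<integral>\<omega>. g n \<omega> * min (L n \<omega>) K - g n \<omega> * min (e n \<omega>) K \<partial>P n\<bar>"
        using i by simp
      also have "\<dots> \<le> (\<integral>\<omega>. \<bar>g n \<omega> * min (L n \<omega>) K - g n \<omega> * min (e n \<omega>) K\<bar> \<partial>P n)"
        by (rule integral_abs_bound)
      also have "\<dots> \<le> (\<integral>\<omega>. B * \<bar>min (L n \<omega>) K - min (e n \<omega>) K\<bar> \<partial>P n)"
      proof (rule integral_mono)
        show "integrable (P n) (\<lambda>\<omega>. \<bar>g n \<omega> * min (L n \<omega>) K - g n \<omega> * min (e n \<omega>) K\<bar>)"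
          using i by (intro integrable_abs Bochner_Integration.integrable_diff)
        show "integrable (P n) (\<lambda>\<omega>. B * \<bar>min (L n \<omega>) K - min (e n \<omega>) K\<bar>)"
          using integrable_truncated[OF K, of n]
          by (intro integrable_mult_right integrable_abs Bochner_Integration.integrable_diff)
      qed (simp add: abs_mult_diff gB mult_right_mono)
      finally show ?thesis by simp
    qed
    ultimately show ?case
      using elim by linarith
  qed
qed

text \<open>\<open>\<phi> * exp z\<close> need not be bounded, so weak convergence does not apply to
  it directly. A level \<open>K\<close> is fixed first, the truncated integrals converge, and
  \<open>B * tail K\<close> bounds the error on both sides.\<close>

lemma le_cam_third_lemma:
  assumes \<phi>: "continuous_on UNIV \<phi>" and B: "\<And>x. \<bar>\<phi> x\<bar> \<le> B"
  shows "(\<lambda>n. \<integral>\<omega>. \<phi> (X n \<omega>) \<partial>Q n) \<longlonglongrightarrow> (\<integral>x. \<phi> x * exp (z x) \<partial>N)"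
proof (rule tendstoI)
  fix \<eta> :: real assume \<eta>: "0 < \<eta>"
  have B0: "0 \<le> B"
    using B[of undefined] by linarith
  have [measurable]: "\<phi> \<in> borel_measurable borel"
    by (rule borel_measurable_continuous_onI[OF \<phi>])
  have [measurable]: "\<phi> \<in> borel_measurable N"
    using N(2) by (simp cong: measurable_cong_sets)
  interpret N: prob_space N by (rule N)
  \<comment> \<open>Four errors of at most \<open>\<eta> / 4\<close> occur, the strict ones giving
    the strict total. \<open>B + 1\<close> in the denominator covers \<open>B = 0\<close>.\<close>
  obtain K where K: "0 < K" "tail K < \<eta> / (4 * (B + 1))"
    using tail_small[of "\<eta> / (4 * (B + 1))"] \<eta> B0 by auto
  have "B * tail K \<le> (B + 1) * tail K"
    using tail_nonneg[OF K(1)] by (simp add: distrib_right)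
  also have "\<dots> < \<eta> / 4"
    using K(2) B0 by (simp add: field_simps)
  finally have small: "B * tail K < \<eta> / 4" .
  have "(\<lambda>n. \<integral>\<omega>. \<phi> (X n \<omega>) * min (exp (z (X n \<omega>))) K \<partial>P n) \<longlonglongrightarrow> (\<integral>x. \<phi> x * min (exp (z x)) K \<partial>N)"
    by (rule tendsto_bounded_weak[OF weak, where B="B * K"])
      (use K(1) B in \<open>auto intro!: continuous_intros cont \<phi> abs_mult_min_le\<close>)
  then have ev1: "\<forall>\<^sub>F n in sequentially. \<bar>(\<integral>\<omega>. \<phi> (X n \<omega>) * min (exp (z (X n \<omega>))) K \<partial>P n) - (\<integral>x. \<phi> x * min (exp (z x)) K \<partial>N)\<bar> < \<eta> / 4"
    using \<eta> by (auto dest!: tendstoD[where e="\<eta> / 4"] simp: dist_real_def)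
  have ev2: "\<forall>\<^sub>F n in sequentially. \<bar>(\<integral>\<omega>. \<phi> (X n \<omega>) \<partial>Q n) - (\<integral>\<omega>. \<phi> (X n \<omega>) * min (e n \<omega>) K \<partial>P n)\<bar> \<le> B * tail K + \<eta> / 4"
    using \<eta> by (intro change_of_measure K(1) B) auto
  have bd: "\<bar>(\<integral>x. \<phi> x * min (exp (z x)) K \<partial>N) - (\<integral>x. \<phi> x * exp (z x) \<partial>N)\<bar> \<le> B * tail K"
  proof -
    have "integrable N (\<lambda>x. min (exp (z x)) K)"
      using K(1) by (intro N.integrable_const_bound[where B=K]) (auto simp: abs_min_nonneg)
    moreover have "integrable N (\<lambda>x. \<phi> x * exp (z x))"
      by (rule Bochner_Integration.integrable_bound[OF integrable_mult_right[of B, OF integrable_exp_z]])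
        (use B B0 in \<open>auto simp: abs_mult intro!: mult_right_mono\<close>)
    moreover have "integrable N (\<lambda>x. \<phi> x * min (exp (z x)) K)"
      using K(1) B by (intro N.integrable_const_bound[where B="B * K"]) (auto intro!: abs_mult_min_le)
    ultimately have i: "integrable N (\<lambda>x. \<phi> x * min (exp (z x)) K)" "integrable N (\<lambda>x. \<phi> x * exp (z x))"
      "integrable N (\<lambda>x. exp (z x) - min (exp (z x)) K)"
      using integrable_exp_z by auto
    have "\<bar>(\<integral>x. \<phi> x * min (exp (z x)) K \<partial>N) - (\<integral>x. \<phi> x * exp (z x) \<partial>N)\<bar> =
        \<bar>\<integral>x. \<phi> x * min (exp (z x)) K - \<phi> x * exp (z x) \<partial>N\<bar>"
      using i by simp
    also have "\<dots> \<le> (\<integral>x. \<bar>\<phi> x * min (exp (z x)) K - \<phi> x * exp (z x)\<bar> \<partial>N)"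
      by (rule integral_abs_bound)
    also have "\<dots> \<le> (\<integral>x. B * (exp (z x) - min (exp (z x)) K) \<partial>N)"
    proof (rule integral_mono)
      show "integrable N (\<lambda>x. \<bar>\<phi> x * min (exp (z x)) K - \<phi> x * exp (z x)\<bar>)"
        using i by (intro integrable_abs Bochner_Integration.integrable_diff)
      show "integrable N (\<lambda>x. B * (exp (z x) - min (exp (z x)) K))"
        using i by simp
      fix x
      have "\<bar>min (exp (z x)) K - exp (z x)\<bar> = exp (z x) - min (exp (z x)) K"
        by simp
      then show "\<bar>\<phi> x * min (exp (z x)) K - \<phi> x * exp (z x)\<bar> \<le> B * (exp (z x) - min (exp (z x)) K)"
        unfolding abs_mult_diff by (simp add: B mult_right_mono)
    qed
    finally show ?thesis
      by (simp add: tail_eq[OF K(1)])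
  qed
  show "\<forall>\<^sub>F n in sequentially. dist (\<integral>\<omega>. \<phi> (X n \<omega>) \<partial>Q n) (\<integral>x. \<phi> x * exp (z x) \<partial>N) < \<eta>"
    unfolding dist_real_def using ev1 ev2 by eventually_elim (use small bd in linarith)
qed

end

section \<open>Likelihood ratio processes\<close>

lemma tendsto_funI:
  fixes f :: "nat \<Rightarrow> 'h \<Rightarrow> 'c::topological_space"
  assumes "\<And>h. (\<lambda>k. f k h) \<longlonglongrightarrow> l h"
  shows "f \<longlonglongrightarrow> l"
  using assms limitin_componentwise[of "\<lambda>_::'h. euclidean :: 'c topology" UNIV f l sequentially]
  by (simp add: euclidean_product_topology)

text \<open>
  \<open>'h\<close> may be uncountable, in which case the product topology has more Borel sets than the product
  \<open>\<sigma>\<close>-algebra; the finitely many relevant coordinates are therefore routed through \<open>nat \<Rightarrow> real\<close>.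
\<close>

lemma measurable_finite_dim_process:
  fixes f :: "('h \<Rightarrow> real) \<Rightarrow> real" and Y :: "'h \<Rightarrow> 'a \<Rightarrow> real"
  assumes I: "finite I" and f: "continuous_on UNIV f" and Y: "\<And>h. h \<in> I \<Longrightarrow> Y h \<in> borel_measurable M"
  shows "(\<lambda>\<omega>. f (\<lambda>h. if h \<in> I then Y h \<omega> else 0)) \<in> borel_measurable M"
proof -
  obtain idx :: "'h \<Rightarrow> nat" where inj: "inj_on idx I"
    using I finite_imp_inj_to_nat_seg by metis
  let ?emb = "\<lambda>y::nat \<Rightarrow> real. (\<lambda>h. if h \<in> I then y (idx h) else 0)"
  have "continuous_on UNIV ?emb"
  proof (rule continuous_on_coordinatewise_then_product)
    fix h
    show "continuous_on UNIV (\<lambda>y::nat \<Rightarrow> real. if h \<in> I then y (idx h) else 0)"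
      by (cases "h \<in> I") (auto intro: continuous_on_product_then_coordinatewise[OF continuous_on_id, simplified])
  qed
  then have "continuous_on UNIV (f \<circ> ?emb)"
    by (rule continuous_on_compose) (rule continuous_on_subset[OF f subset_UNIV])
  then have *: "f \<circ> ?emb \<in> borel_measurable (PiM UNIV (\<lambda>_. borel))"
    using borel_measurable_continuous_onI sets_PiM_equal_borel measurable_cong_sets by blast
  let ?Y = "\<lambda>\<omega> i. if i \<in> idx ` I then Y (the_inv_into I idx i) \<omega> else 0"
  have "?Y \<in> M \<rightarrow>\<^sub>M PiM UNIV (\<lambda>_. borel)"
  proof (rule measurable_PiM_single')
    fix i
    show "(\<lambda>\<omega>. ?Y \<omega> i) \<in> borel_measurable M"
      using Y the_inv_into_into[OF inj _ order_refl] by (cases "i \<in> idx ` I") auto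
  qed auto
  from measurable_compose[OF this *]
  have "(\<lambda>\<omega>. (f \<circ> ?emb) (?Y \<omega>)) \<in> borel_measurable M" .
  moreover have "?emb (?Y \<omega>) = (\<lambda>h. if h \<in> I then Y h \<omega> else 0)" for \<omega>
    by (auto simp: the_inv_into_f_f[OF inj])
  ultimately show ?thesis
    by (simp add: comp_def)
qed

text \<open>A compactness argument in place of uniform continuity: the function space need not be
  metrizable, but a sequence of counterexamples with \<open>x\<close> in the ball and
  \<open>v\<close> tending to 0 has a subsequence along which the arguments of \<open>f\<close>
  converge coordinatewise, that is, in the product topology.\<close>

lemma finite_dim_modulus:
  fixes f :: "('h \<Rightarrow> real) \<Rightarrow> real" and d :: "'h \<Rightarrow> 'b::euclidean_space \<Rightarrow> real"
  assumes f: "continuous_on UNIV f" and d: "\<And>h. h \<in> I \<Longrightarrow> continuous_on UNIV (d h)" and "0 < \<eta>"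
  obtains \<epsilon> where "0 < \<epsilon>" "\<And>x v. x \<in> cball 0 R \<Longrightarrow> (\<And>h. h \<in> I \<Longrightarrow> \<bar>v h\<bar> \<le> \<epsilon>) \<Longrightarrow>
    \<bar>f (\<lambda>h. if h \<in> I then exp (d h x + v h) else 0) - f (\<lambda>h. if h \<in> I then exp (d h x) else 0)\<bar> \<le> \<eta>"
proof (rule ccontr)
  assume no: "\<not> thesis"
  let ?F = "\<lambda>x v. f (\<lambda>h. if h \<in> I then exp (d h x + v h) else 0)" and ?G = "\<lambda>x. f (\<lambda>h. if h \<in> I then exp (d h x) else 0)"
  have "\<exists>x v. x \<in> cball 0 R \<and> (\<forall>h\<in>I. \<bar>v h\<bar> \<le> inverse (real (Suc k))) \<and> \<not> \<bar>?F x v - ?G x\<bar> \<le> \<eta>" for k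
  proof (rule ccontr)
    assume "\<nexists>x v. x \<in> cball 0 R \<and> (\<forall>h\<in>I. \<bar>v h\<bar> \<le> inverse (real (Suc k))) \<and> \<not> \<bar>?F x v - ?G x\<bar> \<le> \<eta>"
    then show False
      using no that[of "inverse (real (Suc k))"] by auto
  qed
  note ex = this
  \<comment> \<open>Point and perturbation are packed into a pair so that a single choice yields
    both sequences.\<close>
  have "\<forall>k. \<exists>p. fst p \<in> cball 0 R \<and> (\<forall>h\<in>I. \<bar>snd p h\<bar> \<le> inverse (real (Suc k))) \<and>
      \<not> \<bar>?F (fst p) (snd p) - ?G (fst p)\<bar> \<le> \<eta>"
  proof
    fix k
    obtain x v where *: "x \<in> cball 0 R \<and> (\<forall>h\<in>I. \<bar>v h\<bar> \<le> inverse (real (Suc k))) \<and> \<not> \<bar>?F x v - ?G x\<bar> \<le> \<eta>"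
      using ex by blast
    show "\<exists>p. fst p \<in> cball 0 R \<and> (\<forall>h\<in>I. \<bar>snd p h\<bar> \<le> inverse (real (Suc k))) \<and>
      \<not> \<bar>?F (fst p) (snd p) - ?G (fst p)\<bar> \<le> \<eta>"
      by (rule exI[of _ "(x, v)"], unfold fst_conv snd_conv, rule *)
  qed
  from choice[OF this] obtain p where p: "\<And>k. fst (p k) \<in> cball 0 R \<and>
      (\<forall>h\<in>I. \<bar>snd (p k) h\<bar> \<le> inverse (real (Suc k))) \<and> \<not> \<bar>?F (fst (p k)) (snd (p k)) - ?G (fst (p k))\<bar> \<le> \<eta>"
    by blast
  define x v where "x k = fst (p k)" and "v k = snd (p k)" for k
  have x: "\<And>k. x k \<in> cball 0 R" and v: "\<And>k h. h \<in> I \<Longrightarrow> \<bar>v k h\<bar> \<le> inverse (real (Suc k))"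
    and bad: "\<And>k. \<not> \<bar>?F (x k) (v k) - ?G (x k)\<bar> \<le> \<eta>"
    using p by (simp_all only: x_def v_def) blast+
  have "seq_compact (cball (0::'b) R)"
    by (simp add: compact_imp_seq_compact)
  then obtain l s where s: "strict_mono (s :: nat \<Rightarrow> nat)" and lim: "(x \<circ> s) \<longlonglongrightarrow> l"
    using x by (elim seq_compactE[of _ x]) auto
  have v0: "(\<lambda>k. v (s k) h) \<longlonglongrightarrow> 0" if "h \<in> I" for h
  proof -
    have "(\<lambda>k. v k h) \<longlonglongrightarrow> 0"
      by (rule Lim_null_comparison[OF _ LIMSEQ_inverse_real_of_nat]) (use v[OF that] in auto)
    from LIMSEQ_subseq_LIMSEQ[OF this s] show ?thesis
      by (simp add: comp_def)
  qed
  have d': "(\<lambda>k. d h (x (s k))) \<longlonglongrightarrow> d h l" if "h \<in> I" for h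
    using continuous_on_tendsto_compose[OF d[OF that] lim] by (simp add: comp_def)
  \<comment> \<open>Used for \<open>w = v\<close> and for \<open>w = 0\<close>: the perturbed and
    the unperturbed values have the same limit, against the lower bound
    \<open>\<eta>\<close>.\<close>
  have "(\<lambda>k. ?F (x (s k)) (w (s k))) \<longlonglongrightarrow> ?F l (\<lambda>_. 0)"
    if w: "\<And>h. h \<in> I \<Longrightarrow> (\<lambda>k. w (s k) h) \<longlonglongrightarrow> 0" for w
  proof (rule continuous_on_tendsto_compose[OF f])
    show "(\<lambda>k h. if h \<in> I then exp (d h (x (s k)) + w (s k) h) else 0) \<longlonglongrightarrow> (\<lambda>h. if h \<in> I then exp (d h l + 0) else 0)"
    proof (rule tendsto_funI)
      fix h
      show "(\<lambda>k. if h \<in> I then exp (d h (x (s k)) + w (s k) h) else 0) \<longlonglongrightarrow> (if h \<in> I then exp (d h l + 0) else 0)"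
        by (cases "h \<in> I") (auto intro!: tendsto_exp tendsto_add d' w simp del: add_0_right)
    qed
  qed auto
  from tendsto_diff[OF this[of v, OF v0] this[of "\<lambda>_ _. 0"]]
  have "(\<lambda>k. ?F (x (s k)) (v (s k)) - ?G (x (s k))) \<longlonglongrightarrow> 0"
    by (simp cong: if_cong)
  then have "\<forall>\<^sub>F k in sequentially. \<bar>?F (x (s k)) (v (s k)) - ?G (x (s k))\<bar> < \<eta>"
    using \<open>0 < \<eta>\<close> by (auto dest!: tendstoD simp: dist_real_def)
  from eventually_happens'[OF _ this] obtain k where "\<bar>?F (x (s k)) (v (s k)) - ?G (x (s k))\<bar> < \<eta>"
    by auto
  with bad[of "s k"] show False
    by simp
qed

lemma conv_in_dist_tight:
  fixes X :: "nat \<Rightarrow> 'a \<Rightarrow> 'b::euclidean_space"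
  assumes P: "\<And>n. prob_space (P n)" and X [measurable]: "\<And>n. X n \<in> borel_measurable (P n)"
    and weak: "conv_in_dist P X N (\<lambda>x. x)" and N: "prob_space N" "sets N = sets borel" and "0 < \<eta>"
  obtains R where "\<forall>\<^sub>F n in sequentially. measure (P n) {\<omega> \<in> space (P n). X n \<omega> \<notin> cball 0 R} < \<eta>"
proof -
  interpret N: prob_space N by (rule N)
  note N(2) [measurable_cong]
  \<comment> \<open>A continuous cutoff, 0 on the ball of radius \<open>R\<close> and 1 outside
    radius \<open>R + 1\<close>. It dominates the indicator of the complement of the larger ball,
    hence the radius \<open>R + 1\<close> below.\<close>
  let ?\<chi> = "\<lambda>R (x::'b). min 1 (max 0 (norm x - R))"
  have "((\<lambda>R. \<integral>x. ?\<chi> R x \<partial>N) \<longlongrightarrow> (\<integral>x. 0 \<partial>N)) at_top"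
  proof (rule integral_dominated_convergence_at_top[where w="\<lambda>_. 1"])
    show "AE x in N. ((\<lambda>R. ?\<chi> R x) \<longlongrightarrow> 0) at_top"
    proof (rule AE_I2)
      fix x :: 'b
      have "\<forall>\<^sub>F R in at_top. ?\<chi> R x = 0"
        using eventually_ge_at_top[of "norm x"] by eventually_elim simp
      then show "((\<lambda>R. ?\<chi> R x) \<longlongrightarrow> 0) at_top"
        by (rule tendsto_eventually)
    qed
  qed auto
  then have "\<forall>\<^sub>F R in at_top. (\<integral>x. ?\<chi> R x \<partial>N) < \<eta>"
    using \<open>0 < \<eta>\<close> by (auto intro!: order_tendstoD(2))
  then obtain R where R: "(\<integral>x. ?\<chi> R x \<partial>N) < \<eta>"
    by (auto simp: eventually_at_top_linorder)
  have "(\<lambda>n. \<integral>\<omega>. ?\<chi> R (X n \<omega>) \<partial>P n) \<longlonglongrightarrow> (\<integral>x. ?\<chi> R x \<partial>N)"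
    by (rule tendsto_bounded_weak[OF weak, where B=1]) (auto intro!: continuous_intros)
  then have "\<forall>\<^sub>F n in sequentially. (\<integral>\<omega>. ?\<chi> R (X n \<omega>) \<partial>P n) < \<eta>"
    using R by (rule order_tendstoD(2))
  then have "\<forall>\<^sub>F n in sequentially. measure (P n) {\<omega> \<in> space (P n). X n \<omega> \<notin> cball 0 (R + 1)} < \<eta>"
  proof eventually_elim
    case (elim n)
    interpret prob_space "P n" by (rule P)
    define A where "A = {\<omega> \<in> space (P n). X n \<omega> \<notin> cball 0 (R + 1)}"
    have [measurable]: "A \<in> sets (P n)"
      unfolding A_def mem_cball_0 by measurable
    have "measure (P n) A = (\<integral>\<omega>. indicator A \<omega> \<partial>P n)"
      by simp
    also have "\<dots> \<le> (\<integral>\<omega>. ?\<chi> R (X n \<omega>) \<partial>P n)"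
    proof (rule integral_mono)
      show "integrable (P n) (\<lambda>\<omega>. ?\<chi> R (X n \<omega>))"
        by (rule integrable_const_bound[where B=1]) auto
    qed (auto simp: A_def less_top[symmetric] split: split_indicator)
    finally show ?case
      using elim by (simp add: A_def)
  qed
  then show ?thesis
    using that by blast
qed

text \<open>On a likely event under \<open>P n\<close> each ratio to base \<open>h0\<close> is
  \<open>exp (z h - z h0 + v)\<close> with small \<open>v\<close>, so the process can be replaced by
  a continuous function of \<open>X n\<close>. Truncation carries this closeness over to
  \<open>E n h0\<close>, where Le Cam's third lemma gives the limit.\<close>

proposition lr_process_limit:
  fixes E :: "nat \<Rightarrow> 'h \<Rightarrow> 'a measure" and X :: "nat \<Rightarrow> 'a \<Rightarrow> 'b::euclidean_space"
  assumes lr: "\<And>h. h \<in> insert h0 I \<Longrightarrow> lr_expansion P (\<lambda>n. E n h) X N (z h)"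
    and I: "finite I" and f: "continuous_on UNIV f" and fB: "\<And>y. \<bar>f y\<bar> \<le> B"
  shows "(\<lambda>n. \<integral>\<omega>. f (lr_process I (E n) h0 \<omega>) \<partial>E n h0) \<longlonglongrightarrow>
    (\<integral>x. f (\<lambda>h. if h \<in> I then exp (z h x - z h0 x) else 0) * exp (z h0 x) \<partial>N)"
proof -
  interpret h0: lr_expansion P "\<lambda>n. E n h0" X N "z h0"
    by (rule lr) simp
  note [measurable] = h0.X
  note fin = h0.fin
  have finE: "finite_measure (E n h)" and setsE: "sets (E n h) = sets (P n)" if "h \<in> insert h0 I" for h n
    using lr_expansion.fin(2)[OF lr[OF that]] lr_expansion.sets_Q[OF lr[OF that]] by auto
  have B0: "0 \<le> B"
    using fB[of undefined] by linarith
  let ?L = "\<lambda>h n. lik_ratio (E n h) (P n)"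
  define \<psi> where "\<psi> x = f (\<lambda>h. if h \<in> I then exp (z h x - z h0 x) else 0)" for x
  have zcont: "continuous_on UNIV (\<lambda>x. z h x - z h0 x)" if "h \<in> I" for h
    using lr_expansion.cont[OF lr] that by (intro continuous_intros) auto
  have \<psi>: "continuous_on UNIV \<psi>"
    unfolding \<psi>_def
  proof (rule continuous_on_compose2[OF f])
    show "continuous_on UNIV (\<lambda>x h. if h \<in> I then exp (z h x - z h0 x) else 0)"
    proof (rule continuous_on_coordinatewise_then_product)
      fix h
      show "continuous_on UNIV (\<lambda>x. if h \<in> I then exp (z h x - z h0 x) else 0)"
        by (cases "h \<in> I") (auto intro!: continuous_on_exp zcont)
    qed
  qed simp
  have \<psi>B: "\<bar>\<psi> x\<bar> \<le> B" for x
    by (simp add: \<psi>_def fB)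
  have [measurable]: "\<psi> \<in> borel_measurable borel"
    by (rule borel_measurable_continuous_onI[OF \<psi>])
  let ?g = "\<lambda>n \<omega>. f (lr_process I (E n) h0 \<omega>)"
  have g [measurable]: "?g n \<in> borel_measurable (P n)" for n
  proof -
    have "lik_ratio (E n h) (E n h0) \<in> borel_measurable (P n)" if "h \<in> I" for h
      using lik_ratio_spec(1)[of "E n h0" "E n h"] finE setsE that by (simp cong: measurable_cong_sets)
    from measurable_finite_dim_process[OF I f this] show ?thesis
      by (simp add: lr_process_def)
  qed
  have small: "\<forall>\<^sub>F n in sequentially. (\<integral>\<omega>. \<bar>?g n \<omega> - \<psi> (X n \<omega>)\<bar> \<partial>P n) < \<eta>" if \<eta>: "0 < \<eta>" for \<eta>
  proof -
    \<comment> \<open>\<open>c\<close> counts the exceptional events: one for each parameter in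
      \<open>insert h0 I\<close> and one for leaving the ball. Each has probability below
      \<open>\<kappa>\<close>, which bounds \<open>2 * B\<close> times the probability of their
      union by \<open>\<eta> / 4\<close>.\<close>
    define c where "c = real (card (insert h0 I)) + 1"
    have c: "0 < c"
      by (simp add: c_def)
    define \<kappa> where "\<kappa> = \<eta> / (8 * (B + 1) * c)"
    have \<kappa>: "0 < \<kappa>"
      using \<eta> B0 c by (simp add: \<kappa>_def)
    obtain R where tight: "\<forall>\<^sub>F n in sequentially. measure (P n) {\<omega> \<in> space (P n). X n \<omega> \<notin> cball 0 R} < \<kappa>"
      using conv_in_dist_tight[OF h0.P h0.X h0.weak h0.N \<kappa>] by blast
    have "0 < \<eta> / 4" using \<eta> by simp
    obtain \<epsilon> where \<epsilon>: "0 < \<epsilon>" and modulus: "\<And>x v. x \<in> cball 0 R \<Longrightarrow> (\<And>h. h \<in> I \<Longrightarrow> \<bar>v h\<bar> \<le> \<epsilon>) \<Longrightarrow>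
        \<bar>f (\<lambda>h. if h \<in> I then exp (z h x - z h0 x + v h) else 0) - \<psi> x\<bar> \<le> \<eta> / 4"
      using finite_dim_modulus[where d="\<lambda>h x. z h x - z h0 x" and I=I and R=R, OF f zcont \<open>0 < \<eta> / 4\<close>] unfolding \<psi>_def by blast
    \<comment> \<open>The tolerance is halved because the error in a quotient combines the errors of
      numerator and denominator.\<close>
    define bad where "bad h n = {\<omega> \<in> space (P n). \<not> (0 < ?L h n \<omega> \<and> \<bar>ln (?L h n \<omega>) - z h (X n \<omega>)\<bar> \<le> \<epsilon> / 2)}" for h n
    define far where "far n = {\<omega> \<in> space (P n). X n \<omega> \<notin> cball 0 R}" for n
    define U where "U n = far n \<union> (\<Union>h\<in>insert h0 I. bad h n)" for n
    have "\<forall>\<^sub>F n in sequentially. \<forall>h\<in>insert h0 I. measure (P n) (bad h n) < \<kappa>"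
      using I lr_expansion.eventually_bad[OF lr _ \<kappa>, of _ "\<epsilon> / 2"] \<epsilon>
      unfolding bad_def by (intro eventually_ball_finite) auto
    with tight show ?thesis
    proof eventually_elim
      case (elim n)
      interpret prob_space "P n" by (rule h0.P)
      have bad_m [measurable]: "bad h n \<in> sets (P n)" if "h \<in> insert h0 I" for h
      proof -
        have [measurable]: "?L h n \<in> borel_measurable (P n)"
          by (rule lr_expansion.L(1)[OF lr[OF that]])
        have [measurable]: "z h \<in> borel_measurable borel"
          by (rule lr_expansion.z[OF lr[OF that]])
        show ?thesis
          unfolding bad_def by measurable
      qed
      have far_m [measurable]: "far n \<in> sets (P n)"
        unfolding far_def mem_cball_0 by measurable
      have bads_m: "(\<Union>h\<in>insert h0 I. bad h n) \<in> sets (P n)"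
        by (rule sets.finite_UN) (use I bad_m in auto)
      then have U_m [measurable]: "U n \<in> sets (P n)"
        unfolding U_def by (rule sets.Un[OF far_m])
      have "measure (P n) (U n) \<le> measure (P n) (far n) + (\<Sum>h\<in>insert h0 I. measure (P n) (bad h n))"
        unfolding U_def using I bad_m
        by (intro order_trans[OF measure_Un_le[OF far_m bads_m]] add_left_mono measure_UNION_le) auto
      also have "\<dots> \<le> \<kappa> + (\<Sum>h\<in>insert h0 I. \<kappa>)"
        using elim by (intro add_mono sum_mono) (auto simp: far_def intro: less_imp_le)
      also have "\<dots> = \<eta> / (8 * (B + 1))"
      proof -
        have "\<kappa> + (\<Sum>h\<in>insert h0 I. \<kappa>) = c * \<kappa>"
          by (simp add: c_def algebra_simps)
        also have "\<dots> = \<eta> / (8 * (B + 1))"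
          using B0 c by (simp add: \<kappa>_def)
        finally show ?thesis .
      qed
      finally have "2 * B * measure (P n) (U n) \<le> 2 * (B + 1) * (\<eta> / (8 * (B + 1)))"
        using B0 by (intro mult_mono) auto
      also have "\<dots> = \<eta> / 4"
      proof -
        have "2 * b * (\<eta> / (8 * b)) = \<eta> / 4" if "0 < b" for b
          using that by simp
        from this[of "B + 1"] B0 show ?thesis
          by simp
      qed
      finally have PU: "2 * B * measure (P n) (U n) \<le> \<eta> / 4" .
      have quot: "AE \<omega> in P n. \<forall>h\<in>I. 0 < ?L h0 n \<omega> \<longrightarrow> lik_ratio (E n h) (E n h0) \<omega> = ?L h n \<omega> / ?L h0 n \<omega>"
        using I by (intro AE_finite_allI lik_ratio_quotient) (auto simp: finE setsE fin)
      have "AE \<omega> in P n. \<bar>?g n \<omega> - \<psi> (X n \<omega>)\<bar> \<le> \<eta> / 4 + 2 * B * indicator (U n) \<omega>"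
        using quot AE_space
      proof eventually_elim
        case (elim \<omega>)
        show ?case
        proof (cases "\<omega> \<in> U n")
          case True
          have "\<bar>?g n \<omega> - \<psi> (X n \<omega>)\<bar> \<le> 2 * B"
            using fB[of "lr_process I (E n) h0 \<omega>"] \<psi>B[of "X n \<omega>"] by linarith
          then show ?thesis
            using True \<eta> by simp
        next
          case False
          then have x: "X n \<omega> \<in> cball 0 R"
            and good: "\<And>h. h \<in> insert h0 I \<Longrightarrow> 0 < ?L h n \<omega> \<and> \<bar>ln (?L h n \<omega>) - z h (X n \<omega>)\<bar> \<le> \<epsilon> / 2"
            using elim(2) by (auto simp: U_def far_def bad_def)
          define v where "v h = (ln (?L h n \<omega>) - z h (X n \<omega>)) - (ln (?L h0 n \<omega>) - z h0 (X n \<omega>))" for h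
          have "\<bar>v h\<bar> \<le> \<epsilon>" if "h \<in> I" for h
          proof -
            have "\<bar>ln (?L h n \<omega>) - z h (X n \<omega>)\<bar> \<le> \<epsilon> / 2" "\<bar>ln (?L h0 n \<omega>) - z h0 (X n \<omega>)\<bar> \<le> \<epsilon> / 2"
              using good[of h] good[of h0] that by auto
            then show ?thesis
              unfolding v_def by linarith
          qed
          from modulus[OF x this]
          have "\<bar>f (\<lambda>h. if h \<in> I then exp (z h (X n \<omega>) - z h0 (X n \<omega>) + v h) else 0) - \<psi> (X n \<omega>)\<bar> \<le> \<eta> / 4" by simp
          also have "(\<lambda>h. if h \<in> I then exp (z h (X n \<omega>) - z h0 (X n \<omega>) + v h) else 0) = lr_process I (E n) h0 \<omega>"
          proof
            fix h
            show "(if h \<in> I then exp (z h (X n \<omega>) - z h0 (X n \<omega>) + v h) else 0) = lr_process I (E n) h0 \<omega> h"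
              using good[of h] good[of h0] elim(1) by (simp add: lr_process_def v_def exp_diff)
          qed
          finally show ?thesis
            using False by simp
        qed
      qed
      then have "(\<integral>\<omega>. \<bar>?g n \<omega> - \<psi> (X n \<omega>)\<bar> \<partial>P n) \<le> (\<integral>\<omega>. \<eta> / 4 + 2 * B * indicator (U n) \<omega> \<partial>P n)"
      proof (rule integral_mono_AE[rotated 2])
        show "integrable (P n) (\<lambda>\<omega>. \<bar>?g n \<omega> - \<psi> (X n \<omega>)\<bar>)"
          using fB \<psi>B
          by (intro integrable_abs Bochner_Integration.integrable_diff integrable_const_bound[where B=B]) auto
        show "integrable (P n) (\<lambda>\<omega>. \<eta> / 4 + 2 * B * indicator (U n) \<omega>)"
          by (intro Bochner_Integration.integrable_add integrable_mult_right integrable_real_indicator) (auto simp: less_top[symmetric])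
      qed
      also have "\<dots> = \<eta> / 4 + 2 * B * measure (P n) (U n)"
        by (subst Bochner_Integration.integral_add) (auto simp: prob_space less_top[symmetric])
      also have "\<dots> < \<eta>"
        using PU \<eta> by linarith
      finally show ?case .
    qed
  qed
  \<comment> \<open>Closeness is known in mean under \<open>P n\<close> and wanted under
    \<open>E n h0\<close>. Both integrals are moved to \<open>P n\<close> with the weight cut off at
    \<open>K\<close>, where the difference costs at most \<open>K\<close> times the mean
    distance.\<close>
  have "(\<lambda>n. (\<integral>\<omega>. ?g n \<omega> \<partial>E n h0) - (\<integral>\<omega>. \<psi> (X n \<omega>) \<partial>E n h0)) \<longlonglongrightarrow> 0"
  proof (rule tendstoI)
    fix \<eta> :: real assume \<eta>: "0 < \<eta>"
    obtain K where K: "0 < K" "h0.tail K < \<eta> / (8 * (B + 1))"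
      using h0.tail_small[of "\<eta> / (8 * (B + 1))"] \<eta> B0 by auto
    have "B * h0.tail K \<le> (B + 1) * h0.tail K"
      using h0.tail_nonneg[OF K(1)] by (simp add: distrib_right)
    also have "\<dots> < \<eta> / 8"
      using K(2) B0 by (simp add: field_simps)
    finally have tail: "B * h0.tail K < \<eta> / 8" .
    have ev1: "\<forall>\<^sub>F n in sequentially. \<bar>(\<integral>\<omega>. ?g n \<omega> \<partial>E n h0) - (\<integral>\<omega>. ?g n \<omega> * min (exp (z h0 (X n \<omega>))) K \<partial>P n)\<bar> \<le> B * h0.tail K + \<eta> / 8"
      by (rule h0.change_of_measure) (use K \<eta> fB in auto)
    have ev2: "\<forall>\<^sub>F n in sequentially. \<bar>(\<integral>\<omega>. \<psi> (X n \<omega>) \<partial>E n h0) - (\<integral>\<omega>. \<psi> (X n \<omega>) * min (exp (z h0 (X n \<omega>))) K \<partial>P n)\<bar> \<le> B * h0.tail K + \<eta> / 8"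
      by (rule h0.change_of_measure) (use K \<eta> \<psi>B in auto)
    have ev3: "\<forall>\<^sub>F n in sequentially. (\<integral>\<omega>. \<bar>?g n \<omega> - \<psi> (X n \<omega>)\<bar> \<partial>P n) < \<eta> / (4 * K)"
      by (rule small) (use \<eta> K in auto)
    show "\<forall>\<^sub>F n in sequentially. dist ((\<integral>\<omega>. ?g n \<omega> \<partial>E n h0) - (\<integral>\<omega>. \<psi> (X n \<omega>) \<partial>E n h0)) 0 < \<eta>"
      using ev1 ev2 ev3
    proof eventually_elim
      case (elim n)
      interpret prob_space "P n" by (rule h0.P)
      note [measurable] = h0.z
      let ?m = "\<lambda>\<omega>. min (exp (z h0 (X n \<omega>))) K"
      have i: "integrable (P n) (\<lambda>\<omega>. ?g n \<omega> * ?m \<omega>)" "integrable (P n) (\<lambda>\<omega>. \<psi> (X n \<omega>) * ?m \<omega>)"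
        by (rule integrable_const_bound[where B="B * K"]; simp add: abs_mult_min_le fB \<psi>B K)+
      have j: "integrable (P n) (\<lambda>\<omega>. \<bar>?g n \<omega> - \<psi> (X n \<omega>)\<bar>)"
        using fB \<psi>B
        by (intro integrable_abs Bochner_Integration.integrable_diff integrable_const_bound[where B=B]) auto
      have "\<bar>(\<integral>\<omega>. ?g n \<omega> * ?m \<omega> \<partial>P n) - (\<integral>\<omega>. \<psi> (X n \<omega>) * ?m \<omega> \<partial>P n)\<bar> =
          \<bar>\<integral>\<omega>. ?g n \<omega> * ?m \<omega> - \<psi> (X n \<omega>) * ?m \<omega> \<partial>P n\<bar>"
        using i by simp
      also have "\<dots> \<le> (\<integral>\<omega>. \<bar>?g n \<omega> * ?m \<omega> - \<psi> (X n \<omega>) * ?m \<omega>\<bar> \<partial>P n)"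
        by (rule integral_abs_bound)
      also have "\<dots> \<le> (\<integral>\<omega>. K * \<bar>?g n \<omega> - \<psi> (X n \<omega>)\<bar> \<partial>P n)"
      proof (rule integral_mono)
        show "integrable (P n) (\<lambda>\<omega>. \<bar>?g n \<omega> * ?m \<omega> - \<psi> (X n \<omega>) * ?m \<omega>\<bar>)"
          using i by (intro integrable_abs Bochner_Integration.integrable_diff)
        show "integrable (P n) (\<lambda>\<omega>. K * \<bar>?g n \<omega> - \<psi> (X n \<omega>)\<bar>)"
          using j by simp
        fix \<omega>
        have "\<bar>?m \<omega>\<bar> \<le> K"
          using K by simp
        then show "\<bar>?g n \<omega> * ?m \<omega> - \<psi> (X n \<omega>) * ?m \<omega>\<bar> \<le> K * \<bar>?g n \<omega> - \<psi> (X n \<omega>)\<bar>"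
          unfolding mult.commute[of _ "?m \<omega>"] abs_mult_diff by (rule mult_right_mono) simp
      qed
      also have "\<dots> = K * (\<integral>\<omega>. \<bar>?g n \<omega> - \<psi> (X n \<omega>)\<bar> \<partial>P n)"
        by simp
      also have "\<dots> < K * (\<eta> / (4 * K))"
        using elim(3) K by (intro mult_strict_left_mono) auto
      also have "\<dots> = \<eta> / 4"
        using K by simp
      finally show ?case
        unfolding dist_real_def using elim(1,2) tail by linarith
    qed
  qed
  from tendsto_add[OF this h0.le_cam_third_lemma[OF \<psi> \<psi>B]]
  show ?thesis
    by (simp add: \<psi>_def)
qed

section \<open>Covariance matrices and the residual score\<close>

lemma matrix_mult_nth: "(A ** B) $ i $ j = (\<Sum>k\<in>UNIV. A $ i $ k * B $ k $ j)"
  by (simp add: matrix_matrix_mult_def)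

lemma matrix_vector_mult_nth: "(A *v x) $ i = (\<Sum>k\<in>UNIV. A $ i $ k * x $ k)"
  by (simp add: matrix_vector_mult_def)

lemma covar_commute: "covar M X Y = covar M Y X"
  by (simp add: covar_def mult.commute)

lemma (in prob_space) has_cov_matrix_products:
  assumes "has_cov_matrix M X A"
  shows "integrable M (\<lambda>\<omega>. X \<omega> $ i)"
    and "integrable M (\<lambda>\<omega>. (X \<omega> $ i - a) * (X \<omega> $ j - b))"
proof -
  have X [measurable]: "(\<lambda>\<omega>. X \<omega> $ i) \<in> borel_measurable M"
    and X2: "integrable M (\<lambda>\<omega>. (X \<omega> $ i)\<^sup>2)" for i
    using assms by (simp_all add: has_cov_matrix_def)
  have int: "integrable M (\<lambda>\<omega>. X \<omega> $ i)" for i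
    using square_integrable_imp_integrable[OF X X2] .
  have "integrable M (\<lambda>\<omega>. X \<omega> $ i * X \<omega> $ j)" for i j
  proof (rule Bochner_Integration.integrable_bound)
    show "integrable M (\<lambda>\<omega>. (X \<omega> $ i)\<^sup>2 + (X \<omega> $ j)\<^sup>2)"
      by (intro Bochner_Integration.integrable_add X2)
    have "\<bar>x * y\<bar> \<le> x\<^sup>2 + y\<^sup>2" for x y :: real
    proof -
      have "0 \<le> (\<bar>x\<bar> - \<bar>y\<bar>)\<^sup>2" "0 \<le> x\<^sup>2 + y\<^sup>2"
        by simp_all
      moreover have "0 \<le> \<bar>x\<bar> * \<bar>y\<bar>"
        by simp
      ultimately show ?thesis
        by (simp only: power2_diff abs_mult power2_abs)
    qed
    then show "AE \<omega> in M. norm (X \<omega> $ i * X \<omega> $ j) \<le> norm ((X \<omega> $ i)\<^sup>2 + (X \<omega> $ j)\<^sup>2)"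
      by simp
  qed measurable
  then show "integrable M (\<lambda>\<omega>. (X \<omega> $ i - a) * (X \<omega> $ j - b))"
    using int by (simp add: algebra_simps)
  show "integrable M (\<lambda>\<omega>. X \<omega> $ i)"
    by (rule int)
qed

lemma (in prob_space) has_cov_matrix_linear_image:
  fixes L :: "real^'k^'m"
  assumes cov: "has_cov_matrix M X A"
  shows "has_cov_matrix M (\<lambda>\<omega>. L *v X \<omega>) (L ** A ** transpose L)"
proof -
  note X = has_cov_matrix_products[OF cov]
  have [measurable]: "(\<lambda>\<omega>. X \<omega> $ k) \<in> borel_measurable M" for k
    using cov by (simp add: has_cov_matrix_def)
  define c where "c k \<omega> = X \<omega> $ k - expectation (\<lambda>\<omega>. X \<omega> $ k)" for k \<omega>
  have comp: "(L *v X \<omega>) $ i = (\<Sum>k\<in>UNIV. L $ i $ k * X \<omega> $ k)" for i \<omega>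
    by (simp add: matrix_vector_mult_def)
  have centred: "(L *v X \<omega>) $ i - expectation (\<lambda>\<omega>. (L *v X \<omega>) $ i) = (\<Sum>k\<in>UNIV. L $ i $ k * c k \<omega>)" for i \<omega>
    using X(1) by (simp add: comp c_def sum_subtractf right_diff_distrib)
  have c_cov: "expectation (\<lambda>\<omega>. c k \<omega> * c l \<omega>) = A $ k $ l" for k l
    using cov by (simp add: has_cov_matrix_def covar_def c_def)
  have "covar M (\<lambda>\<omega>. (L *v X \<omega>) $ i) (\<lambda>\<omega>. (L *v X \<omega>) $ j) = (L ** A ** transpose L) $ i $ j" for i j
  proof -
    have "covar M (\<lambda>\<omega>. (L *v X \<omega>) $ i) (\<lambda>\<omega>. (L *v X \<omega>) $ j) =
        expectation (\<lambda>\<omega>. \<Sum>k\<in>UNIV. \<Sum>l\<in>UNIV. L $ i $ k * L $ j $ l * (c k \<omega> * c l \<omega>))"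
      unfolding covar_def centred by (simp add: sum_product ac_simps)
    also have "\<dots> = (\<Sum>k\<in>UNIV. \<Sum>l\<in>UNIV. L $ i $ k * L $ j $ l * A $ k $ l)"
      using X(2) by (simp add: c_def c_cov[unfolded c_def])
    also have "\<dots> = (L ** A ** transpose L) $ i $ j"
    proof -
      have "(\<Sum>l\<in>UNIV. (\<Sum>k\<in>UNIV. L $ i $ k * A $ k $ l) * L $ j $ l) =
          (\<Sum>l\<in>UNIV. \<Sum>k\<in>UNIV. L $ i $ k * L $ j $ l * A $ k $ l)"
        by (simp add: sum_distrib_right mult.assoc mult.commute[of "A $ _ $ _"])
      then show ?thesis
        by (subst sum.swap) (simp add: matrix_mult_nth transpose_def)
    qed
    finally show ?thesis .
  qed
  moreover have "integrable M (\<lambda>\<omega>. ((L *v X \<omega>) $ i)\<^sup>2)" for i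
    using X(2)[of _ 0 _ 0] by (simp add: comp power2_eq_square sum_product mult.assoc mult.left_commute[of "X _ $ _"])
  ultimately show ?thesis
    by (simp add: has_cov_matrix_def comp)
qed

lemma (in prob_space) has_cov_matrix_symmetric:
  assumes "has_cov_matrix M X A"
  shows "transpose A = A"
proof -
  have "A $ i $ j = A $ j $ i" for i j
  proof -
    have *: "A $ i $ j = covar M (\<lambda>\<omega>. X \<omega> $ i) (\<lambda>\<omega>. X \<omega> $ j)" for i j
      using assms by (simp add: has_cov_matrix_def)
    show ?thesis
      unfolding * by (rule covar_commute)
  qed
  then show ?thesis
    by (simp add: vec_eq_iff transpose_def)
qed

lemma (in prob_space) has_cov_matrix_nonneg:
  fixes A :: "real^'k^'k"
  assumes "has_cov_matrix M X A"
  shows "0 \<le> a \<bullet> (A *v a)"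
proof -
  \<comment> \<open>A matrix with a single row makes the variance of \<open>a \<bullet> X\<close> an
    instance of the linear image lemma.\<close>
  let ?L = "\<chi> i j. a $ j :: real^'k^1"
  have "0 \<le> covar M (\<lambda>\<omega>. (?L *v X \<omega>) $ 1) (\<lambda>\<omega>. (?L *v X \<omega>) $ 1)"
    unfolding covar_def by (intro Bochner_Integration.integral_nonneg) simp
  also have "\<dots> = (?L ** A ** transpose ?L) $ 1 $ 1"
    using has_cov_matrix_linear_image[OF assms, of ?L] unfolding has_cov_matrix_def by blast
  also have "\<dots> = a \<bullet> (A *v a)"
  proof -
    have "(?L ** A ** transpose ?L) $ 1 $ 1 = (\<Sum>l\<in>UNIV. \<Sum>k\<in>UNIV. a $ k * A $ k $ l * a $ l)"
      by (simp add: matrix_mult_nth transpose_def sum_distrib_right)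
    also have "\<dots> = (\<Sum>k\<in>UNIV. \<Sum>l\<in>UNIV. a $ k * A $ k $ l * a $ l)"
      by (rule sum.swap)
    also have "\<dots> = a \<bullet> (A *v a)"
      by (simp add: inner_vec_def matrix_vector_mult_nth sum_distrib_left mult.assoc)
    finally show ?thesis .
  qed
  finally show ?thesis .
qed

section \<open>Positive definite matrices\<close>

definition pos_def_matrix :: "real^'n^'n \<Rightarrow> bool"
  where "pos_def_matrix A \<longleftrightarrow> transpose A = A \<and> (\<forall>a. a \<noteq> 0 \<longrightarrow> 0 < a \<bullet> (A *v a))"

text \<open>For a nonnegative form, \<open>a \<bullet> (A *v a) = 0\<close> forces
  \<open>A *v a = 0\<close>: otherwise a small step from \<open>a\<close> against
  \<open>A *v a\<close> would make the form negative.\<close>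

lemma pos_def_matrixI:
  fixes A :: "real^'n^'n"
  assumes sym: "transpose A = A" and inv: "invertible A" and nonneg: "\<And>a. 0 \<le> a \<bullet> (A *v a)"
  shows "pos_def_matrix A"
proof -
  have "0 < a \<bullet> (A *v a)" if "a \<noteq> 0" for a
  proof (rule ccontr)
    assume "\<not> 0 < a \<bullet> (A *v a)"
    then have a0: "a \<bullet> (A *v a) = 0"
      using nonneg[of a] by simp
    define b where "b = A *v a"
    define c where "c = b \<bullet> (A *v b)"
    have c: "0 \<le> c"
      using nonneg by (simp add: c_def)
    \<comment> \<open>With this step length the form takes the value
      \<open>- (s\<^sup>2 * (c + 2))\<close>; \<open>c + 1\<close> keeps the denominator
      positive.\<close>
    define s where "s = (b \<bullet> b) / (c + 1)"
    have "a \<bullet> (A *v b) = b \<bullet> b"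
      by (simp add: inner_symmetric_matrix[OF sym] b_def)
    then have "(a - s *\<^sub>R b) \<bullet> (A *v (a - s *\<^sub>R b)) = s\<^sup>2 * c - 2 * s * (b \<bullet> b)"
      using a0 by (simp add: matrix_vector_mult_diff_distrib matrix_vector_mult_scaleR inner_diff_left inner_diff_right
          b_def[symmetric] c_def power2_eq_square algebra_simps)
    then have "0 \<le> s\<^sup>2 * c - 2 * s * (b \<bullet> b)"
      using nonneg by metis
    also have "b \<bullet> b = s * (c + 1)"
      using c by (simp add: s_def)
    finally have "0 \<le> - (s\<^sup>2 * (c + 2))"
      by (simp add: algebra_simps power2_eq_square)
    then have "s\<^sup>2 * (c + 2) \<le> 0"
      by simp
    then have "s = 0"
      using c by (simp add: mult_le_0_iff)
    then have "b = 0"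
      using c by (simp add: s_def)
    then have "matrix_inv A *v (A *v a) = 0"
      by (simp add: b_def)
    then show False
      using that by (simp add: matrix_vector_mul_assoc matrix_inv_mult inv)
  qed
  then show ?thesis
    using sym by (simp add: pos_def_matrix_def)
qed

lemma pos_def_matrix_invertible:
  fixes A :: "real^'n^'n"
  assumes "pos_def_matrix A"
  shows "invertible A"
proof -
  have "A *v x = 0 \<Longrightarrow> x = 0" for x
    using assms unfolding pos_def_matrix_def by (metis inner_zero_right less_irrefl)
  then show ?thesis
    using matrix_left_invertible_ker[of A] invertible_left_inverse by blast
qed

lemma pos_def_matrix_congruence:
  fixes A :: "real^'n^'n" and L :: "real^'n^'m"
  assumes A: "pos_def_matrix A" and inj: "\<And>a. transpose L *v a = 0 \<Longrightarrow> a = 0"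
  shows "pos_def_matrix (L ** A ** transpose L)"
  unfolding pos_def_matrix_def
proof (intro conjI allI impI)
  show "transpose (L ** A ** transpose L) = L ** A ** transpose L"
    using A by (simp add: pos_def_matrix_def matrix_transpose_mul matrix_mul_assoc)
  fix a :: "real^'m" assume "a \<noteq> 0"
  then have "0 < (transpose L *v a) \<bullet> (A *v (transpose L *v a))"
    using A inj unfolding pos_def_matrix_def by blast
  also have "\<dots> = a \<bullet> ((L ** A ** transpose L) *v a)"
    by (simp only: matrix_vector_mul_assoc[symmetric] transpose_matrix_vector dot_lmul_matrix)
  finally show "0 < a \<bullet> ((L ** A ** transpose L) *v a)" .
qed

section \<open>The residual score as a linear image of the score\<close>

lemma sum_UNIV_Plus:
  "(\<Sum>k\<in>(UNIV :: ('a::finite + 'b::finite) set). f k) = (\<Sum>i\<in>UNIV. f (Inl i)) + (\<Sum>j\<in>UNIV. f (Inr j))"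
  using sum.Plus[of UNIV UNIV f] by (simp add: comp_def)

text \<open>The block row consisting of the identity and minus the regression coefficients on the
  nuisance scores. It reduces covariance and orthogonality of the residual score to matrix
  identities.\<close>

definition resid_matrix :: "real^(3 + 'p::finite)^(3 + 'p) \<Rightarrow> real^(3 + 'p)^3"
  where "resid_matrix J = (\<chi> i k. case k of Inl j \<Rightarrow> (if i = j then 1 else 0)
    | Inr j \<Rightarrow> - (info_xi_theta J ** matrix_inv (info_theta_theta J)) $ i $ j)"

lemma resid_matrix_nth:
  "resid_matrix J $ i $ Inl j = (if i = j then 1 else 0)"
  "resid_matrix J $ i $ Inr k = - (info_xi_theta J ** matrix_inv (info_theta_theta J)) $ i $ k"
  by (simp_all add: resid_matrix_def)

lemma sum_if_eq_mult:
  fixes f :: "'a::finite \<Rightarrow> real"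
  shows "(\<Sum>j\<in>UNIV. (if i = j then 1 else 0) * f j) = f i"
    "(\<Sum>j\<in>UNIV. (if j = i then 1 else 0) * f j) = f i"
    "(\<Sum>j\<in>UNIV. f j * (if i = j then 1 else 0)) = f i"
proof -
  have *: "(\<Sum>j\<in>UNIV. if i = j then f j else 0) = f i"
    by simp
  show "(\<Sum>j\<in>UNIV. (if i = j then 1 else 0) * f j) = f i"
    "(\<Sum>j\<in>UNIV. (if j = i then 1 else 0) * f j) = f i"
    "(\<Sum>j\<in>UNIV. f j * (if i = j then 1 else 0)) = f i"
    by (subst *[symmetric], rule sum.cong, auto)+
qed

lemma resid_score_eq: "resid_score J s = resid_matrix J *v s"
  by (simp add: vec_eq_iff resid_score_def matrix_vector_mult_nth sum_UNIV_Plus resid_matrix_nth sum_negf sum_if_eq_mult)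

text \<open>The nuisance block is a congruence of \<open>J\<close> by the matrix that selects the
  nuisance coordinates, so it inherits positive definiteness.\<close>

lemma info_theta_theta_invertible:
  fixes J :: "real^(3 + 'p::finite)^(3 + 'p)"
  assumes J: "pos_def_matrix J"
  shows "invertible (info_theta_theta J)"
proof (rule pos_def_matrix_invertible)
  define L where "L = (\<chi> i k. case k of Inl _ \<Rightarrow> 0 | Inr j \<Rightarrow> if i = j then 1 else (0::real) :: real^(3 + 'p)^'p)"
  have L: "L $ i $ Inl l = 0" "L $ i $ Inr j = (if i = j then 1 else 0)" for i j l
    by (simp_all add: L_def)
  have "L ** J ** transpose L = info_theta_theta J"
    by (simp add: vec_eq_iff matrix_mult_nth transpose_def info_theta_theta_def sum_UNIV_Plus L sum_if_eq_mult)
  moreover have "pos_def_matrix (L ** J ** transpose L)"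
  proof (rule pos_def_matrix_congruence[OF J])
    fix a assume "transpose L *v a = 0"
    then have "(transpose L *v a) $ Inr j = 0" for j
      by simp
    then have "a $ j = 0" for j
      unfolding matrix_vector_mult_nth transpose_def
      by (simp add: L sum_if_eq_mult)
    then show "a = 0"
      by (simp add: vec_eq_iff)
  qed
  ultimately show "pos_def_matrix (info_theta_theta J)"
    by simp
qed

text \<open>The zero block is the orthogonality of residual and nuisance scores. It yields both the
  covariance \<open>\<Sigma>\<close> and the insensitivity to nuisance drift.\<close>

lemma resid_matrix_mult:
  fixes J :: "real^(3 + 'p::finite)^(3 + 'p)"
  assumes J: "pos_def_matrix J"
  shows "(resid_matrix J ** J) $ i $ Inl j = resid_cov J $ i $ j" "(resid_matrix J ** J) $ i $ Inr k = 0"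
proof -
  define G where "G = info_xi_theta J ** matrix_inv (info_theta_theta J)"
  have *: "(resid_matrix J ** J) $ i $ l = J $ Inl i $ l - (\<Sum>m\<in>UNIV. G $ i $ m * J $ Inr m $ l)" for l
    by (simp add: matrix_mult_nth[of "resid_matrix J"] resid_matrix_nth sum_UNIV_Plus sum_negf sum_if_eq_mult G_def)
  show "(resid_matrix J ** J) $ i $ Inl j = resid_cov J $ i $ j"
    unfolding * by (simp add: resid_cov_def matrix_mult_nth[of G] info_theta_xi_def info_xi_xi_def flip: G_def)
  have "G ** info_theta_theta J = info_xi_theta J"
    by (simp add: G_def matrix_inv_mult info_theta_theta_invertible[OF J] flip: matrix_mul_assoc)
  then have "(\<Sum>m\<in>UNIV. G $ i $ m * info_theta_theta J $ m $ k) = info_xi_theta J $ i $ k"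
    unfolding matrix_mult_nth[symmetric] by simp
  then show "(resid_matrix J ** J) $ i $ Inr k = 0"
    unfolding * by (simp add: info_theta_theta_def info_xi_theta_def)
qed

lemma resid_cov_eq:
  fixes J :: "real^(3 + 'p::finite)^(3 + 'p)"
  assumes J: "pos_def_matrix J"
  shows "resid_matrix J ** J ** transpose (resid_matrix J) = resid_cov J"
proof -
  have "(resid_matrix J ** J ** transpose (resid_matrix J)) $ i $ j = resid_cov J $ i $ j" for i j
    unfolding matrix_mult_nth[of "resid_matrix J ** J"]
    by (simp add: sum_UNIV_Plus resid_matrix_mult[OF J] transpose_def resid_matrix_nth sum_if_eq_mult)
  then show ?thesis
    by (simp add: vec_eq_iff)
qed

text \<open>\<open>J *v t\<close> is the limit mean of the score under a drift \<open>t\<close> of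
  the nuisance parameter; the residual score removes it.\<close>

lemma resid_matrix_mult_theta:
  fixes J :: "real^(3 + 'p::finite)^(3 + 'p)"
  assumes J: "pos_def_matrix J" and t: "\<And>i. t $ Inl i = 0"
  shows "resid_matrix J *v (J *v t) = 0"
  unfolding matrix_vector_mul_assoc
  by (simp add: vec_eq_iff matrix_vector_mult_nth[of "resid_matrix J ** J"] sum_UNIV_Plus resid_matrix_mult[OF J] t)

lemma resid_cov_pos_def:
  fixes J :: "real^(3 + 'p::finite)^(3 + 'p)"
  assumes J: "pos_def_matrix J"
  shows "pos_def_matrix (resid_cov J)"
  unfolding resid_cov_eq[OF J, symmetric]
proof (rule pos_def_matrix_congruence[OF J])
  fix a assume "transpose (resid_matrix J) *v a = 0"
  then have "(transpose (resid_matrix J) *v a) $ Inl i = 0" for i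
    by simp
  then have "a $ i = 0" for i
    unfolding matrix_vector_mult_nth transpose_def
    by (simp add: resid_matrix_nth sum_if_eq_mult)
  then show "a = 0"
    by (simp add: vec_eq_iff)
qed

definition u_matrix :: "real^3^3 \<Rightarrow> real^3^2"
  where "u_matrix S = vector [vector [1, 0, - (S$1$3 / S$3$3)], vector [0, 1, - (S$2$3 / S$3$3)]]"

lemma u_vec_eq: "u_vec S s = u_matrix S *v s"
  by (simp add: vec_eq_iff forall_2 u_vec_def u_matrix_def matrix_vector_mult_def sum_3)

lemma schur_11_2_eq:
  assumes "transpose S = S" "S$3$3 \<noteq> 0"
  shows "u_matrix S ** S ** transpose (u_matrix S) = schur_11_2 S"
proof -
  have "S$3$1 = S$1$3" "S$3$2 = S$2$3"
    using assms(1) by (simp_all add: vec_eq_iff transpose_def)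
  then show ?thesis
    using assms(2)
    by (simp add: vec_eq_iff forall_2 u_matrix_def schur_11_2_def matrix_mult_nth sum_3 transpose_def)
qed

lemma schur_11_2_pos_def:
  assumes S: "pos_def_matrix S" and "S$3$3 \<noteq> 0"
  shows "pos_def_matrix (schur_11_2 S)"
proof -
  have "pos_def_matrix (u_matrix S ** S ** transpose (u_matrix S))"
  proof (rule pos_def_matrix_congruence[OF S])
    fix a assume "transpose (u_matrix S) *v a = 0"
    then have "(transpose (u_matrix S) *v a) $ 1 = 0" "(transpose (u_matrix S) *v a) $ 2 = 0"
      by simp_all
    then show "a = 0"
      unfolding matrix_vector_mult_nth transpose_def by (simp add: vec_eq_iff forall_2 u_matrix_def sum_2)
  qed
  then show ?thesis
    using assms schur_11_2_eq by (simp add: pos_def_matrix_def)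
qed

section \<open>The test statistic\<close>

text \<open>\<open>a \<bullet> (J *v b)\<close> is the covariance of the functionals
  \<open>a \<bullet> s\<close> and \<open>b \<bullet> s\<close>. Three functionals orthonormal for
  it and uncorrelated with \<open>t \<bullet> s\<close> stay standard normal under the tilt; the
  adjoint needed is the linear combination of \<open>a1\<close>, \<open>a2\<close>,
  \<open>a3\<close>.\<close>

lemma mv_normal_std_normal_triple:
  fixes J :: "real^'n^'n"
  assumes J: "transpose J = J" "invertible J" and prob: "prob_space (mv_normal 0 J)"
    and a: "a1 \<bullet> (J *v a1) = 1" "a2 \<bullet> (J *v a2) = 1" "a3 \<bullet> (J *v a3) = 1"
      "a1 \<bullet> (J *v a2) = 0" "a1 \<bullet> (J *v a3) = 0" "a2 \<bullet> (J *v a3) = 0"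
    and t: "a1 \<bullet> (J *v t) = 0" "a2 \<bullet> (J *v t) = 0" "a3 \<bullet> (J *v t) = 0"
  shows "std_normal_triple (density (mv_normal 0 J) (\<lambda>s. ennreal (exp (t \<bullet> s - 1/2 * (t \<bullet> (J *v t))))))
    (\<lambda>s. (a1 \<bullet> s, a2 \<bullet> s, a3 \<bullet> s))"
proof -
  let ?w = "\<lambda>s. (a1 \<bullet> s, a2 \<bullet> s, a3 \<bullet> s)"
  let ?d = "\<lambda>s. ennreal (exp (t \<bullet> s - 1/2 * (t \<bullet> (J *v t))))"
  let ?M = "density (mv_normal 0 J) ?d"
  let ?adj = "\<lambda>(x, y, z). x *\<^sub>R a1 + y *\<^sub>R a2 + z *\<^sub>R a3"
  have w [measurable]: "?w \<in> borel_measurable borel"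
    by (intro borel_measurable_continuous_onI continuous_intros)
  have lin: "linear ?w"
    by (rule linearI) (simp_all add: inner_add_right)
  have adj: "?adj a \<bullet> s = a \<bullet> ?w s" for a s
    by (cases a) (simp add: inner_add_left)
  have sw: "a2 \<bullet> (J *v a1) = 0" "a3 \<bullet> (J *v a1) = 0" "a3 \<bullet> (J *v a2) = 0"
  proof -
    have "x \<bullet> (J *v y) = y \<bullet> (J *v x)" for x y
      using inner_symmetric_matrix[OF J(1), of x y] by (simp only: inner_commute[of y])
    then show "a2 \<bullet> (J *v a1) = 0" "a3 \<bullet> (J *v a1) = 0" "a3 \<bullet> (J *v a2) = 0"
      using a by metis+
  qed
  have white: "?w (J *v ?adj a) = a" for a
    by (cases a) (simp add: matrix_vector_right_distrib matrix_vector_mult_scaleR inner_add_right a sw)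
  have uncorr: "?w (J *v t) = 0"
    by (simp add: t zero_prod_def)
  obtain c where c: "\<And>g. g \<in> borel_measurable borel \<Longrightarrow> (\<integral>\<^sup>+s. g (?w s) * ?d s \<partial>mv_normal 0 J) =
      c * (\<integral>\<^sup>+x. g x * ennreal (exp (- (x \<bullet> x) / 2)) \<partial>lborel)"
    by (rule mv_normal_projection[OF J lin adj white uncorr]) blast
  show ?thesis
  proof (rule std_normal_tripleI)
    show "?w \<in> borel_measurable ?M"
      by simp
    have "emeasure ?M (space ?M) = (\<integral>\<^sup>+s. 1 * ?d s \<partial>mv_normal 0 J)"
      by (subst emeasure_density) auto
    also have "\<dots> = (\<integral>\<^sup>+s. 1 \<partial>mv_normal 0 J)"
      by (rule mv_normal_tilt[OF J]) simp
    also have "\<dots> = 1"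
      using prob_space.emeasure_space_1[OF prob] by simp
    finally show "emeasure ?M (space ?M) = 1" .
    fix g :: "real \<times> real \<times> real \<Rightarrow> ennreal" assume [measurable]: "g \<in> borel_measurable borel"
    show "(\<integral>\<^sup>+s. g (?w s) \<partial>?M) = c * (\<integral>\<^sup>+x. g x * ennreal (exp (- (x \<bullet> x) / 2)) \<partial>lborel)"
      by (subst c[symmetric]) (simp_all add: nn_integral_density mult.commute)
  qed
qed

section \<open>Projection onto a planar cone\<close>

lemma quadratic_max_le: "2 * b * w - b\<^sup>2 \<le> w\<^sup>2" for b w :: real
proof -
  have "0 \<le> (b - w)\<^sup>2" by simp
  then show ?thesis by (simp add: power2_diff)
qed

text \<open>
  \<open>V\<close> is the maximum of \<open>2 b \<bullet> w - b \<bullet> b\<close> over \<open>b = x (1, 0) + y (\<rho>, r)\<close>, \<open>x, y \<ge> 0\<close>.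
\<close>

definition cone_max :: "real \<Rightarrow> real \<Rightarrow> real \<Rightarrow> real \<Rightarrow> real \<Rightarrow> bool"
  where "cone_max \<rho> r w1 w2 V \<longleftrightarrow>
    (\<exists>x\<ge>0. \<exists>y\<ge>0. 2 * ((x + \<rho> * y) * w1 + r * y * w2) - ((x + \<rho> * y)\<^sup>2 + (r * y)\<^sup>2) = V) \<and>
    (\<forall>x\<ge>0. \<forall>y\<ge>0. 2 * ((x + \<rho> * y) * w1 + r * y * w2) - ((x + \<rho> * y)\<^sup>2 + (r * y)\<^sup>2) \<le> V)"

text \<open>In each chamber the maximum is the squared length of the projection of
  \<open>(w1, w2)\<close>. It is attained at the cone coefficients of the projection, and completing
  squares bounds all other values.\<close>

lemma cone_max_sectors:
  assumes r: "0 < r" "r\<^sup>2 = 1 - \<rho>\<^sup>2"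
  shows "w1 \<ge> \<rho> / r * w2 \<Longrightarrow> w2 \<ge> 0 \<Longrightarrow> cone_max \<rho> r w1 w2 (w1\<^sup>2 + w2\<^sup>2)"
    and "w2 \<le> 0 \<Longrightarrow> w1 \<ge> 0 \<Longrightarrow> cone_max \<rho> r w1 w2 (w1\<^sup>2)"
    and "0 \<le> \<rho> * w1 + r * w2 \<Longrightarrow> w1 \<le> \<rho> / r * w2 \<Longrightarrow> cone_max \<rho> r w1 w2 ((\<rho> * w1 + r * w2)\<^sup>2)"
    and "w1 \<le> 0 \<Longrightarrow> w2 \<le> - (\<rho> / r) * w1 \<Longrightarrow> cone_max \<rho> r w1 w2 0"
proof -
  show "cone_max \<rho> r w1 w2 (w1\<^sup>2 + w2\<^sup>2)" if "w1 \<ge> \<rho> / r * w2" "w2 \<ge> 0"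
    unfolding cone_max_def
  proof (intro conjI allI impI)
    show "\<exists>x\<ge>0. \<exists>y\<ge>0. 2 * ((x + \<rho> * y) * w1 + r * y * w2) - ((x + \<rho> * y)\<^sup>2 + (r * y)\<^sup>2) = w1\<^sup>2 + w2\<^sup>2"
    proof (intro exI conjI)
      \<comment> \<open>These are the coefficients of \<open>(w1, w2)\<close> in the edges
        \<open>(1, 0)\<close> and \<open>(\<rho>, r)\<close>; the chamber is where both are
        nonnegative.\<close>
      show "0 \<le> w1 - \<rho> / r * w2" "0 \<le> w2 / r"
        using that r by auto
      have "w1 - \<rho> / r * w2 + \<rho> * (w2 / r) = w1" "r * (w2 / r) = w2"
        using r by auto
      then show "2 * ((w1 - \<rho> / r * w2 + \<rho> * (w2 / r)) * w1 + r * (w2 / r) * w2) -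
          ((w1 - \<rho> / r * w2 + \<rho> * (w2 / r))\<^sup>2 + (r * (w2 / r))\<^sup>2) = w1\<^sup>2 + w2\<^sup>2"
        by (simp only:) (simp add: power2_eq_square)
    qed
    fix x y :: real
    show "2 * ((x + \<rho> * y) * w1 + r * y * w2) - ((x + \<rho> * y)\<^sup>2 + (r * y)\<^sup>2) \<le> w1\<^sup>2 + w2\<^sup>2"
      using quadratic_max_le[of "x + \<rho> * y" w1] quadratic_max_le[of "r * y" w2] by (simp add: algebra_simps)
  qed
  show "cone_max \<rho> r w1 w2 (w1\<^sup>2)" if "w2 \<le> 0" "w1 \<ge> 0"
    unfolding cone_max_def
  proof (intro conjI allI impI)
    show "\<exists>x\<ge>0. \<exists>y\<ge>0. 2 * ((x + \<rho> * y) * w1 + r * y * w2) - ((x + \<rho> * y)\<^sup>2 + (r * y)\<^sup>2) = w1\<^sup>2"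
      using that by (intro exI[of _ w1] exI[of _ 0] conjI) (auto simp: power2_eq_square)
    fix x y :: real assume "0 \<le> y"
    then have "r * y * w2 \<le> 0"
      using that r by (simp add: mult_nonneg_nonpos)
    moreover have "0 \<le> (r * y)\<^sup>2"
      by simp
    ultimately show "2 * ((x + \<rho> * y) * w1 + r * y * w2) - ((x + \<rho> * y)\<^sup>2 + (r * y)\<^sup>2) \<le> w1\<^sup>2"
      using quadratic_max_le[of "x + \<rho> * y" w1] by argo
  qed
  show "cone_max \<rho> r w1 w2 ((\<rho> * w1 + r * w2)\<^sup>2)" if "0 \<le> \<rho> * w1 + r * w2" "w1 \<le> \<rho> / r * w2"
    unfolding cone_max_def
  proof (intro conjI allI impI)
    \<comment> \<open>Signed length of the projection onto the edge \<open>(\<rho>, r)\<close>, used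
      as the coefficient of that edge.\<close>
    define a where "a = \<rho> * w1 + r * w2"
    have "(\<rho> * a)\<^sup>2 + (r * a)\<^sup>2 = a\<^sup>2"
      using r by (simp add: power_mult_distrib left_diff_distrib)
    moreover have "\<rho> * a * w1 + r * a * w2 = a\<^sup>2"
      by (simp add: a_def power2_eq_square algebra_simps)
    ultimately have "2 * ((0 + \<rho> * a) * w1 + r * a * w2) - ((0 + \<rho> * a)\<^sup>2 + (r * a)\<^sup>2) = a\<^sup>2"
      by simp
    then show "\<exists>x\<ge>0. \<exists>y\<ge>0. 2 * ((x + \<rho> * y) * w1 + r * y * w2) - ((x + \<rho> * y)\<^sup>2 + (r * y)\<^sup>2) = (\<rho> * w1 + r * w2)\<^sup>2"
      using that(1) unfolding a_def by (intro exI[of _ 0] exI[of _ "\<rho> * w1 + r * w2"] conjI) auto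
    fix x y :: real assume "0 \<le> x" "0 \<le> y"
    have "r * w1 - \<rho> * w2 \<le> 0"
      using that(2) r by (simp add: field_simps)
    then have "x * r * (r * w1 - \<rho> * w2) \<le> 0"
      using \<open>0 \<le> x\<close> r by (simp add: mult_nonneg_nonpos)
    \<comment> \<open>Change to the orthonormal frame \<open>(\<rho>, r)\<close>,
      \<open>(r, - \<rho>)\<close>, in which the cone point has the coordinates
      \<open>\<rho> * x + y\<close> and \<open>r * x\<close>.\<close>
    moreover have "(x + \<rho> * y) * w1 + r * y * w2 = (\<rho> * x + y) * (\<rho> * w1 + r * w2) + x * r * (r * w1 - \<rho> * w2)"
    proof -
      have "x * w1 = x * (\<rho>\<^sup>2 + r\<^sup>2) * w1"
        using r by simp
      then show ?thesis
        by (simp add: algebra_simps power2_eq_square)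
    qed
    moreover have "(x + \<rho> * y)\<^sup>2 + (r * y)\<^sup>2 = (\<rho> * x + y)\<^sup>2 + (r * x)\<^sup>2"
      unfolding power_mult_distrib r(2) by (simp add: power2_eq_square algebra_simps)
    moreover have "0 \<le> (r * x)\<^sup>2"
      by simp
    ultimately show "2 * ((x + \<rho> * y) * w1 + r * y * w2) - ((x + \<rho> * y)\<^sup>2 + (r * y)\<^sup>2) \<le> (\<rho> * w1 + r * w2)\<^sup>2"
      using quadratic_max_le[of "\<rho> * x + y" "\<rho> * w1 + r * w2"] by argo
  qed
  show "cone_max \<rho> r w1 w2 0" if "w1 \<le> 0" "w2 \<le> - (\<rho> / r) * w1"
    unfolding cone_max_def
  proof (intro conjI allI impI)
    show "\<exists>x\<ge>0. \<exists>y\<ge>0. 2 * ((x + \<rho> * y) * w1 + r * y * w2) - ((x + \<rho> * y)\<^sup>2 + (r * y)\<^sup>2) = 0"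
      by (intro exI[of _ 0] conjI) auto
    fix x y :: real assume "0 \<le> x" "0 \<le> y"
    have "\<rho> * w1 + r * w2 \<le> 0"
      using that(2) r by (simp add: field_simps)
    then have "y * (\<rho> * w1 + r * w2) \<le> 0" "x * w1 \<le> 0"
      using \<open>0 \<le> x\<close> \<open>0 \<le> y\<close> that by (simp_all add: mult_nonneg_nonpos)
    then have "(x + \<rho> * y) * w1 + r * y * w2 \<le> 0"
      by (simp add: algebra_simps)
    moreover have "0 \<le> (x + \<rho> * y)\<^sup>2" "0 \<le> (r * y)\<^sup>2"
      by simp_all
    ultimately show "2 * ((x + \<rho> * y) * w1 + r * y * w2) - ((x + \<rho> * y)\<^sup>2 + (r * y)\<^sup>2) \<le> 0"
      by argo
  qed
qed

text \<open>A point outside all four chambers falls under one of two sign patterns of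
  \<open>w1\<close> and \<open>w2\<close>, and either one forces \<open>\<rho>\<close> to be both
  positive and negative.\<close>

lemma cone_sectors_cover:
  fixes r \<rho> :: real
  assumes r: "0 < r"
  shows "(w1 \<ge> \<rho> / r * w2 \<and> w2 \<ge> 0) \<or> (w2 \<le> 0 \<and> w1 \<ge> 0) \<or> (0 \<le> \<rho> * w1 + r * w2 \<and> w1 \<le> \<rho> / r * w2) \<or>
    (w1 \<le> 0 \<and> w2 \<le> - (\<rho> / r) * w1)"
proof -
  have 1: "w1 \<ge> \<rho> / r * w2 \<longleftrightarrow> r * w1 \<ge> \<rho> * w2" and 3: "w1 \<le> \<rho> / r * w2 \<longleftrightarrow> r * w1 \<le> \<rho> * w2"
    and 4: "w2 \<le> - (\<rho> / r) * w1 \<longleftrightarrow> \<rho> * w1 + r * w2 \<le> 0"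
    using r by (auto simp: field_simps)
  show ?thesis
  proof (rule ccontr)
    assume no: "\<not> ?thesis"
    then consider "w2 \<ge> 0" "r * w1 < \<rho> * w2" "\<rho> * w1 + r * w2 < 0" "0 < w1" | "w2 < 0" "w1 < 0" "0 < \<rho> * w1 + r * w2" "r * w1 > \<rho> * w2"
      unfolding 1 3 4 by linarith
    then show False
    proof cases
      case 1
      then have "0 < r * w1" "0 \<le> r * w2"
        using r by auto
      then show False
        using 1 by (smt (verit) mult_nonneg_nonneg mult_nonpos_nonneg)
    next
      case 2
      then have "r * w1 < 0" "r * w2 < 0"
        using r by (auto simp: mult_pos_neg)
      then show False
        using 2 by (smt (verit) mult_nonneg_nonpos mult_nonpos_nonpos)
    qed
  qed
qed

section \<open>The statistic in whitened coordinates\<close>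

locale calpha =
  fixes S :: "real^3^3"
  assumes pos_def: "pos_def_matrix S"
begin

definition "v1 = schur_11_2 S $ 1 $ 1"
definition "v2 = schur_11_2 S $ 2 $ 2"
definition "\<rho> = schur_11_2 S $ 1 $ 2 / (sqrt v1 * sqrt v2)"
definition "r = sqrt (1 - \<rho>\<^sup>2)"
definition "\<Lambda> = (vector [vector [sqrt v1, 0], vector [\<rho> * sqrt v2, sqrt v2 * r]] :: real^2^2)"

lemma sym: "transpose S = S" and S_sym: "S$3$1 = S$1$3" "S$3$2 = S$2$3" "S$2$1 = S$1$2"
  using pos_def by (simp_all add: pos_def_matrix_def vec_eq_iff transpose_def)

lemma S33: "0 < S$3$3"
proof -
  have "0 < axis 3 1 \<bullet> (S *v axis 3 (1::real))"
    using pos_def unfolding pos_def_matrix_def by (simp add: axis_eq_0_iff)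
  then show ?thesis
    by (simp add: inner_axis' matrix_vector_mult_basis column_def)
qed

lemma schur_pos_def: "pos_def_matrix (schur_11_2 S)"
  using schur_11_2_pos_def[OF pos_def] S33 by simp

lemma v: "0 < v1" "0 < v2" "(schur_11_2 S $ 1 $ 2)\<^sup>2 < v1 * v2" "schur_11_2 S $ 2 $ 1 = schur_11_2 S $ 1 $ 2"
proof -
  let ?A = "schur_11_2 S"
  have pd: "0 < a \<bullet> (?A *v a)" if "a \<noteq> 0" for a
    using schur_pos_def that by (simp add: pos_def_matrix_def)
  show s: "?A $ 2 $ 1 = ?A $ 1 $ 2"
    using schur_pos_def by (simp add: pos_def_matrix_def vec_eq_iff transpose_def)
  show v1: "0 < v1" and "0 < v2"
    using pd[of "axis 1 1"] pd[of "axis 2 1"]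
    by (simp_all add: v1_def v2_def inner_axis' matrix_vector_mult_basis column_def)
  \<comment> \<open>The form at this vector is \<open>v1\<close> times the determinant, which gives
    strict Cauchy-Schwarz and hence \<open>\<bar>\<rho>\<bar> < 1\<close>.\<close>
  have "0 < (vector [?A $ 1 $ 2, - v1] :: real^2) \<bullet> (?A *v vector [?A $ 1 $ 2, - v1])"
    using v1 by (intro pd) (simp add: vec_eq_iff forall_2)
  also have "\<dots> = v1 * (v1 * v2 - (?A $ 1 $ 2)\<^sup>2)"
    by (simp add: inner_vec_def matrix_vector_mult_nth sum_2 s flip: v1_def v2_def) (simp add: algebra_simps power2_eq_square)
  finally show "(?A $ 1 $ 2)\<^sup>2 < v1 * v2"
    using v1 by (simp add: zero_less_mult_iff)
qed

lemma rho: "\<bar>\<rho>\<bar> < 1" and r: "0 < r" "r\<^sup>2 = 1 - \<rho>\<^sup>2" and s12: "schur_11_2 S $ 1 $ 2 = \<rho> * sqrt v1 * sqrt v2"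
proof -
  have "\<rho>\<^sup>2 < 1"
    using v by (simp add: \<rho>_def power_divide power_mult_distrib)
  then show "0 < r" "r\<^sup>2 = 1 - \<rho>\<^sup>2"
    by (simp_all add: r_def)
  show "\<bar>\<rho>\<bar> < 1"
    using \<open>\<rho>\<^sup>2 < 1\<close> by (simp only: abs_square_less_1)
  show "schur_11_2 S $ 1 $ 2 = \<rho> * sqrt v1 * sqrt v2"
    using v by (simp add: \<rho>_def)
qed

lemma cholesky: "is_cholesky_factor \<Lambda> (schur_11_2 S)"
proof -
  have "(\<rho>\<^sup>2 + r\<^sup>2) * v2 = v2"
    using r(2) by simp
  then have "\<rho> * (\<rho> * v2) + r * (r * v2) = v2"
    by (simp add: power2_eq_square algebra_simps)
  then show ?thesis
    using v r rho s12 unfolding is_cholesky_factor_def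
    by (simp add: \<Lambda>_def vec_eq_iff forall_2 matrix_mult_nth sum_2 transpose_def mult.assoc flip: v1_def v2_def)
      (simp add: algebra_simps)
qed

lemma matrix_inv_cholesky:
  "matrix_inv \<Lambda> = vector [vector [1 / sqrt v1, 0], vector [- \<rho> / (r * sqrt v1), 1 / (r * sqrt v2)]]"
  using v r by (intro matrix_inv_unique) (simp add: \<Lambda>_def vec_eq_iff forall_2 matrix_mult_nth sum_2 mat_def field_simps)

definition "w1 s = (matrix_inv \<Lambda> *v u_vec S s) $ 1"
definition "w2 s = (matrix_inv \<Lambda> *v u_vec S s) $ 2"
definition "w3 s = s $ 3 / sqrt (S $ 3 $ 3)"

lemma w: "w1 s = u_vec S s $ 1 / sqrt v1"
  "w2 s = 1 / r * (u_vec S s $ 2 / sqrt v2 - \<rho> * (u_vec S s $ 1 / sqrt v1))"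
  using v r by (simp_all add: w1_def w2_def matrix_inv_cholesky matrix_vector_mult_nth sum_2 field_simps)

text \<open>The distance is \<open>s \<bullet> x - (w3 s)\<^sup>2\<close> minus a planar objective
  in \<open>m$1\<close>, \<open>m$2\<close> plus a square that the free coordinate
  \<open>m$3\<close> can make zero. Rescaling by \<open>sqrt v1\<close> and \<open>sqrt v2\<close>
  maps the cone condition to the quadrant in \<open>cone_max\<close>.\<close>

lemma calpha_stat_eq:
  assumes "cone_max \<rho> r (w1 s) (w2 s) V"
  shows "calpha_stat S s = V + (w3 s)\<^sup>2"
proof -
  define x where "x = matrix_inv S *v s"
  have Sx: "S *v x = s"
    by (simp add: x_def matrix_vector_mul_assoc matrix_inv_mult pos_def_matrix_invertible[OF pos_def])
  let ?q = "\<lambda>m1 m2. 2 * ((sqrt v1 * m1 + \<rho> * (sqrt v2 * m2)) * w1 s + r * (sqrt v2 * m2) * w2 s) -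
      ((sqrt v1 * m1 + \<rho> * (sqrt v2 * m2))\<^sup>2 + (r * (sqrt v2 * m2))\<^sup>2)"
  have expand: "(x - m) \<bullet> (S *v (x - m)) = s \<bullet> x - (w3 s)\<^sup>2 - ?q (m$1) (m$2) +
      (sqrt (S$3$3) * (m$3 + S$1$3 / S$3$3 * m$1 + S$2$3 / S$3$3 * m$2) - w3 s)\<^sup>2" for m
  proof -
    define c \<alpha> \<beta> \<sigma> where "c = S$3$3" and "\<alpha> = S$1$3 / S$3$3" and "\<beta> = S$2$3 / S$3$3" and "\<sigma> = schur_11_2 S $ 1 $ 2"
    define u where "u = u_vec S s"
    have S_eq: "S$3$3 = c" "S$1$3 = c * \<alpha>" "S$2$3 = c * \<beta>" "S$1$1 = v1 + c * \<alpha>\<^sup>2" "S$1$2 = \<sigma> + c * \<alpha> * \<beta>" "S$2$2 = v2 + c * \<beta>\<^sup>2"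
      using S33 by (simp_all add: c_def \<alpha>_def \<beta>_def \<sigma>_def v1_def v2_def schur_11_2_def S_sym power2_eq_square)
    have s_eq: "s$1 = u$1 + \<alpha> * s$3" "s$2 = u$2 + \<beta> * s$3"
      by (simp_all add: u_def u_vec_def \<alpha>_def \<beta>_def)
    have u_eq: "sqrt v1 * w1 s = u$1" "sqrt v2 * (\<rho> * w1 s + r * w2 s) = u$2"
      using v r by (simp_all add: w u_def[symmetric])
    have w3_eq: "sqrt c * w3 s = s$3" "(sqrt c)\<^sup>2 = c"
      using S33 by (simp_all add: w3_def c_def)
    have "(x - m) \<bullet> (S *v (x - m)) = s \<bullet> x - 2 * (m \<bullet> s) + m \<bullet> (S *v m)"
      using inner_symmetric_matrix[OF sym, of x m]
      by (simp add: matrix_vector_mult_diff_distrib Sx inner_diff_left inner_diff_right inner_commute)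
    also have "m \<bullet> s = m$1 * u$1 + m$2 * u$2 + s$3 * (m$3 + \<alpha> * m$1 + \<beta> * m$2)"
      by (simp add: inner_vec_def sum_3 s_eq algebra_simps)
    also have "m \<bullet> (S *v m) = v1 * (m$1)\<^sup>2 + 2 * \<sigma> * m$1 * m$2 + v2 * (m$2)\<^sup>2 + c * (m$3 + \<alpha> * m$1 + \<beta> * m$2)\<^sup>2"
      by (simp add: inner_vec_def sum_3 matrix_vector_mult_nth S_sym S_eq) (simp add: algebra_simps power2_eq_square)
    finally have 1: "(x - m) \<bullet> (S *v (x - m)) = s \<bullet> x - 2 * (m$1 * u$1 + m$2 * u$2 + s$3 * (m$3 + \<alpha> * m$1 + \<beta> * m$2)) +
        (v1 * (m$1)\<^sup>2 + 2 * \<sigma> * m$1 * m$2 + v2 * (m$2)\<^sup>2 + c * (m$3 + \<alpha> * m$1 + \<beta> * m$2)\<^sup>2)" .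
    have "?q (m$1) (m$2) = 2 * (m$1 * (sqrt v1 * w1 s) + m$2 * (sqrt v2 * (\<rho> * w1 s + r * w2 s))) -
        ((sqrt v1)\<^sup>2 * (m$1)\<^sup>2 + 2 * (\<rho> * sqrt v1 * sqrt v2) * m$1 * m$2 + (\<rho>\<^sup>2 + r\<^sup>2) * ((sqrt v2)\<^sup>2 * (m$2)\<^sup>2))"
      by (simp only: power2_eq_square) (simp only: algebra_simps)
    also have "\<dots> = 2 * (m$1 * u$1 + m$2 * u$2) - (v1 * (m$1)\<^sup>2 + 2 * \<sigma> * m$1 * m$2 + v2 * (m$2)\<^sup>2)"
      using v r by (simp add: u_eq \<sigma>_def s12)
    finally have 2: "?q (m$1) (m$2) = 2 * (m$1 * u$1 + m$2 * u$2) - (v1 * (m$1)\<^sup>2 + 2 * \<sigma> * m$1 * m$2 + v2 * (m$2)\<^sup>2)" .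
    have 3: "(sqrt c * d - w3 s)\<^sup>2 = c * d\<^sup>2 - 2 * s$3 * d + (w3 s)\<^sup>2" for d
    proof -
      have "(sqrt c * d - w3 s)\<^sup>2 = (sqrt c)\<^sup>2 * d\<^sup>2 - 2 * (sqrt c * w3 s) * d + (w3 s)\<^sup>2"
        by (simp add: power2_diff power_mult_distrib)
      then show ?thesis
        by (simp only: w3_eq)
    qed
    show ?thesis
      unfolding 1 2 c_def[symmetric] \<alpha>_def[symmetric, unfolded c_def[symmetric]] \<beta>_def[symmetric, unfolded c_def[symmetric]] 3
      by (simp add: algebra_simps)
  qed
  obtain a b where ab: "0 \<le> a" "0 \<le> b" and attained: "2 * ((a + \<rho> * b) * w1 s + r * b * w2 s) - ((a + \<rho> * b)\<^sup>2 + (r * b)\<^sup>2) = V"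
    and bound: "\<And>a b. 0 \<le> a \<Longrightarrow> 0 \<le> b \<Longrightarrow> 2 * ((a + \<rho> * b) * w1 s + r * b * w2 s) - ((a + \<rho> * b)\<^sup>2 + (r * b)\<^sup>2) \<le> V"
    using assms unfolding cone_max_def by auto
  \<comment> \<open>The first two entries undo the rescaling of the planar maximizer; the third
    solves the equation that annihilates the remaining square.\<close>
  define m where "m = (vector [a / sqrt v1, b / sqrt v2,
      w3 s / sqrt (S$3$3) - S$1$3 / S$3$3 * (a / sqrt v1) - S$2$3 / S$3$3 * (b / sqrt v2)] :: real^3)"
  have "(INF m\<in>calpha_cone. (x - m) \<bullet> (S *v (x - m))) = s \<bullet> x - (w3 s)\<^sup>2 - V"
  proof (rule cInf_eq_minimum)
    have "m \<in> calpha_cone"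
      using ab v by (simp add: m_def calpha_cone_def)
    moreover have "(x - m) \<bullet> (S *v (x - m)) = s \<bullet> x - (w3 s)\<^sup>2 - V"
      unfolding expand using v S33 attained by (simp add: m_def)
    ultimately show "s \<bullet> x - (w3 s)\<^sup>2 - V \<in> (\<lambda>m. (x - m) \<bullet> (S *v (x - m))) ` calpha_cone"
      by force
  next
    fix y assume "y \<in> (\<lambda>m. (x - m) \<bullet> (S *v (x - m))) ` calpha_cone"
    then obtain m where m: "m \<in> calpha_cone" "y = (x - m) \<bullet> (S *v (x - m))"
      by auto
    have "?q (m$1) (m$2) \<le> V"
      using m v by (intro bound) (simp_all add: calpha_cone_def)
    then show "s \<bullet> x - (w3 s)\<^sup>2 - V \<le> y"
      unfolding m(2) expand
      using zero_le_power2[of "sqrt (S$3$3) * (m$3 + S$1$3 / S$3$3 * m$1 + S$2$3 / S$3$3 * m$2) - w3 s"] by linarith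
  qed
  then show ?thesis
    by (simp add: calpha_stat_def x_def[symmetric])
qed

lemma calpha_stat_cases:
  "w1 s \<ge> \<rho> / r * w2 s \<Longrightarrow> w2 s \<ge> 0 \<Longrightarrow> calpha_stat S s = (w1 s)\<^sup>2 + (w2 s)\<^sup>2 + (w3 s)\<^sup>2"
  "w2 s \<le> 0 \<Longrightarrow> w1 s \<ge> 0 \<Longrightarrow> calpha_stat S s = (w1 s)\<^sup>2 + (w3 s)\<^sup>2"
  "0 \<le> \<rho> * w1 s + r * w2 s \<Longrightarrow> w1 s \<le> \<rho> / r * w2 s \<Longrightarrow> calpha_stat S s = (\<rho> * w1 s + r * w2 s)\<^sup>2 + (w3 s)\<^sup>2"
  "w1 s \<le> 0 \<Longrightarrow> w2 s \<le> - (\<rho> / r) * w1 s \<Longrightarrow> calpha_stat S s = (w3 s)\<^sup>2"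
  using cone_max_sectors[OF r, THEN calpha_stat_eq] by simp_all

text \<open>For \<open>\<rho> > 0\<close> the first condition is the claim divided by
  \<open>\<rho>\<close>. For \<open>\<rho> \<le> 0\<close> (with \<open>r / 0 = 0\<close>) the
  bounds squeeze \<open>x\<close> to 0, where the claim is immediate.\<close>

lemma third_sector:
  assumes "- (r / \<rho>) * y \<le> x" "x \<le> \<rho> / r * y" "0 \<le> y"
  shows "0 \<le> \<rho> * x + r * y"
proof (cases "\<rho> > 0")
  case True
  then show ?thesis
    using assms(1) by (simp add: field_simps)
next
  case False
  then have "\<rho> / r * y \<le> 0" "- (r / \<rho>) * y \<ge> 0"
    using r assms(3) by (auto simp: divide_nonpos_pos divide_nonneg_nonpos mult_nonpos_nonneg)
  then have "x = 0" "\<rho> / r * y = 0"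
    using assms by linarith+
  then show ?thesis
    using r assms(3) by auto
qed

text \<open>For \<open>\<rho> > 0\<close> the condition with \<open>r / \<rho>\<close> and
  \<open>y \<ge> 0\<close> describes the whole third chamber. For \<open>\<rho> \<le> 0\<close> it
  shrinks to points with \<open>x = 0\<close> and leaves a gap, so this cover is restricted to
  positive \<open>\<rho>\<close>.\<close>

lemma sectors_cover_positive:
  assumes "0 < \<rho>"
  shows "(x \<ge> \<rho> / r * y \<and> y \<ge> 0) \<or> (y \<le> 0 \<and> x \<ge> 0) \<or> (- (r / \<rho>) * y \<le> x \<and> x \<le> \<rho> / r * y \<and> y \<ge> 0) \<or>
    (x \<le> 0 \<and> y \<le> - (\<rho> / r) * x)"
proof -
  have "- (r / \<rho>) * y \<le> x \<and> y \<ge> 0" if "0 \<le> \<rho> * x + r * y" "x \<le> \<rho> / r * y"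
  proof
    show "- (r / \<rho>) * y \<le> x"
      using that(1) assms by (simp add: field_simps)
    show "y \<ge> 0"
    proof (rule ccontr)
      assume "\<not> y \<ge> 0"
      then have "\<rho> / r * y < 0" "r * y < 0"
        using assms r by (intro mult_pos_neg divide_pos_pos; simp)+
      then have "\<rho> * x < 0"
        using that(2) assms by (simp add: mult_pos_neg)
      then show False
        using that(1) \<open>r * y < 0\<close> by linarith
    qed
  qed
  then show ?thesis
    using cone_sectors_cover[OF r(1), of \<rho> y x] by blast
qed

text \<open>Coefficient vector of the functional \<open>p * u\<^sub>1 + q * u\<^sub>2\<close> of the
  residual score; \<open>b1\<close>, \<open>b2\<close>, \<open>b3\<close> represent
  \<open>w1\<close>, \<open>w2\<close>, \<open>w3\<close>.\<close>

definition "b p q = (vector [p, q, - (S$1$3 / S$3$3 * p + S$2$3 / S$3$3 * q)] :: real^3)"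
definition "b1 = b (1 / sqrt v1) 0"
definition "b2 = b (- \<rho> / (r * sqrt v1)) (1 / (r * sqrt v2))"
definition "b3 = (vector [0, 0, 1 / sqrt (S$3$3)] :: real^3)"

lemma w_inner: "w1 s = b1 \<bullet> s" "w2 s = b2 \<bullet> s" "w3 s = b3 \<bullet> s"
proof -
  have "b p q \<bullet> s = p * u_vec S s $ 1 + q * u_vec S s $ 2" for p q
    by (simp add: b_def inner_vec_def sum_3 u_vec_def algebra_simps)
  then show "w1 s = b1 \<bullet> s" "w2 s = b2 \<bullet> s"
    using v r by (simp_all add: w b1_def b2_def field_simps)
  show "w3 s = b3 \<bullet> s"
    by (simp add: w3_def b3_def inner_vec_def sum_3)
qed

text \<open>The whitened coordinates have identity covariance. The last entry of
  \<open>S *v b p q\<close> vanishes because \<open>u\<close> is uncorrelated with the third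
  residual score, which separates \<open>b3\<close> from the others.\<close>

lemma orthonormal:
  "b1 \<bullet> (S *v b1) = 1" "b2 \<bullet> (S *v b2) = 1" "b3 \<bullet> (S *v b3) = 1"
  "b1 \<bullet> (S *v b2) = 0" "b3 \<bullet> (S *v b1) = 0" "b3 \<bullet> (S *v b2) = 0"
proof -
  let ?s = "schur_11_2 S $ 1 $ 2"
  have S_b: "S *v b p q = vector [v1 * p + ?s * q, ?s * p + v2 * q, 0]" for p q
    using S33 by (simp add: vec_eq_iff forall_3 b_def matrix_vector_mult_nth sum_3 v1_def v2_def schur_11_2_def S_sym algebra_simps)
  have q1: "v1 * (1 / sqrt v1) = sqrt v1" and q2: "v2 * (1 / (r * sqrt v2)) = sqrt v2 / r"
    using v r by (simp_all add: real_div_sqrt field_simps)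
  have Sb1: "S *v b1 = vector [sqrt v1, \<rho> * sqrt v2, 0]"
    using v q1 by (simp add: b1_def S_b s12)
  have Sb2: "S *v b2 = vector [0, r * sqrt v2, 0]"
  proof -
    have "v1 * (- \<rho> / (r * sqrt v1)) + ?s * (1 / (r * sqrt v2)) = 0"
      using v r q1 by (simp add: s12 field_simps)
    moreover have "?s * (- \<rho> / (r * sqrt v1)) + v2 * (1 / (r * sqrt v2)) = (1 - \<rho>\<^sup>2) / r * sqrt v2"
      using v r unfolding q2 by (simp add: s12 field_simps power2_eq_square)
    moreover have "(1 - \<rho>\<^sup>2) / r = r"
    proof -
      have "(1 - \<rho>\<^sup>2) / r = r\<^sup>2 / r"
        by (simp only: r(2))
      then show ?thesis
        using r(1) by (simp add: power2_eq_square)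
    qed
    ultimately show ?thesis
      by (simp only: b2_def S_b)
  qed
  show "b1 \<bullet> (S *v b1) = 1" "b2 \<bullet> (S *v b2) = 1" "b1 \<bullet> (S *v b2) = 0" "b3 \<bullet> (S *v b1) = 0" "b3 \<bullet> (S *v b2) = 0"
    using v r unfolding Sb1 Sb2 by (simp_all add: inner_vec_def sum_3 b1_def b2_def b3_def b_def)
  show "b3 \<bullet> (S *v b3) = 1"
    using S33 by (simp add: inner_vec_def sum_3 b3_def matrix_vector_mult_nth)
qed

text \<open>Pasting over the four closed chambers, on each of which the statistic is a quadratic
  polynomial. Both measurability and the passage to the limit rest on it.\<close>

lemma continuous_on_calpha_stat: "continuous_on UNIV (calpha_stat S)"
proof -
  define U where "U = (\<lambda>i::nat. if i = 0 then {s. w1 s \<ge> \<rho> / r * w2 s \<and> w2 s \<ge> 0}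
    else if i = 1 then {s. w2 s \<le> 0 \<and> w1 s \<ge> 0}
    else if i = 2 then {s. 0 \<le> \<rho> * w1 s + r * w2 s \<and> w1 s \<le> \<rho> / r * w2 s}
    else {s. w1 s \<le> 0 \<and> w2 s \<le> - (\<rho> / r) * w1 s})"
  have cont: "continuous_on A w1" "continuous_on A w2" "continuous_on A w3" for A
    unfolding w_inner[abs_def] by (intro continuous_intros)+
  have closed: "closed (U i)" for i
    unfolding U_def using r(1) by (auto intro!: closed_Collect_conj closed_Collect_le continuous_intros cont)
  have "continuous_on (U i) (calpha_stat S)" for i
  proof -
    consider "i = 0" | "i = 1" | "i = 2" | "i \<noteq> 0 \<and> i \<noteq> 1 \<and> i \<noteq> 2" by blast
    then show ?thesis
    proof cases
      case 1
      have "continuous_on (U i) (\<lambda>s. (w1 s)\<^sup>2 + (w2 s)\<^sup>2 + (w3 s)\<^sup>2)"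
        by (intro continuous_intros cont)
      then show ?thesis
        by (rule continuous_on_eq) (auto simp: U_def 1 calpha_stat_cases)
    next
      case 2
      have "continuous_on (U i) (\<lambda>s. (w1 s)\<^sup>2 + (w3 s)\<^sup>2)"
        by (intro continuous_intros cont)
      then show ?thesis
        by (rule continuous_on_eq) (auto simp: U_def 2 calpha_stat_cases)
    next
      case 3
      have "continuous_on (U i) (\<lambda>s. (\<rho> * w1 s + r * w2 s)\<^sup>2 + (w3 s)\<^sup>2)"
        by (intro continuous_intros cont)
      then show ?thesis
        by (rule continuous_on_eq) (auto simp: U_def 3 calpha_stat_cases)
    next
      case 4
      have "continuous_on (U i) (\<lambda>s. (w3 s)\<^sup>2)"
        by (intro continuous_intros cont)
      then show ?thesis
        by (rule continuous_on_eq) (use 4 in \<open>auto simp: U_def calpha_stat_cases\<close>)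
    qed
  qed
  then have "continuous_on (\<Union>i\<in>{0, 1, 2, 3}. U i) (calpha_stat S)"
    by (intro continuous_on_closed_Union closed) auto
  moreover have "(\<Union>i\<in>{0, 1, 2, 3}. U i) = UNIV"
    using cone_sectors_cover[OF r(1), of \<rho>] by (auto simp: U_def)
  ultimately show ?thesis
    by simp
qed

end

text \<open>The law of the statistic in the limit when only the nuisance parameter drifts: the tilt
  by \<open>t\<close> leaves the three whitened coordinates standard normal.\<close>

proposition calpha_stat_mixture:
  fixes J :: "real^(3 + 'p::finite)^(3 + 'p)"
  assumes J: "pos_def_matrix J" and prob: "prob_space (mv_normal 0 J)" and t: "\<And>i. t $ Inl i = 0"
  shows "distr (density (mv_normal 0 J) (\<lambda>s. ennreal (exp (t \<bullet> s - 1/2 * (t \<bullet> (J *v t)))))) borel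
      (\<lambda>s. calpha_stat (resid_cov J) (resid_score J s)) =
    mixture [(1/2 - arccos (calpha.\<rho> (resid_cov J)) / (2 * pi), chi_squared 1), (1/2, chi_squared 2),
      (arccos (calpha.\<rho> (resid_cov J)) / (2 * pi), chi_squared 3)]"
proof -
  interpret C: calpha "resid_cov J"
    by unfold_locales (rule resid_cov_pos_def[OF J])
  let ?R = "resid_matrix J"
  have J': "transpose J = J" "invertible J"
    using J pos_def_matrix_invertible by (auto simp: pos_def_matrix_def)
  \<comment> \<open>Pulls a functional of the residual score back to a functional of the score; Gram
    matrices with respect to \<open>\<Sigma>\<close> become Gram matrices with respect to
    \<open>J\<close>.\<close>
  let ?a = "\<lambda>b. transpose ?R *v b"
  have inner_a: "?a b \<bullet> s = b \<bullet> resid_score J s" for b s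
    by (simp only: resid_score_eq transpose_matrix_vector dot_lmul_matrix)
  have gram: "?a b \<bullet> (J *v ?a c) = b \<bullet> (resid_cov J *v c)" for b c
    by (simp only: inner_a resid_score_eq matrix_vector_mul_assoc resid_cov_eq[OF J] matrix_mul_assoc)
  have t0: "?a b \<bullet> (J *v t) = 0" for b
    by (simp add: inner_a resid_score_eq resid_matrix_mult_theta[OF J t] del: transpose_matrix_vector)
  note orth = C.orthonormal
  have sym: "b \<bullet> (resid_cov J *v c) = c \<bullet> (resid_cov J *v b)" for b c
    using inner_symmetric_matrix[OF C.sym, of b c] by (simp only: inner_commute[of c])
  have orth': "C.b2 \<bullet> (resid_cov J *v C.b1) = 0" "C.b1 \<bullet> (resid_cov J *v C.b3) = 0" "C.b2 \<bullet> (resid_cov J *v C.b3) = 0"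
    using orth(4-6) sym[of C.b1 C.b2] sym[of C.b3 C.b1] sym[of C.b3 C.b2] by simp_all
  let ?D = "density (mv_normal 0 J) (\<lambda>s. ennreal (exp (t \<bullet> s - 1/2 * (t \<bullet> (J *v t)))))"
  have X: "std_normal_triple ?D (\<lambda>s. (C.w2 (resid_score J s), C.w1 (resid_score J s), C.w3 (resid_score J s)))"
    unfolding C.w_inner inner_a[symmetric]
    by (rule mv_normal_std_normal_triple[OF J' prob]) (simp_all only: gram t0 orth orth')
  have rho: "C.\<rho>\<^sup>2 + C.r\<^sup>2 = 1"
    using C.r by simp
  \<comment> \<open>The orthonormal pair rotated so that \<open>?c2\<close> measures along the
    second edge of the cone and \<open>?c1\<close> across it.\<close>
  let ?c1 = "C.r *\<^sub>R C.b1 - C.\<rho> *\<^sub>R C.b2" and ?c2 = "C.\<rho> *\<^sub>R C.b1 + C.r *\<^sub>R C.b2"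
  have rot: "?c1 \<bullet> (resid_cov J *v ?c1) = 1" "?c2 \<bullet> (resid_cov J *v ?c2) = 1" "?c1 \<bullet> (resid_cov J *v ?c2) = 0"
    "?c1 \<bullet> (resid_cov J *v C.b3) = 0" "?c2 \<bullet> (resid_cov J *v C.b3) = 0"
    using rho by (simp_all add: matrix_vector_mult_diff_distrib matrix_vector_right_distrib matrix_vector_mult_scaleR
        inner_diff_left inner_diff_right inner_add_left inner_add_right orth orth' power2_eq_square)
  have Y: "std_normal_triple ?D (\<lambda>s. (C.r * C.w1 (resid_score J s) - C.\<rho> * C.w2 (resid_score J s),
      C.\<rho> * C.w1 (resid_score J s) + C.r * C.w2 (resid_score J s), C.w3 (resid_score J s)))"
  proof -
    have "std_normal_triple ?D (\<lambda>s. (?a ?c1 \<bullet> s, ?a ?c2 \<bullet> s, ?a C.b3 \<bullet> s))"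
      by (rule mv_normal_std_normal_triple[OF J' prob]) (simp_all only: gram t0 rot orth)
    then show ?thesis
      by (simp only: inner_a C.w_inner inner_diff_left inner_add_left inner_scaleR_left)
  qed
  have meas: "(\<lambda>s. calpha_stat (resid_cov J) (resid_score J s)) \<in> borel_measurable ?D"
  proof -
    have "continuous_on UNIV (\<lambda>s. calpha_stat (resid_cov J) (resid_score J s))"
      unfolding resid_score_eq
      by (rule continuous_on_compose2[OF C.continuous_on_calpha_stat]) (auto intro!: continuous_intros)
    from borel_measurable_continuous_onI[OF this] show ?thesis
      by (simp add: mv_normal_def)
  qed
  show ?thesis
    by (rule mixture_law[OF X Y C.rho C.r_def _ _ _ _ meas]) (auto intro!: C.calpha_stat_cases intro: less_imp_le)
qed

section \<open>The Gaussian shift experiment\<close>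

text \<open>Serves to drop the sample sizes at which a local parameter is still outside the
  parameter space.\<close>

lemma conv_in_dist_shift:
  assumes "conv_in_dist P X N Y"
  shows "conv_in_dist (\<lambda>n. P (n + n0)) (\<lambda>n. X (n + n0)) N Y"
  using assms unfolding conv_in_dist_def by (auto intro: LIMSEQ_ignore_initial_segment)

lemma log_lr_expansion_shift:
  assumes "log_lr_expansion Q P Z"
  shows "log_lr_expansion (\<lambda>n. Q (n + n0)) (\<lambda>n. P (n + n0)) (\<lambda>n. Z (n + n0))"
  unfolding log_lr_expansion_def
proof (intro allI impI)
  fix \<epsilon> :: real assume "0 < \<epsilon>"
  then show "(\<lambda>n. measure (P (n + n0)) {\<omega> \<in> space (P (n + n0)).
      \<not> (0 < lik_ratio (Q (n + n0)) (P (n + n0)) \<omega> \<and> \<bar>ln (lik_ratio (Q (n + n0)) (P (n + n0)) \<omega>) - Z (n + n0) \<omega>\<bar> \<le> \<epsilon>)}) \<longlonglongrightarrow> 0"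
    using assms[unfolded log_lr_expansion_def, rule_format] by (intro LIMSEQ_ignore_initial_segment)
qed

text \<open>In HOL a nonpositive determinant makes the root in the denominator nonpositive, and
  \<open>ennreal\<close> then cuts the density to 0, against mass 1.\<close>

lemma mv_normal_det_pos:
  fixes A :: "real^'n^'n"
  assumes "prob_space (mv_normal m A)"
  shows "0 < det A"
proof (rule ccontr)
  assume "\<not> 0 < det A"
  then have "sqrt ((2 * pi) ^ CARD('n) * det A) \<le> 0"
    by (simp add: mult_nonneg_nonpos)
  then have "ennreal (exp (- ((x - m) \<bullet> (matrix_inv A *v (x - m))) / 2) / sqrt ((2 * pi) ^ CARD('n) * det A)) = 0" for x
    by (intro ennreal_neg divide_nonneg_nonpos) auto
  then have "emeasure (mv_normal m A) (space (mv_normal m A)) = 0"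
    unfolding mv_normal_def by (simp add: emeasure_density)
  then show False
    using prob_space.emeasure_space_1[OF assms] by simp
qed

text \<open>The tilt formula for the covariance \<open>matrix_inv J\<close> in the direction
  \<open>J *v t\<close>, whose mean shift is \<open>matrix_inv J *v (J *v t) = t\<close>.\<close>

lemma gaussian_shift_density:
  fixes J :: "real^'n^'n"
  assumes sym: "transpose J = J" and inv: "invertible J"
  shows "distr (mv_normal 0 (matrix_inv J)) borel (\<lambda>\<nu>. t + \<nu>) =
    density (mv_normal 0 (matrix_inv J)) (\<lambda>y. ennreal (exp (t \<bullet> (J *v y) - 1/2 * (t \<bullet> (J *v t)))))"
proof (rule measure_eqI)
  let ?M = "mv_normal 0 (matrix_inv J)"
  have symi: "transpose (matrix_inv J) = matrix_inv J"
  proof -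
    have "J ** transpose (matrix_inv J) = transpose (matrix_inv J ** J)"
      by (simp add: matrix_transpose_mul sym)
    then show ?thesis
      using matrix_inv_unique[of J "transpose (matrix_inv J)"] by (simp add: matrix_inv_mult inv)
  qed
  have invi: "invertible (matrix_inv J)"
    using matrix_inv_mult[OF inv] invertible_def by blast
  have J1: "matrix_inv J *v (J *v t) = t"
    by (simp add: matrix_vector_mul_assoc matrix_inv_mult inv)
  have J2: "(J *v t) \<bullet> y = t \<bullet> (J *v y)" for y
    by (rule inner_symmetric_matrix[OF sym, symmetric])
  define d where "d y = ennreal (exp (t \<bullet> (J *v y) - 1/2 * (t \<bullet> (J *v t))))" for y
  have d [measurable]: "d \<in> borel_measurable borel"
  proof -
    have "continuous_on UNIV (\<lambda>y. exp (t \<bullet> (J *v y) - 1/2 * (t \<bullet> (J *v t))))"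
      by (intro continuous_intros)
    from borel_measurable_continuous_onI[OF this] show ?thesis
      unfolding d_def by measurable
  qed
  fix A assume "A \<in> sets (distr ?M borel (\<lambda>\<nu>. t + \<nu>))"
  then have [measurable]: "A \<in> sets borel" by simp
  have "emeasure (distr ?M borel (\<lambda>\<nu>. t + \<nu>)) A = (\<integral>\<^sup>+\<nu>. indicator A (\<nu> + t) \<partial>?M)"
    by (subst nn_integral_indicator[symmetric], simp, subst nn_integral_distr) (simp_all add: add.commute)
  also have "\<dots> = (\<integral>\<^sup>+y. indicator A y * d y \<partial>?M)"
    using mv_normal_tilt[OF symi invi, of "indicator A" "J *v t"] by (simp only: J1 J2 d_def) simp
  also have "\<dots> = (\<integral>\<^sup>+y. d y * indicator A y \<partial>?M)"
    by (simp only: mult.commute)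
  also have "\<dots> = emeasure (density ?M d) A"
    by (rule emeasure_density[symmetric]) simp_all
  also have "d = (\<lambda>y. ennreal (exp (t \<bullet> (J *v y) - 1/2 * (t \<bullet> (J *v t)))))"
    by (simp add: d_def fun_eq_iff)
  finally show "emeasure (distr ?M borel (\<lambda>\<nu>. t + \<nu>)) A =
    emeasure (density ?M (\<lambda>y. ennreal (exp (t \<bullet> (J *v y) - 1/2 * (t \<bullet> (J *v t)))))) A" .
qed simp

text \<open>All shifts have positive densities with respect to the unshifted law, so their ratios
  are \<open>exp (z h - z h0)\<close> evaluated at \<open>J *v y\<close>. Since
  \<open>J *v y\<close> has law \<open>mv_normal 0 J\<close> there, the expression of
  \<open>lr_process_limit\<close> results.\<close>

lemma gaussian_shift_lr_process:
  fixes J :: "real^'n^'n" and t :: "'h \<Rightarrow> real^'n" and f :: "('h \<Rightarrow> real) \<Rightarrow> real"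
  defines "F \<equiv> \<lambda>h. distr (mv_normal 0 (matrix_inv J)) borel (\<lambda>\<nu>. t h + \<nu>)"
    and "z \<equiv> \<lambda>h s. t h \<bullet> s - 1/2 * (t h \<bullet> (J *v t h))"
  assumes sym: "transpose J = J" and prob: "prob_space (mv_normal 0 J)"
    and I: "finite I" and f: "continuous_on UNIV f"
  shows "(\<integral>y. f (lr_process I F h0 y) \<partial>F h0) =
    (\<integral>s. f (\<lambda>h. if h \<in> I then exp (z h s - z h0 s) else 0) * exp (z h0 s) \<partial>mv_normal 0 J)"
proof -
  have det: "0 < det J"
    by (rule mv_normal_det_pos[OF prob])
  then have inv: "invertible J"
    by (simp add: invertible_det_nz)
  let ?M = "mv_normal 0 (matrix_inv J)"
  have im: "distr ?M borel ((*v) J) = mv_normal 0 J"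
    by (rule mv_normal_image[OF sym det])
  have Jm [measurable]: "(\<lambda>y. J *v y) \<in> borel_measurable borel"
    by (rule measurable_matrix_vector_mult)
  \<comment> \<open>Mass 1 passes from the covariance \<open>J\<close> to
    \<open>matrix_inv J\<close> along the image map.\<close>
  have "emeasure ?M (space ?M) = emeasure (mv_normal 0 J) (space (mv_normal 0 J))"
    by (subst im[symmetric]) (simp add: emeasure_distr)
  then have M: "prob_space ?M"
    using prob_space.emeasure_space_1[OF prob] by (intro prob_spaceI) simp
  have F: "F h = density ?M (\<lambda>y. ennreal (exp (z h (J *v y))))" for h
    unfolding F_def z_def by (rule gaussian_shift_density[OF sym inv])
  have [measurable]: "z h \<in> borel_measurable borel" for h
    unfolding z_def by measurable
  have finF: "finite_measure (F h)" for h
  proof -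
    have "prob_space (F h)"
      unfolding F_def by (rule prob_space.prob_space_distr[OF M]) simp
    then show ?thesis
      by (simp add: prob_space_def)
  qed
  have sF [simp, measurable_cong]: "sets (F h) = sets borel" for h
    by (simp add: F_def)
  have quot: "F h = density (F h0) (\<lambda>y. ennreal (exp (z h (J *v y) - z h0 (J *v y))))" for h
    unfolding F by (subst density_density_eq) (auto intro!: density_cong simp flip: ennreal_mult'' exp_add)
  have lr: "AE y in F h0. lik_ratio (F h) (F h0) y = exp (z h (J *v y) - z h0 (J *v y))" for h
    by (subst quot, rule lik_ratio_density) (auto simp: finF simp flip: quot)
  define \<psi> where "\<psi> s = f (\<lambda>h. if h \<in> I then exp (z h s - z h0 s) else 0)" for s
  have \<psi> [measurable]: "\<psi> \<in> borel_measurable borel"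
    unfolding \<psi>_def by (rule measurable_finite_dim_process[OF I f]) measurable
  have "(\<integral>y. f (lr_process I F h0 y) \<partial>F h0) = (\<integral>y. \<psi> (J *v y) \<partial>F h0)"
  proof (rule integral_cong_AE)
    have "lik_ratio (F h) (F h0) \<in> borel_measurable (F h0)" for h
      by (rule lik_ratio_spec) (simp_all add: finF)
    then show "(\<lambda>y. f (lr_process I F h0 y)) \<in> borel_measurable (F h0)"
      unfolding lr_process_def by (intro measurable_finite_dim_process[OF I f])
    show "(\<lambda>y. \<psi> (J *v y)) \<in> borel_measurable (F h0)"
      by measurable
    have "AE y in F h0. \<forall>h\<in>I. lik_ratio (F h) (F h0) y = exp (z h (J *v y) - z h0 (J *v y))"
      by (intro AE_finite_allI I lr)
    then show "AE y in F h0. f (lr_process I F h0 y) = \<psi> (J *v y)"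
      by eventually_elim (auto simp: \<psi>_def lr_process_def intro!: arg_cong[where f=f])
  qed
  also have "\<dots> = (\<integral>y. exp (z h0 (J *v y)) * \<psi> (J *v y) \<partial>?M)"
    unfolding F by (subst integral_density) simp_all
  also have "\<dots> = (\<integral>s. exp (z h0 s) * \<psi> s \<partial>distr ?M borel ((*v) J))"
    by (subst integral_distr) simp_all
  finally show ?thesis
    by (simp add: im \<psi>_def mult.commute)
qed

section \<open>The statistical model and the final result\<close>

lemma density_family_prob_space:
  assumes "density_family \<mu> \<Xi> \<Theta> p" "\<xi> \<in> \<Xi>" "\<theta> \<in> \<Theta>"
  shows "prob_space (joint_dist \<mu> p n \<xi> \<theta>)"
  unfolding joint_dist_def
proof (rule prob_space_PiM)
  have "(\<lambda>x. p x \<xi> \<theta>) \<in> borel_measurable \<mu>" "(\<integral>\<^sup>+x. ennreal (p x \<xi> \<theta>) \<partial>\<mu>) = 1"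
    using assms by (auto simp: density_family_def)
  then show "prob_space (density \<mu> (\<lambda>x. ennreal (p x \<xi> \<theta>)))"
  proof (intro prob_spaceI)
    assume m: "(\<lambda>x. p x \<xi> \<theta>) \<in> borel_measurable \<mu>" and one: "(\<integral>\<^sup>+x. ennreal (p x \<xi> \<theta>) \<partial>\<mu>) = 1"
    have "emeasure (density \<mu> (\<lambda>x. ennreal (p x \<xi> \<theta>))) (space \<mu>) = (\<integral>\<^sup>+x. ennreal (p x \<xi> \<theta>) * indicator (space \<mu>) x \<partial>\<mu>)"
      using m by (intro emeasure_density) auto
    also have "\<dots> = (\<integral>\<^sup>+x. ennreal (p x \<xi> \<theta>) \<partial>\<mu>)"
      by (intro nn_integral_cong) simp
    finally show "emeasure (density \<mu> (\<lambda>x. ennreal (p x \<xi> \<theta>))) (space (density \<mu> (\<lambda>x. ennreal (p x \<xi> \<theta>)))) = 1"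
      by (simp add: one)
  qed
qed

lemma sets_joint_dist: "sets (joint_dist \<mu> p n \<xi> \<theta>) = sets (joint_dist \<mu> p n \<xi>' \<theta>')"
  unfolding joint_dist_def by (intro sets_PiM_cong) auto

lemma measurable_of_has_cov_matrix:
  fixes X :: "'a \<Rightarrow> real^'k"
  assumes "has_cov_matrix M X A"
  shows "X \<in> borel_measurable M"
  using assms unfolding has_cov_matrix_def
  by (subst borel_measurable_euclidean_space) (auto simp: Basis_vec_def inner_axis)

theorem theorem4:
  fixes \<mu> :: "'x measure"
    and p :: "'x \<Rightarrow> real^2 \<Rightarrow> real^'p::finite \<Rightarrow> real"
    and \<Xi> :: "(real^2) set" and \<Theta> :: "(real^'p) set"
    and \<xi>0 :: "real^2" and \<theta> :: "real^'p"
    and J :: "real^(3 + 'p)^(3 + 'p)"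
  assumes model: "density_family \<mu> \<Xi> \<Theta> p"
    and null: "\<xi>0 \<in> \<Xi>" "\<theta> \<in> \<Theta>"
    and regular: "second_order_regular \<mu> p \<xi>0 \<theta>"
    and J_cov: "\<And>n. n \<ge> 1 \<Longrightarrow> has_cov_matrix (joint_dist \<mu> p n \<xi>0 \<theta>) (score p \<xi>0 \<theta> n) J"
    and J_nonsingular: "invertible J"
    and score_conv: "conv_in_dist (\<lambda>n. joint_dist \<mu> p n \<xi>0 \<theta>) (score p \<xi>0 \<theta>)
                       (mv_normal 0 J) (\<lambda>x. x)"
    and expansion: "\<And>\<delta>. \<delta> \<in> loc_params \<Xi> \<Theta> \<xi>0 \<theta> \<Longrightarrow>
        log_lr_expansion (\<lambda>n. loc_experiment \<mu> p \<xi>0 \<theta> n \<delta>) (\<lambda>n. joint_dist \<mu> p n \<xi>0 \<theta>)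
          (\<lambda>n \<omega>. t_of \<delta> \<bullet> score p \<xi>0 \<theta> n \<omega> - 1/2 * (t_of \<delta> \<bullet> (J *v t_of \<delta>)))"
  shows "limit_experiment (loc_params \<Xi> \<Theta> \<xi>0 \<theta>) (loc_experiment \<mu> p \<xi>0 \<theta>)
           (\<lambda>\<delta>. distr (mv_normal 0 (matrix_inv J)) borel (\<lambda>\<nu>. t_of \<delta> + \<nu>)) \<and>
    (\<forall>\<delta>\<in>loc_params \<Xi> \<Theta> \<xi>0 \<theta>. 0 \<le> t_of \<delta> $ Inl 1 \<and> 0 \<le> t_of \<delta> $ Inl 2) \<and>
    (let \<Sigma> = resid_cov J;
         S\<^sub>r = (\<lambda>n \<omega>. resid_score J (score p \<xi>0 \<theta> n \<omega>));
         u = (\<lambda>n \<omega>. u_vec \<Sigma> (S\<^sub>r n \<omega>));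
         \<Sigma>112 = schur_11_2 \<Sigma>;
         v1 = \<Sigma>112 $ 1 $ 1;
         v2 = \<Sigma>112 $ 2 $ 2;
         \<rho> = \<Sigma>112 $ 1 $ 2 / (sqrt v1 * sqrt v2);
         r = sqrt (1 - \<rho>\<^sup>2);
         \<Lambda> = vector [vector [sqrt v1, 0], vector [\<rho> * sqrt v2, sqrt v2 * r]] :: real^2^2;
         T = (\<lambda>n \<omega>. calpha_stat \<Sigma> (S\<^sub>r n \<omega>));
         \<beta> = arccos \<rho>
     in
       (\<forall>n\<ge>1. has_cov_matrix (joint_dist \<mu> p n \<xi>0 \<theta>) (S\<^sub>r n) \<Sigma>) \<and>
       (\<forall>n\<ge>1. has_cov_matrix (joint_dist \<mu> p n \<xi>0 \<theta>) (u n) \<Sigma>112) \<and>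
       (\<forall>n\<ge>1. let cov = (\<lambda>i j. covar (joint_dist \<mu> p n \<xi>0 \<theta>) (\<lambda>\<omega>. u n \<omega> $ i) (\<lambda>\<omega>. u n \<omega> $ j))
          in cov 1 1 = v1 \<and> cov 2 2 = v2 \<and> cov 1 2 / (sqrt (cov 1 1) * sqrt (cov 2 2)) = \<rho>) \<and>
       is_cholesky_factor \<Lambda> \<Sigma>112 \<and> \<bar>\<rho>\<bar> < 1 \<and>
       (\<forall>n \<omega>.
          let w1 = (matrix_inv \<Lambda> *v u n \<omega>) $ 1;
              w2 = (matrix_inv \<Lambda> *v u n \<omega>) $ 2;
              w3 = S\<^sub>r n \<omega> $ 3 / sqrt (\<Sigma> $ 3 $ 3);
              case1 = (w1 \<ge> \<rho> / r * w2 \<and> w2 \<ge> 0);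
              case2 = (w2 \<le> 0 \<and> w1 \<ge> 0);
              case3 = (- (r / \<rho>) * w2 \<le> w1 \<and> w1 \<le> \<rho> / r * w2 \<and> w2 \<ge> 0);
              case3' = (0 \<le> \<rho> * w1 + r * w2 \<and> w1 \<le> \<rho> / r * w2);
              case4 = (w1 \<le> 0 \<and> w2 \<le> - (\<rho> / r) * w1)
          in
            w1 = u n \<omega> $ 1 / sqrt v1 \<and>
            w2 = 1 / r * (u n \<omega> $ 2 / sqrt v2 - \<rho> * (u n \<omega> $ 1 / sqrt v1)) \<and>
            (case1 \<longrightarrow> T n \<omega> = w1\<^sup>2 + w2\<^sup>2 + w3\<^sup>2) \<and>
            (case2 \<longrightarrow> T n \<omega> = w1\<^sup>2 + w3\<^sup>2) \<and>
            (case3 \<longrightarrow> T n \<omega> = (\<rho> * w1 + r * w2)\<^sup>2 + w3\<^sup>2) \<and>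
            (case4 \<longrightarrow> T n \<omega> = w3\<^sup>2) \<and>
            (\<rho> > 0 \<longrightarrow> case1 \<or> case2 \<or> case3 \<or> case4) \<and>
            (case3' \<longrightarrow> T n \<omega> = (\<rho> * w1 + r * w2)\<^sup>2 + w3\<^sup>2) \<and>
            (case1 \<or> case2 \<or> case3' \<or> case4)) \<and>
       (\<forall>\<delta>\<in>loc_params \<Xi> \<Theta> \<xi>0 \<theta>. fst \<delta> $ 1 = 0 \<and> fst \<delta> $ 2 = 0 \<longrightarrow>
          weak_conv_m (\<lambda>n. distr (loc_experiment \<mu> p \<xi>0 \<theta> n \<delta>) borel (T n))
            (mixture [(1/2 - \<beta> / (2 * pi), chi_squared 1),
                      (1/2, chi_squared 2),
                      (\<beta> / (2 * pi), chi_squared 3)])))"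
proof -
  define P where "P n = joint_dist \<mu> p n \<xi>0 \<theta>" for n
  define E where "E = loc_experiment \<mu> p \<xi>0 \<theta>"
  define X where "X = score p \<xi>0 \<theta>"
  define H where "H = loc_params \<Xi> \<Theta> \<xi>0 \<theta>"
  let ?N = "mv_normal 0 J"
  define z where "z \<delta> s = t_of \<delta> \<bullet> s - 1/2 * (t_of \<delta> \<bullet> (J *v t_of \<delta>))" for \<delta> s
  have P: "prob_space (P n)" for n
    unfolding P_def by (rule density_family_prob_space[OF model null])
  have cov: "has_cov_matrix (P n) (X n) J" if "n \<ge> 1" for n
    using J_cov[OF that] by (simp add: P_def X_def)
  have X [measurable]: "X n \<in> borel_measurable (P n)" if "n \<ge> 1" for n
    by (rule measurable_of_has_cov_matrix[OF cov[OF that]])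
  have conv: "conv_in_dist P X ?N (\<lambda>x. x)"
    using score_conv by (simp add: P_def[abs_def] X_def)
  \<comment> \<open>Convergence of the scores is tested with the constant 1. An infinite total mass
    is excluded because \<open>measure\<close> would be 0.\<close>
  have N: "prob_space ?N"
  proof -
    have "(\<lambda>n. \<integral>\<omega>. 1 \<partial>P n) \<longlonglongrightarrow> (\<integral>x. (1 :: real) \<partial>?N)"
      by (rule tendsto_bounded_weak[OF conv, where f="\<lambda>_. 1" and B=1]) auto
    moreover have "(\<integral>\<omega>. 1 \<partial>P n) = (1 :: real)" for n
      using prob_space.prob_space[OF P[of n]] by simp
    ultimately have "(\<lambda>n. 1) \<longlonglongrightarrow> (\<integral>x. (1 :: real) \<partial>?N)"
      by (simp only:)
    from LIMSEQ_unique[OF this tendsto_const] have "measure ?N (space ?N) = 1"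
      by simp
    then have "emeasure ?N (space ?N) = 1"
      by (cases "emeasure ?N (space ?N) = top") (simp_all add: measure_def emeasure_eq_ennreal_measure)
    then show ?thesis
      by (rule prob_spaceI)
  qed
  have sym: "transpose J = J"
    by (rule prob_space.has_cov_matrix_symmetric[OF P[of 1] cov]) simp
  have pd: "pos_def_matrix J"
    by (rule pos_def_matrixI[OF sym J_nonsingular])
      (rule prob_space.has_cov_matrix_nonneg[OF P[of 1] cov], simp)
  have z_cont: "continuous_on UNIV (z \<delta>)" for \<delta>
    unfolding z_def by (intro continuous_intros)
  have exp_z: "(\<integral>\<^sup>+s. ennreal (exp (z \<delta> s)) \<partial>?N) = 1" for \<delta>
    using mv_normal_tilt[OF sym J_nonsingular, of "\<lambda>_. 1" "t_of \<delta>"] prob_space.emeasure_space_1[OF N]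
    by (simp add: z_def)
  \<comment> \<open>From \<open>n0\<close> on the alternatives are probability measures.
    \<open>n0\<close> is at least 1 since measurability of the score is drawn from its covariance
    assumption, which starts at sample size 1.\<close>
  have lr: "lr_expansion (\<lambda>n. P (n + n0)) (\<lambda>n. E (n + n0) \<delta>) (\<lambda>n. X (n + n0)) ?N (z \<delta>)"
    if n0: "1 \<le> n0" and \<delta>: "\<delta> \<in> H" and params: "\<And>n. n0 \<le> n \<Longrightarrow> xi_loc \<xi>0 \<delta> n \<in> \<Xi> \<and> theta_loc \<theta> \<delta> n \<in> \<Theta>" for n0 \<delta>
  proof (rule lr_expansion.intro)
    fix n
    show "prob_space (P (n + n0))"
      by (rule P)
    show "prob_space (E (n + n0) \<delta>)"
      unfolding E_def loc_experiment_def using params[of "n + n0"] by (intro density_family_prob_space[OF model]) auto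
    show "sets (E (n + n0) \<delta>) = sets (P (n + n0))"
      unfolding E_def loc_experiment_def P_def by (rule sets_joint_dist)
    show "X (n + n0) \<in> borel_measurable (P (n + n0))"
      using n0 by (intro X) simp
  next
    show "conv_in_dist (\<lambda>n. P (n + n0)) (\<lambda>n. X (n + n0)) ?N (\<lambda>x. x)"
      by (rule conv_in_dist_shift[OF conv])
    show "prob_space ?N" "sets ?N = sets borel" "continuous_on UNIV (z \<delta>)" "(\<integral>\<^sup>+s. ennreal (exp (z \<delta> s)) \<partial>?N) = 1"
      by (simp_all add: N z_cont exp_z)
    have "log_lr_expansion (\<lambda>n. E n \<delta>) P (\<lambda>n \<omega>. z \<delta> (X n \<omega>))"
      using expansion[of \<delta>] \<delta> by (simp add: E_def P_def[abs_def] z_def X_def H_def)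
    then show "log_lr_expansion (\<lambda>n. E (n + n0) \<delta>) (\<lambda>n. P (n + n0)) (\<lambda>n \<omega>. z \<delta> (X (n + n0) \<omega>))"
      by (rule log_lr_expansion_shift)
  qed
  have start: "\<exists>n0\<ge>1. \<forall>\<delta>\<in>I. \<forall>n\<ge>n0. xi_loc \<xi>0 \<delta> n \<in> \<Xi> \<and> theta_loc \<theta> \<delta> n \<in> \<Theta>" if "finite I" "I \<subseteq> H" for I
  proof -
    have "\<forall>\<^sub>F n in sequentially. \<forall>\<delta>\<in>I. xi_loc \<xi>0 \<delta> n \<in> \<Xi> \<and> theta_loc \<theta> \<delta> n \<in> \<Theta>"
      using that by (intro eventually_ball_finite) (auto simp: H_def loc_params_def)
    then obtain n0 where "\<And>n. n0 \<le> n \<Longrightarrow> \<forall>\<delta>\<in>I. xi_loc \<xi>0 \<delta> n \<in> \<Xi> \<and> theta_loc \<theta> \<delta> n \<in> \<Theta>"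
      by (auto simp: eventually_sequentially)
    then show ?thesis
      by (intro exI[of _ "max 1 n0"]) auto
  qed

  have limit: "limit_experiment H E (\<lambda>\<delta>. distr (mv_normal 0 (matrix_inv J)) borel (\<lambda>\<nu>. t_of \<delta> + \<nu>))"
    unfolding limit_experiment_def conv_in_dist_def
  proof (intro ballI allI impI)
    fix h0 I and f :: "((real^2) \<times> (real^'p) \<Rightarrow> real) \<Rightarrow> real"
    assume h0: "h0 \<in> H" and I: "finite I \<and> I \<subseteq> H" and f: "continuous_on UNIV f \<and> bounded (range f)"
    obtain n0 where n0: "1 \<le> n0" "\<And>\<delta> n. \<delta> \<in> insert h0 I \<Longrightarrow> n0 \<le> n \<Longrightarrow> xi_loc \<xi>0 \<delta> n \<in> \<Xi> \<and> theta_loc \<theta> \<delta> n \<in> \<Theta>"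
    proof -
      have "finite (insert h0 I)" "insert h0 I \<subseteq> H"
        using h0 I by auto
      from start[OF this] show ?thesis
        using that by blast
    qed
    obtain B where B: "\<And>y. \<bar>f y\<bar> \<le> B"
    proof -
      from f obtain B where "\<And>y. norm (f y) \<le> B"
        unfolding bounded_iff by blast
      then show ?thesis
        by (intro that[of B]) simp
    qed
    have "(\<lambda>n. \<integral>\<omega>. f (lr_process I (E (n + n0)) h0 \<omega>) \<partial>E (n + n0) h0) \<longlonglongrightarrow>
        (\<integral>s. f (\<lambda>h. if h \<in> I then exp (z h s - z h0 s) else 0) * exp (z h0 s) \<partial>?N)"
    proof (rule lr_process_limit[where P="\<lambda>n. P (n + n0)" and X="\<lambda>n. X (n + n0)"])
      fix h assume h: "h \<in> insert h0 I"
      then have "h \<in> H"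
        using h0 I by blast
      then show "lr_expansion (\<lambda>n. P (n + n0)) (\<lambda>n. E (n + n0) h) (\<lambda>n. X (n + n0)) ?N (z h)"
        by (rule lr[OF n0(1) _ n0(2)[OF h]])
    next
      show "finite I" "continuous_on UNIV f"
        using I f by blast+
      show "\<bar>f y\<bar> \<le> B" for y
        by (rule B)
    qed
    then have "(\<lambda>n. \<integral>\<omega>. f (lr_process I (E n) h0 \<omega>) \<partial>E n h0) \<longlonglongrightarrow>
        (\<integral>s. f (\<lambda>h. if h \<in> I then exp (z h s - z h0 s) else 0) * exp (z h0 s) \<partial>?N)"
      by (rule LIMSEQ_offset)
    then show "(\<lambda>n. \<integral>\<omega>. f (lr_process I (E n) h0 \<omega>) \<partial>E n h0) \<longlonglongrightarrow>
        (\<integral>y. f (lr_process I (\<lambda>\<delta>. distr (mv_normal 0 (matrix_inv J)) borel (\<lambda>\<nu>. t_of \<delta> + \<nu>)) h0 y)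
          \<partial>distr (mv_normal 0 (matrix_inv J)) borel (\<lambda>\<nu>. t_of h0 + \<nu>))"
      unfolding z_def using I f gaussian_shift_lr_process[OF sym N, of I f t_of h0] by simp
  qed

  have t_Inl: "t_of \<delta> $ Inl 1 = (fst \<delta> $ 1)\<^sup>2" "t_of \<delta> $ Inl 2 = (fst \<delta> $ 2)\<^sup>2"
    "t_of \<delta> $ Inl 3 = 2 * (fst \<delta> $ 1) * (fst \<delta> $ 2)" for \<delta> :: "(real^2) \<times> (real^'p)"
    by (simp_all add: t_of_def vec_append_def)

  interpret C: calpha "resid_cov J"
    by unfold_locales (rule resid_cov_pos_def[OF pd])
  let ?S = "\<lambda>n \<omega>. resid_score J (X n \<omega>)"
  have cov_S: "has_cov_matrix (P n) (?S n) (resid_cov J)" if "n \<ge> 1" for n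
    using prob_space.has_cov_matrix_linear_image[OF P cov[OF that], of "resid_matrix J"]
    by (simp add: resid_score_eq resid_cov_eq[OF pd])
  have cov_u: "has_cov_matrix (P n) (\<lambda>\<omega>. u_vec (resid_cov J) (?S n \<omega>)) (schur_11_2 (resid_cov J))" if "n \<ge> 1" for n
    using prob_space.has_cov_matrix_linear_image[OF P cov_S[OF that], of "u_matrix (resid_cov J)"] C.S33
    by (simp add: u_vec_eq schur_11_2_eq[OF C.sym])
  have covs: "covar (P n) (\<lambda>\<omega>. u_vec (resid_cov J) (?S n \<omega>) $ i) (\<lambda>\<omega>. u_vec (resid_cov J) (?S n \<omega>) $ j) =
      schur_11_2 (resid_cov J) $ i $ j" if "n \<ge> 1" for n i j
    using cov_u[OF that] unfolding has_cov_matrix_def by blast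
  let ?T = "\<lambda>s. calpha_stat (resid_cov J) (resid_score J s)"
  have T_cont: "continuous_on UNIV ?T"
    unfolding resid_score_eq
    by (rule continuous_on_compose2[OF C.continuous_on_calpha_stat]) (auto intro!: continuous_intros)
  have T_meas [measurable]: "?T \<in> borel_measurable borel"
    by (rule borel_measurable_continuous_onI[OF T_cont])
  let ?mix = "mixture [(1/2 - arccos C.\<rho> / (2 * pi), chi_squared 1), (1/2, chi_squared 2), (arccos C.\<rho> / (2 * pi), chi_squared 3)]"
  \<comment> \<open>Only the first two local parameters vanish, while \<open>snd \<delta>\<close> is
    arbitrary. Le Cam's third lemma gives the limit law under this drift as a tilted normal
    law.\<close>
  have weak: "weak_conv_m (\<lambda>n. distr (E n \<delta>) borel (\<lambda>\<omega>. ?T (X n \<omega>))) ?mix"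
    if \<delta>: "\<delta> \<in> H" and null_\<delta>: "fst \<delta> $ 1 = 0" "fst \<delta> $ 2 = 0" for \<delta>
  proof -
    obtain n0 where n0: "1 \<le> n0" "\<And>n. n0 \<le> n \<Longrightarrow> xi_loc \<xi>0 \<delta> n \<in> \<Xi> \<and> theta_loc \<theta> \<delta> n \<in> \<Theta>"
    proof -
      have "finite {\<delta>}" "{\<delta>} \<subseteq> H"
        using \<delta> by auto
      from start[OF this] show ?thesis
        using that by blast
    qed
    interpret L: lr_expansion "\<lambda>n. P (n + n0)" "\<lambda>n. E (n + n0) \<delta>" "\<lambda>n. X (n + n0)" ?N "z \<delta>"
      by (rule lr[OF n0(1) \<delta> n0(2)])
    have XE [measurable]: "X (n + n0) \<in> borel_measurable (E (n + n0) \<delta>)" for n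
      using L.X[of n] by (simp add: L.sets_Q cong: measurable_cong_sets)
    have "t_of \<delta> $ Inl i = 0" for i
    proof -
      have "\<forall>i::3. t_of \<delta> $ Inl i = 0"
        by (simp add: forall_3 t_Inl null_\<delta>)
      then show ?thesis ..
    qed
    then have mix: "distr (density ?N (\<lambda>s. ennreal (exp (z \<delta> s)))) borel ?T = ?mix"
      unfolding z_def by (rule calpha_stat_mixture[OF pd N])
    have [measurable]: "z \<delta> \<in> borel_measurable borel"
      by (rule L.z)
    have dist: "real_distribution (distr (E (n + n0) \<delta>) borel (\<lambda>\<omega>. ?T (X (n + n0) \<omega>)))" for n
      by (intro prob_space.real_distribution_distr L.Q) measurable
    have "prob_space (density ?N (\<lambda>s. ennreal (exp (z \<delta> s))))"
      using exp_z[of \<delta>] by (intro prob_spaceI) (simp add: emeasure_density)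
    then have "real_distribution (distr (density ?N (\<lambda>s. ennreal (exp (z \<delta> s)))) borel ?T)"
      by (rule prob_space.real_distribution_distr) simp
    then have dist_mix: "real_distribution ?mix"
      by (simp only: mix)
    \<comment> \<open>Continuous ramps suffice as test functions; composed with the continuous
      statistic they are bounded continuous functions of the score.\<close>
    have "weak_conv_m (\<lambda>n. distr (E (n + n0) \<delta>) borel (\<lambda>\<omega>. ?T (X (n + n0) \<omega>))) ?mix"
    proof (rule integral_cts_step_conv_imp_weak_conv[OF dist dist_mix])
      fix x y :: real assume xy: "x < y"
      have cts: "continuous_on UNIV (cts_step x y)"
        by (rule uniformly_continuous_imp_continuous[OF cts_step_uniformly_continuous[OF xy]])
      have [measurable]: "cts_step x y \<in> borel_measurable borel"
        by (rule borel_measurable_continuous_onI[OF cts])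
      have "continuous_on UNIV (\<lambda>s. cts_step x y (?T s))"
        by (rule continuous_on_compose2[OF cts T_cont]) simp
      moreover have "\<bar>cts_step x y q\<bar> \<le> 1" for q
        using xy by (auto simp: cts_step_def)
      ultimately have "(\<lambda>n. \<integral>\<omega>. cts_step x y (?T (X (n + n0) \<omega>)) \<partial>E (n + n0) \<delta>) \<longlonglongrightarrow>
          (\<integral>s. cts_step x y (?T s) * exp (z \<delta> s) \<partial>?N)"
        by (intro L.le_cam_third_lemma) auto
      moreover have "(\<integral>s. cts_step x y (?T s) * exp (z \<delta> s) \<partial>?N) = integral\<^sup>L ?mix (cts_step x y)"
        unfolding mix[symmetric] by (subst integral_distr, simp, simp, subst integral_density) (simp_all add: mult.commute)
      ultimately show "(\<lambda>n. integral\<^sup>L (distr (E (n + n0) \<delta>) borel (\<lambda>\<omega>. ?T (X (n + n0) \<omega>))) (cts_step x y)) \<longlonglongrightarrow>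
          integral\<^sup>L ?mix (cts_step x y)"
        by (simp add: integral_distr)
    qed
    then show ?thesis
      unfolding weak_conv_m_def weak_conv_def by (auto intro: LIMSEQ_offset[where k=n0])
  qed
  show ?thesis
    unfolding Let_def
    unfolding C.v1_def[symmetric] C.v2_def[symmetric]
    unfolding C.\<rho>_def[symmetric]
    unfolding C.r_def[symmetric]
    unfolding C.\<Lambda>_def[symmetric]
    unfolding C.w1_def[symmetric] C.w2_def[symmetric] C.w3_def[symmetric]
    unfolding E_def[symmetric] P_def[symmetric] X_def[symmetric] H_def[symmetric]
  proof (intro conjI, goal_cases)
    case 1
    show ?case by (rule limit)
  next
    case 2
    show ?case by (simp add: t_Inl)
  next
    case 3
    show ?case using cov_S by blast
  next
    case 4
    show ?case using cov_u by blast
  next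
    case 5
    show ?case by (simp add: covs C.\<rho>_def flip: C.v1_def C.v2_def)
  next
    case 6
    show ?case by (rule C.cholesky)
  next
    case 7
    show ?case by (rule C.rho)
  next
    case 8
    show ?case
    proof (intro allI conjI impI, goal_cases)
      case (1 n \<omega>)
      show ?case by (rule C.w)
    next
      case (2 n \<omega>)
      show ?case by (rule C.w)
    next
      case (3 n \<omega>)
      then show ?case by (intro C.calpha_stat_cases) blast+
    next
      case (4 n \<omega>)
      then show ?case by (intro C.calpha_stat_cases) blast+
    next
      case (5 n \<omega>)
      then show ?case by (intro C.calpha_stat_cases C.third_sector) blast+
    next
      case (6 n \<omega>)
      then show ?case by (intro C.calpha_stat_cases) blast+
    next
      case (7 n \<omega>)
      then show ?case by (rule C.sectors_cover_positive)
    next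
      case (8 n \<omega>)
      then show ?case by (intro C.calpha_stat_cases) blast+
    next
      case (9 n \<omega>)
      show ?case by (rule cone_sectors_cover[OF C.r(1)])
    qed
  next
    case 9
    show ?case using weak by blast
  qed
qed

end
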